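(* Let $\mathfrak{g}$ be a Heisenberg algebra. Then for any positive integer $n$: (i) the center of $\mathfrak{f}^{n}(\mathfrak{g})$ is trivial; (ii) $\mathrm{Der}(\mathfrak{f}^{n}(\mathfrak{g}))=\mathfrak{f}^{n-1}(\mathrm{Der}(\mathfrak{f}(\mathfrak{g})))$ (up to isomorphism of Lie algebras) is complete, but $\mathfrak{f}^{n}(\mathfrak{g})$ is not complete; (iii) $[\mathrm{Der}(\mathfrak{f}^{n}(\mathfrak{g})),\mathrm{Der}(\mathfrak{f}^{n}(\mathfrak{g}))]\subseteq \mathrm{ad}(\mathfrak{f}^{n}(\mathfrak{g}))$; (iv) $\dim(\mathrm{Der}(\mathfrak{f}^{n}(\mathfrak{g})))-\dim(\mathfrak{f}^{n}(\mathfrak{g}))=1$.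
   Context: Lie algebras are finite dimensional over $\mathbb{C}$. A Lie algebra is complete if its center is trivial and all its derivations are inner. A Heisenberg algebra here is a Lie algebra $\mathfrak{g}$ with $[\mathfrak{g},\mathfrak{g}]=C(\mathfrak{g})$ and $\dim C(\mathfrak{g})=1$, where $C(\mathfrak{g})$ is the center. Equivalently, $\mathfrak{g}$ has dimension $2N+1$ for some positive integer $N$ and a basis $x_1,\dots,x_N,y_1,\dots,y_N,c$ with $[x_i,y_j]=\delta_{ij}c$ and $[x_i,x_j]=[y_i,y_j]=0$, $c$ central. The full graph of a Lie algebra $\mathfrak{a}$ is $\mathfrak{f}(\mathfrak{a})=\mathrm{Der}(\mathfrak{a})\oplus\mathfrak{a}$ (as a vector space) with bracket $[(s_1,a_1),(s_2,a_2)]=([s_1,s_2],\,s_1(a_2)-s_2(a_1)+[a_1,a_2])$. Inductively $\mathfrak{f}^0(\mathfrak{a})=\mathfrak{a}$ and $\mathfrak{f}^{n}(\mathfrak{a})=\mathfrak{f}(\mathfrak{f}^{n-1}(\mathfrak{a}))$. *)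

theory Defs
  imports Complex_Main "HOL-Library.Function_Algebras" "HOL-Library.Product_Plus"
begin

class complex_vector = ab_group_add +
  fixes scaleC :: "complex \<Rightarrow> 'a \<Rightarrow> 'a"  (infixr \<open>*\<^sub>C\<close> 75)
  assumes scaleC_add_right: "a *\<^sub>C (x + y) = a *\<^sub>C x + a *\<^sub>C y"
    and scaleC_add_left: "(a + b) *\<^sub>C x = a *\<^sub>C x + b *\<^sub>C x"
    and scaleC_scaleC: "a *\<^sub>C b *\<^sub>C x = (a * b) *\<^sub>C x"
    and scaleC_one: "1 *\<^sub>C x = x"

global_interpretation cvec: vector_space "scaleC :: complex \<Rightarrow> 'a \<Rightarrow> 'a::complex_vector"
  by unfold_locales (simp_all add: scaleC_add_right scaleC_add_left scaleC_scaleC scaleC_one)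

instantiation complex :: complex_vector
begin
definition scaleC_complex_def [simp]: "a *\<^sub>C x = a * (x::complex)"
instance by standard (simp_all add: algebra_simps)
end

instantiation "fun" :: (type, complex_vector) complex_vector
begin
definition scaleC_fun_def: "a *\<^sub>C f = (\<lambda>x. a *\<^sub>C f x)"
instance
  by standard
    (simp_all add: scaleC_fun_def fun_eq_iff scaleC_add_right scaleC_add_left scaleC_scaleC scaleC_one)
end

instantiation prod :: (complex_vector, complex_vector) complex_vector
begin
definition scaleC_prod_def: "a *\<^sub>C p = (a *\<^sub>C fst p, a *\<^sub>C snd p)"
instance
  by standard
    (simp_all add: scaleC_prod_def prod_eq_iff scaleC_add_right scaleC_add_left scaleC_scaleC scaleC_one)
end

definition finite_dimensional :: "'a::complex_vector set \<Rightarrow> bool" where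
  "finite_dimensional V \<longleftrightarrow> (\<exists>B. finite B \<and> V \<subseteq> cvec.span B)"

definition linear_on :: "'a::complex_vector set \<Rightarrow> ('a \<Rightarrow> 'b::complex_vector) \<Rightarrow> bool" where
  "linear_on V f \<longleftrightarrow>
     (\<forall>x\<in>V. \<forall>y\<in>V. f (x + y) = f x + f y) \<and> (\<forall>c. \<forall>x\<in>V. f (c *\<^sub>C x) = c *\<^sub>C f x)"

text \<open>
  A Lie algebra lives on a subspace of an ambient complex vector space; the values of the bracket
  outside that subspace are irrelevant.
\<close>

record 'a lie_alg =
  lcarrier :: "'a set"
  lbracket :: "'a \<Rightarrow> 'a \<Rightarrow> 'a"

definition lie_algebra :: "'a::complex_vector lie_alg \<Rightarrow> bool" where
  "lie_algebra L \<longleftrightarrow>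
     cvec.subspace (lcarrier L) \<and> finite_dimensional (lcarrier L) \<and>
     (\<forall>x\<in>lcarrier L. \<forall>y\<in>lcarrier L. lbracket L x y \<in> lcarrier L) \<and>
     (\<forall>x\<in>lcarrier L. linear_on (lcarrier L) (\<lambda>y. lbracket L x y)) \<and>
     (\<forall>y\<in>lcarrier L. linear_on (lcarrier L) (\<lambda>x. lbracket L x y)) \<and>
     (\<forall>x\<in>lcarrier L. lbracket L x x = 0) \<and>
     (\<forall>x\<in>lcarrier L. \<forall>y\<in>lcarrier L. \<forall>z\<in>lcarrier L.
        lbracket L x (lbracket L y z) + lbracket L y (lbracket L z x)
          + lbracket L z (lbracket L x y) = 0)"

definition lie_dim :: "'a::complex_vector lie_alg \<Rightarrow> nat" where
  "lie_dim L = cvec.dim (lcarrier L)"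

definition lie_center :: "'a::complex_vector lie_alg \<Rightarrow> 'a set" where
  "lie_center L = {x \<in> lcarrier L. \<forall>y\<in>lcarrier L. lbracket L x y = 0}"

definition lie_derived :: "'a::complex_vector lie_alg \<Rightarrow> 'a set" where
  "lie_derived L = cvec.span {lbracket L x y |x y. x \<in> lcarrier L \<and> y \<in> lcarrier L}"

definition lie_isomorphic :: "'a::complex_vector lie_alg \<Rightarrow> 'b::complex_vector lie_alg \<Rightarrow> bool"
    (infix \<open>\<cong>\<^sub>L\<close> 50) where
  "L \<cong>\<^sub>L M \<longleftrightarrow> (\<exists>f. bij_betw f (lcarrier L) (lcarrier M) \<and> linear_on (lcarrier L) f \<and>
     (\<forall>x\<in>lcarrier L. \<forall>y\<in>lcarrier L. f (lbracket L x y) = lbracket M (f x) (f y)))"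

definition heisenberg :: "'a::complex_vector lie_alg \<Rightarrow> bool" where
  "heisenberg L \<longleftrightarrow>
     lie_algebra L \<and> lie_derived L = lie_center L \<and> cvec.dim (lie_center L) = 1"

text \<open>
  Endomaps of the carrier are represented by functions on the ambient type that vanish off the
  carrier, so that equality and the pointwise vector space operations are the right ones.
\<close>

definition derivations :: "'a::complex_vector lie_alg \<Rightarrow> ('a \<Rightarrow> 'a) set" where
  "derivations L = {D.
     (\<forall>x\<in>lcarrier L. D x \<in> lcarrier L) \<and> (\<forall>x. x \<notin> lcarrier L \<longrightarrow> D x = 0) \<and>
     linear_on (lcarrier L) D \<and>
     (\<forall>x\<in>lcarrier L. \<forall>y\<in>lcarrier L.
        D (lbracket L x y) = lbracket L (D x) y + lbracket L x (D y))}"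

definition Der :: "'a::complex_vector lie_alg \<Rightarrow> ('a \<Rightarrow> 'a) lie_alg" where
  "Der L = \<lparr>lcarrier = derivations L, lbracket = (\<lambda>s t. (s \<circ> t) - (t \<circ> s))\<rparr>"

definition lie_ad :: "'a::complex_vector lie_alg \<Rightarrow> 'a \<Rightarrow> 'a \<Rightarrow> 'a" where
  "lie_ad L x = (\<lambda>y. if y \<in> lcarrier L then lbracket L x y else 0)"

definition lie_complete :: "'a::complex_vector lie_alg \<Rightarrow> bool" where
  "lie_complete L \<longleftrightarrow>
     lie_center L = {0} \<and> (\<forall>D\<in>derivations L. \<exists>x\<in>lcarrier L. D = lie_ad L x)"

definition full_graph :: "'a::complex_vector lie_alg \<Rightarrow> (('a \<Rightarrow> 'a) \<times> 'a) lie_alg" where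
  "full_graph L =
     \<lparr>lcarrier = derivations L \<times> lcarrier L,
      lbracket = (\<lambda>(s1, a1) (s2, a2).
        (lbracket (Der L) s1 s2, s1 a2 - s2 a1 + lbracket L a1 a2))\<rparr>"

text \<open>
  The ambient type changes with every application of \<^const>\<open>full_graph\<close>. To iterate, each
  Lie algebra is first replaced by an isomorphic copy inside the space of complex sequences. The
  copy exists by \<open>ex_coordinate_copy\<close> below; iterates are thus determined up to isomorphism.
\<close>

definition coordinate_copy :: "'a::complex_vector lie_alg \<Rightarrow> (nat \<Rightarrow> complex) lie_alg" where
  "coordinate_copy L = (SOME M. lie_algebra M \<and> M \<cong>\<^sub>L L)"

primrec full_graph_iter :: "nat \<Rightarrow> 'a::complex_vector lie_alg \<Rightarrow> (nat \<Rightarrow> complex) lie_alg" where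
  "full_graph_iter 0 L = coordinate_copy L"
| "full_graph_iter (Suc n) L = coordinate_copy (full_graph (full_graph_iter n L))"

lemma fun_diff_apply [simp]: "(f - g) x = f x - g x"
  by (simp add: fun_diff_def)

lemma scaleC_fun_apply [simp]: "(a *\<^sub>C f) x = a *\<^sub>C f x"
  by (simp add: scaleC_fun_def)

lemma scaleC_Pair [simp]: "a *\<^sub>C (x, y) = (a *\<^sub>C x, a *\<^sub>C y)"
  by (simp add: scaleC_prod_def)

lemma fst_scaleC [simp]: "fst (a *\<^sub>C p) = a *\<^sub>C fst p"
  and snd_scaleC [simp]: "snd (a *\<^sub>C p) = a *\<^sub>C snd p"
  by (simp_all add: scaleC_prod_def)

lemma linear_on_add: "linear_on V f \<Longrightarrow> x \<in> V \<Longrightarrow> y \<in> V \<Longrightarrow> f (x + y) = f x + f y"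
  and linear_on_scale: "linear_on V f \<Longrightarrow> x \<in> V \<Longrightarrow> f (c *\<^sub>C x) = c *\<^sub>C f x"
  by (auto simp: linear_on_def)

lemma linear_on_0:
  assumes "cvec.subspace V" "linear_on V f" shows "f 0 = 0"
  using linear_on_scale[OF assms(2) cvec.subspace_0[OF assms(1)], of 0] by simp

lemma linear_on_diff:
  assumes "cvec.subspace V" "linear_on V f" "x \<in> V" "y \<in> V" shows "f (x - y) = f x - f y"
  using linear_on_add[OF assms(2), of "x - y" y] assms cvec.subspace_diff[of V x y] by simp

lemma linear_on_span_image:
  assumes "cvec.subspace V" "linear_on V f" "B \<subseteq> V" "x \<in> cvec.span B"
  shows "f x \<in> cvec.span (f ` B)"
proof -
  have "x \<in> V \<and> f x \<in> cvec.span (f ` B)"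
    using assms(4)
  proof (induction rule: cvec.span_induct_alt)
    case base
    then show ?case
      using assms by (simp add: linear_on_0 cvec.subspace_0 cvec.span_zero)
  next
    case (step c x y)
    then have x: "x \<in> V" and cx: "c *\<^sub>C x \<in> V"
      using assms by (auto intro: cvec.subspace_scale)
    show ?case
      using step x cx assms
      by (auto simp: linear_on_add[OF assms(2)] linear_on_scale[OF assms(2)]
          intro!: cvec.subspace_add[OF assms(1)] cvec.span_add cvec.span_scale
          intro: cvec.span_base)
  qed
  then show ?thesis ..
qed

lemma finite_basisE:
  assumes "cvec.subspace V" "finite_dimensional V"
  obtains B where "finite B" "B \<subseteq> V" "cvec.independent B" "cvec.span B = V"
proof -
  obtain C where C: "finite C" "V \<subseteq> cvec.span C"
    using assms(2) by (auto simp: finite_dimensional_def)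
  obtain B where B: "B \<subseteq> V" "cvec.independent B" "V \<subseteq> cvec.span B"
    by (rule cvec.basis_exists)
  have "finite B"
    using cvec.independent_span_bound[OF C(1) B(2) subset_trans[OF B(1) C(2)]] by simp
  moreover have "cvec.span B = V"
    using cvec.span_minimal[OF B(1) assms(1)] B(3) by simp
  ultimately show ?thesis
    using that[OF _ B(1,2)] by simp
qed

lemma finite_dimensional_subset: "finite_dimensional W \<Longrightarrow> V \<subseteq> W \<Longrightarrow> finite_dimensional V"
  by (auto simp: finite_dimensional_def)

lemma finite_dimensional_image:
  assumes "cvec.subspace V" "finite_dimensional V" "linear_on V f"
  shows "finite_dimensional (f ` V)"
proof -
  obtain B where B: "finite B" "B \<subseteq> V" "cvec.span B = V"
    using finite_basisE[OF assms(1,2)] by metis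
  then have "f ` V \<subseteq> cvec.span (f ` B)"
    using linear_on_span_image[OF assms(1,3) B(2)] by blast
  then show ?thesis
    using B(1) by (auto simp: finite_dimensional_def)
qed

lemma finite_dimensional_sums:
  assumes "finite_dimensional V" "finite_dimensional W"
  shows "finite_dimensional {x + y |x y. x \<in> V \<and> y \<in> W}"
proof -
  obtain B C where BC: "finite B" "V \<subseteq> cvec.span B" "finite C" "W \<subseteq> cvec.span C"
    using assms by (auto simp: finite_dimensional_def)
  have "{x + y |x y. x \<in> V \<and> y \<in> W} \<subseteq> cvec.span (B \<union> C)"
    using BC by (auto simp: cvec.span_Un)
  then show ?thesis
    using BC by (auto simp: finite_dimensional_def)
qed

lemma subspace_Times:
  "cvec.subspace V \<Longrightarrow> cvec.subspace W \<Longrightarrow> cvec.subspace (V \<times> W)"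
  by (auto simp: cvec.subspace_def zero_prod_def)

lemma finite_dimensional_Times:
  assumes "cvec.subspace V" "finite_dimensional V" "cvec.subspace W" "finite_dimensional W"
  shows "finite_dimensional (V \<times> W)"
proof -
  have "finite_dimensional ((\<lambda>x. (x, 0)) ` V :: ('a \<times> 'b) set)"
    using assms by (intro finite_dimensional_image) (auto simp: linear_on_def)
  moreover have "finite_dimensional ((\<lambda>y. (0, y)) ` W :: ('a \<times> 'b) set)"
    using assms by (intro finite_dimensional_image) (auto simp: linear_on_def)
  ultimately have "finite_dimensional
      {p + q |p q. p \<in> (\<lambda>x. (x, 0)) ` V \<and> q \<in> (\<lambda>y. (0, y)) ` W}"
    by (rule finite_dimensional_sums)
  then show ?thesis
  proof (rule finite_dimensional_subset, intro subsetI)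
    fix p assume "p \<in> V \<times> W"
    then have "p = (fst p, 0) + (0, snd p)" "fst p \<in> V" "snd p \<in> W"
      by auto
    then show "p \<in> {p + q |p q. p \<in> (\<lambda>x. (x, 0)) ` V \<and> q \<in> (\<lambda>y. (0, y)) ` W}"
      by blast
  qed
qed

lemma lie_algebraD:
  assumes "lie_algebra L"
  shows "cvec.subspace (lcarrier L)" "finite_dimensional (lcarrier L)"
    and "x \<in> lcarrier L \<Longrightarrow> y \<in> lcarrier L \<Longrightarrow> lbracket L x y \<in> lcarrier L"
    and "x \<in> lcarrier L \<Longrightarrow> linear_on (lcarrier L) (\<lambda>y. lbracket L x y)"
    and "y \<in> lcarrier L \<Longrightarrow> linear_on (lcarrier L) (\<lambda>x. lbracket L x y)"
    and "x \<in> lcarrier L \<Longrightarrow> lbracket L x x = 0"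
    and "x \<in> lcarrier L \<Longrightarrow> y \<in> lcarrier L \<Longrightarrow> z \<in> lcarrier L \<Longrightarrow>
      lbracket L x (lbracket L y z) + lbracket L y (lbracket L z x)
        + lbracket L z (lbracket L x y) = 0"
  using assms by (auto simp: lie_algebra_def)

lemma derivationsD:
  assumes "D \<in> derivations L"
  shows "x \<in> lcarrier L \<Longrightarrow> D x \<in> lcarrier L" "x \<notin> lcarrier L \<Longrightarrow> D x = 0"
    and "linear_on (lcarrier L) D"
    and "x \<in> lcarrier L \<Longrightarrow> y \<in> lcarrier L \<Longrightarrow>
      D (lbracket L x y) = lbracket L (D x) y + lbracket L x (D y)"
  using assms by (auto simp: derivations_def)

lemma lbracket_add_right:
  assumes "lie_algebra L" "x \<in> lcarrier L" "y \<in> lcarrier L" "z \<in> lcarrier L"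
  shows "lbracket L x (y + z) = lbracket L x y + lbracket L x z"
  using lie_algebraD(4)[OF assms(1,2)] assms by (auto simp: linear_on_def)

lemma lbracket_add_left:
  assumes "lie_algebra L" "x \<in> lcarrier L" "y \<in> lcarrier L" "z \<in> lcarrier L"
  shows "lbracket L (x + y) z = lbracket L x z + lbracket L y z"
  using lie_algebraD(5)[OF assms(1,4)] assms by (auto simp: linear_on_def)

lemma lbracket_scale_right:
  assumes "lie_algebra L" "x \<in> lcarrier L" "y \<in> lcarrier L"
  shows "lbracket L x (c *\<^sub>C y) = c *\<^sub>C lbracket L x y"
  using lie_algebraD(4)[OF assms(1,2)] assms by (auto simp: linear_on_def)

lemma lbracket_scale_left:
  assumes "lie_algebra L" "x \<in> lcarrier L" "y \<in> lcarrier L"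
  shows "lbracket L (c *\<^sub>C x) y = c *\<^sub>C lbracket L x y"
  using lie_algebraD(5)[OF assms(1,3)] assms by (auto simp: linear_on_def)

lemma lbracket_diff_right:
  assumes "lie_algebra L" "x \<in> lcarrier L" "y \<in> lcarrier L" "z \<in> lcarrier L"
  shows "lbracket L x (y - z) = lbracket L x y - lbracket L x z"
  using linear_on_diff[OF lie_algebraD(1)[OF assms(1)] lie_algebraD(4)[OF assms(1,2)] assms(3,4)] .

lemma lbracket_diff_left:
  assumes "lie_algebra L" "x \<in> lcarrier L" "y \<in> lcarrier L" "z \<in> lcarrier L"
  shows "lbracket L (x - y) z = lbracket L x z - lbracket L y z"
  using linear_on_diff[OF lie_algebraD(1)[OF assms(1)] lie_algebraD(5)[OF assms(1,4)] assms(2,3)] .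

lemma lbracket_anti:
  assumes "lie_algebra L" "x \<in> lcarrier L" "y \<in> lcarrier L"
  shows "lbracket L x y = - lbracket L y x"
proof -
  have xy: "x + y \<in> lcarrier L"
    using assms lie_algebraD(1)[OF assms(1)] by (simp add: cvec.subspace_add)
  have "0 = lbracket L (x + y) (x + y)"
    using lie_algebraD(6)[OF assms(1) xy] by simp
  also have "\<dots> = lbracket L x y + lbracket L y x"
    using assms xy lie_algebraD(6)[OF assms(1)]
    by (simp add: lbracket_add_left lbracket_add_right)
  finally show ?thesis
    by (simp add: eq_neg_iff_add_eq_0)
qed

lemma ex_coordinate_copy:
  fixes L :: "'a::complex_vector lie_alg"
  assumes L: "lie_algebra L"
  shows "\<exists>M :: (nat \<Rightarrow> complex) lie_alg. lie_algebra M \<and> M \<cong>\<^sub>L L"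
proof -
  define V where "V = lcarrier L"
  note sub = lie_algebraD(1)[OF L, folded V_def]
  obtain B where B: "finite B" "B \<subseteq> V" "cvec.independent B" "cvec.span B = V"
    using finite_basisE lie_algebraD(1,2)[OF L] V_def by metis
  obtain h where h: "bij_betw h {0..<card B} B"
    using ex_bij_betw_nat_finite[OF B(1)] by blast
  define f :: "'a \<Rightarrow> nat \<Rightarrow> complex" where
    "f = (\<lambda>x i. if i < card B then cvec.representation B x (h i) else 0)"
  have lin: "linear_on V f"
    using B by (auto simp: linear_on_def f_def fun_eq_iff cvec.representation_add
        cvec.representation_scale)
  have inj: "inj_on f V"
  proof (rule inj_onI)
    fix x y assume xy: "x \<in> V" "y \<in> V" "f x = f y"
    have "cvec.representation B x b = cvec.representation B y b" if "b \<in> B" for b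
    proof -
      have "b \<in> h ` {0..<card B}"
        using that bij_betw_imp_surj_on[OF h] by simp
      then obtain i where i: "i < card B" "b = h i"
        by auto
      then show ?thesis
        using fun_cong[OF xy(3), of i] by (simp add: f_def)
    qed
    then have "(\<Sum>b\<in>B. cvec.representation B x b *\<^sub>C b) = (\<Sum>b\<in>B. cvec.representation B y b *\<^sub>C b)"
      by (intro sum.cong) auto
    moreover have "(\<Sum>b\<in>B. cvec.representation B z b *\<^sub>C b) = z" if "z \<in> V" for z
      using cvec.sum_representation_eq[OF B(3) _ B(1) subset_refl] that B(4) by blast
    ultimately show "x = y"
      using xy(1,2) by simp
  qed
  define g where "g = inv_into V f"
  define M where "M = \<lparr>lcarrier = f ` V, lbracket = (\<lambda>u v. f (lbracket L (g u) (g v)))\<rparr>"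
  have gf [simp]: "g (f x) = x" if "x \<in> V" for x
    unfolding g_def using inj that by (rule inv_into_f_f)
  note f_add = linear_on_add[OF lin, symmetric] and f_scale = linear_on_scale[OF lin, symmetric]
  note f_zero = linear_on_0[OF sub lin]
  note V_closed = cvec.subspace_add[OF sub] cvec.subspace_scale[OF sub] cvec.subspace_0[OF sub]
    lie_algebraD(3)[OF L, folded V_def]
  note bil = lbracket_add_left[OF L, folded V_def] lbracket_add_right[OF L, folded V_def]
    lbracket_scale_left[OF L, folded V_def] lbracket_scale_right[OF L, folded V_def]
  have "cvec.subspace (f ` V)"
    unfolding cvec.subspace_def
  proof (intro conjI ballI allI)
    show "0 \<in> f ` V"
      using f_zero V_closed(3) by (metis imageI)
  qed (auto simp: f_add f_scale V_closed)
  moreover have "finite_dimensional (f ` V)"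
    using finite_dimensional_image[OF sub _ lin] lie_algebraD(2)[OF L] by (simp add: V_def)
  ultimately have subM: "cvec.subspace (lcarrier M)" "finite_dimensional (lcarrier M)"
    by (simp_all add: M_def)
  have br: "lbracket M (f x) (f y) = f (lbracket L x y)"
    if "x \<in> V" "y \<in> V" for x y
    using that by (simp add: M_def)
  have carrM: "lcarrier M = f ` V"
    by (simp add: M_def)
  have "lie_algebra M"
    unfolding lie_algebra_def linear_on_def carrM ball_simps
  proof (intro conjI ballI allI)
    fix x y z assume xyz: "x \<in> V" "y \<in> V" "z \<in> V"
    then show "lbracket M (f x) (lbracket M (f y) (f z)) + lbracket M (f y) (lbracket M (f z) (f x))
        + lbracket M (f z) (lbracket M (f x) (f y)) = 0"
      using lie_algebraD(7)[OF L, folded V_def, OF xyz]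
      by (simp add: br f_add V_closed f_zero)
  qed (use subM lie_algebraD(6)[OF L, folded V_def] in
      \<open>simp_all add: carrM br f_add f_scale V_closed bil f_zero\<close>)
  moreover have "M \<cong>\<^sub>L L"
    unfolding lie_isomorphic_def
  proof (intro exI[of _ g] conjI)
    show "bij_betw g (lcarrier M) (lcarrier L)"
      unfolding g_def M_def using bij_betw_inv_into[OF inj_on_imp_bij_betw[OF inj]]
      by (simp add: V_def)
    show "linear_on (lcarrier M) g"
      unfolding linear_on_def carrM ball_simps by (simp add: f_add f_scale V_closed)
    show "\<forall>x\<in>lcarrier M. \<forall>y\<in>lcarrier M. g (lbracket M x y) = lbracket L (g x) (g y)"
      unfolding carrM ball_simps by (simp add: br V_closed)
  qed
  ultimately show ?thesis
    by blast
qed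

lemma coordinate_copy:
  assumes "lie_algebra L"
  shows "lie_algebra (coordinate_copy L)" "coordinate_copy L \<cong>\<^sub>L L"
  using someI_ex[OF ex_coordinate_copy[OF assms]] by (simp_all add: coordinate_copy_def)

lemma subspace_derivations:
  assumes L: "lie_algebra L"
  shows "cvec.subspace (derivations L)"
proof -
  note closed = cvec.subspace_0[OF lie_algebraD(1)[OF L]] cvec.subspace_add[OF lie_algebraD(1)[OF L]]
    cvec.subspace_scale[OF lie_algebraD(1)[OF L]] lie_algebraD(3)[OF L]
  have zl: "lbracket L 0 y = 0" and zr: "lbracket L y 0 = 0" if "y \<in> lcarrier L" for y
    using linear_on_0[OF lie_algebraD(1)[OF L] lie_algebraD(5)[OF L that]]
      linear_on_0[OF lie_algebraD(1)[OF L] lie_algebraD(4)[OF L that]] by auto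
  show ?thesis
    unfolding cvec.subspace_def
  proof (intro conjI ballI allI)
    show "0 \<in> derivations L"
      by (auto simp: derivations_def linear_on_def closed zl zr)
    show "D + E \<in> derivations L" if "D \<in> derivations L" "E \<in> derivations L" for D E
      using that
      by (auto simp: derivations_def linear_on_def closed lbracket_add_left[OF L]
          lbracket_add_right[OF L] scaleC_add_right)
    show "c *\<^sub>C D \<in> derivations L" if "D \<in> derivations L" for c D
      using that
      by (auto simp: derivations_def linear_on_def closed lbracket_scale_left[OF L]
          lbracket_scale_right[OF L] scaleC_add_right mult.commute)
  qed
qed

lemma finite_dimensional_derivations:
  fixes L :: "'a::complex_vector lie_alg"
  assumes L: "lie_algebra L"
  shows "finite_dimensional (derivations L)"
proof -
  define V where "V = lcarrier L"
  note sub = lie_algebraD(1)[OF L, folded V_def]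
  obtain B where B: "finite B" "B \<subseteq> V" "cvec.independent B" "cvec.span B = V"
    using finite_basisE lie_algebraD(1,2)[OF L] V_def by metis
  define r where "r = cvec.representation B"
  have rsum: "(\<Sum>b\<in>B. r x b *\<^sub>C b) = x" if "x \<in> V" for x
    unfolding r_def using cvec.sum_representation_eq[OF B(3) _ B(1) subset_refl] that B(4) by metis
  define E :: "'a \<times> 'a \<Rightarrow> 'a \<Rightarrow> 'a" where
    "E = (\<lambda>(b, c) x. if x \<in> V then r x b *\<^sub>C c else 0)"
  have lin_sum: "D (\<Sum>b\<in>A. k b *\<^sub>C b) = (\<Sum>b\<in>A. k b *\<^sub>C D b)"
    if "D \<in> derivations L" "A \<subseteq> V" "finite A" for D k and A :: "'a set"
    using that(3,2)
  proof (induction A rule: finite_induct)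
    case empty
    then show ?case
      using linear_on_0[OF sub] derivationsD(3)[OF that(1)] by (simp add: V_def)
  next
    case (insert x A)
    have "(\<Sum>b\<in>A. k b *\<^sub>C b) \<in> V" "x \<in> V" "k x *\<^sub>C x \<in> V"
      using insert by (auto intro!: cvec.subspace_sum[OF sub] cvec.subspace_scale[OF sub])
    then show ?case
      using insert linear_on_add[OF derivationsD(3)[OF that(1)]]
        linear_on_scale[OF derivationsD(3)[OF that(1)]] by (simp add: V_def)
  qed
  have "D \<in> cvec.span (E ` (B \<times> B))" if D: "D \<in> derivations L" for D
  proof -
    have "D = (\<Sum>p\<in>B \<times> B. r (D (fst p)) (snd p) *\<^sub>C E p)"
    proof
      fix x
      have app: "(\<Sum>p\<in>A. r (D (fst p)) (snd p) *\<^sub>C E p) x = (\<Sum>p\<in>A. r (D (fst p)) (snd p) *\<^sub>C E p x)"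
        for A
        by (induction A rule: infinite_finite_induct) auto
      show "D x = (\<Sum>p\<in>B \<times> B. r (D (fst p)) (snd p) *\<^sub>C E p) x"
      proof (cases "x \<in> V")
        case True
        have "D x = D (\<Sum>b\<in>B. r x b *\<^sub>C b)"
          using rsum[OF True] by simp
        also have "\<dots> = (\<Sum>b\<in>B. r x b *\<^sub>C D b)"
          by (rule lin_sum[OF D B(2,1)])
        also have "\<dots> = (\<Sum>b\<in>B. r x b *\<^sub>C (\<Sum>c\<in>B. r (D b) c *\<^sub>C c))"
          using B(2) derivationsD(1)[OF D] by (intro sum.cong refl) (auto simp: rsum V_def)
        also have "\<dots> = (\<Sum>b\<in>B. \<Sum>c\<in>B. r (D b) c *\<^sub>C E (b, c) x)"
          using True by (simp add: E_def cvec.scale_sum_right mult.commute)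
        also have "\<dots> = (\<Sum>p\<in>B \<times> B. r (D (fst p)) (snd p) *\<^sub>C E p x)"
          by (simp add: sum.cartesian_product case_prod_beta)
        finally show ?thesis
          by (simp add: app)
      next
        case False
        then have "\<And>p. E p x = 0"
          by (simp add: E_def case_prod_beta)
        moreover have "D x = 0"
          using derivationsD(2)[OF D] False by (simp add: V_def)
        ultimately show ?thesis
          by (simp add: app)
      qed
    qed
    moreover have "\<dots> \<in> cvec.span (E ` (B \<times> B))"
      by (intro cvec.span_sum cvec.span_scale cvec.span_base imageI)
    ultimately show ?thesis
      by simp
  qed
  then show ?thesis
    unfolding finite_dimensional_def using B(1) by (intro exI[of _ "E ` (B \<times> B)"]) auto
qed

lemma derivation_linear:
  assumes L: "lie_algebra L" and F: "F \<in> derivations L"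
  shows "F x \<in> lcarrier L"
    and "x \<in> lcarrier L \<Longrightarrow> y \<in> lcarrier L \<Longrightarrow> F (x + y) = F x + F y"
    and "x \<in> lcarrier L \<Longrightarrow> y \<in> lcarrier L \<Longrightarrow> F (x - y) = F x - F y"
    and "x \<in> lcarrier L \<Longrightarrow> F (c *\<^sub>C x) = c *\<^sub>C F x"
    and "F 0 = 0"
proof -
  note sub = lie_algebraD(1)[OF L] and lin = derivationsD(3)[OF F]
  show "F x \<in> lcarrier L"
    using derivationsD(1,2)[OF F, of x] cvec.subspace_0[OF sub] by metis
  show "x \<in> lcarrier L \<Longrightarrow> y \<in> lcarrier L \<Longrightarrow> F (x + y) = F x + F y"
    by (rule linear_on_add[OF lin])
  show "x \<in> lcarrier L \<Longrightarrow> y \<in> lcarrier L \<Longrightarrow> F (x - y) = F x - F y"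
    by (rule linear_on_diff[OF sub lin])
  show "x \<in> lcarrier L \<Longrightarrow> F (c *\<^sub>C x) = c *\<^sub>C F x"
    by (rule linear_on_scale[OF lin])
  show "F 0 = 0"
    by (rule linear_on_0[OF sub lin])
qed

lemma derivations_commutator:
  assumes L: "lie_algebra L" and D: "D \<in> derivations L" and E: "E \<in> derivations L"
  shows "(D \<circ> E) - (E \<circ> D) \<in> derivations L"
proof -
  note sub = lie_algebraD(1)[OF L]
  note DL = derivation_linear[OF L D] and EL = derivation_linear[OF L E]
  note closed = cvec.subspace_diff[OF sub] lie_algebraD(3)[OF L]
  show ?thesis
    unfolding derivations_def mem_Collect_eq linear_on_def
  proof (intro conjI ballI allI impI)
    fix x y assume xy: "x \<in> lcarrier L" "y \<in> lcarrier L"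
    show "((D \<circ> E) - (E \<circ> D)) (lbracket L x y) =
        lbracket L (((D \<circ> E) - (E \<circ> D)) x) y + lbracket L x (((D \<circ> E) - (E \<circ> D)) y)"
      using xy by (simp add: derivationsD(4)[OF D] derivationsD(4)[OF E] DL(1,2) EL(1,2) closed
          lbracket_diff_left[OF L] lbracket_diff_right[OF L])
  qed (simp_all add: DL EL closed derivationsD(2)[OF D] derivationsD(2)[OF E]
      cvec.scale_right_diff_distrib)
qed

lemma lie_algebra_Der:
  assumes L: "lie_algebra L"
  shows "lie_algebra (Der L)"
proof -
  note lin = derivation_linear[OF L]
  have carr: "lcarrier (Der L) = derivations L"
    and br: "lbracket (Der L) s t = (s \<circ> t) - (t \<circ> s)" for s t
    by (simp_all add: Der_def)
  show ?thesis
    unfolding lie_algebra_def carr br linear_on_def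
    by (intro conjI ballI allI)
      (simp_all add: subspace_derivations[OF L] finite_dimensional_derivations[OF L]
        derivations_commutator[OF L] fun_eq_iff lin cvec.scale_right_diff_distrib)
qed

lemma lie_algebra_full_graph:
  assumes L: "lie_algebra L"
  shows "lie_algebra (full_graph L)"
proof -
  note sub = lie_algebraD(1)[OF L]
  note D = lie_algebra_Der[OF L]
  have Dsub: "cvec.subspace (derivations L)"
    by (rule subspace_derivations[OF L])
  have carr: "lcarrier (full_graph L) = derivations L \<times> lcarrier L"
    and br: "lbracket (full_graph L) (s, a) (t, b) =
      ((s \<circ> t) - (t \<circ> s), s b - t a + lbracket L a b)" for s t a b
    by (simp_all add: full_graph_def Der_def)
  have Dcarr: "lcarrier (Der L) = derivations L"
    and Dbr: "lbracket (Der L) s t = (s \<circ> t) - (t \<circ> s)" for s t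
    by (simp_all add: Der_def)
  note add = derivation_linear(2)[OF L] and diff = derivation_linear(3)[OF L]
    and scale = derivation_linear(4)[OF L] and dc = derivation_linear(1)[OF L]
    and der = derivationsD(4)
  note closed = cvec.subspace_add[OF sub] cvec.subspace_diff[OF sub] lie_algebraD(3)[OF L]
  note Dclosed = cvec.subspace_add[OF Dsub] cvec.subspace_scale[OF Dsub]
    derivations_commutator[OF L]
  note bil = lbracket_add_left[OF L] lbracket_add_right[OF L] lbracket_diff_right[OF L]
    lbracket_scale_left[OF L] lbracket_scale_right[OF L]
  show ?thesis
    unfolding lie_algebra_def linear_on_def
  proof (intro conjI ballI allI)
    show "cvec.subspace (lcarrier (full_graph L))"
      unfolding carr by (rule subspace_Times[OF Dsub sub])
    show "finite_dimensional (lcarrier (full_graph L))"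
      unfolding carr
      by (rule finite_dimensional_Times[OF Dsub finite_dimensional_derivations[OF L] sub
            lie_algebraD(2)[OF L]])
  next
    fix p q assume "p \<in> lcarrier (full_graph L)" "q \<in> lcarrier (full_graph L)"
    then show "lbracket (full_graph L) p q \<in> lcarrier (full_graph L)"
      by (auto simp: carr br dc closed Dclosed)
  next
    fix p q r assume pqr: "p \<in> lcarrier (full_graph L)" "q \<in> lcarrier (full_graph L)"
      "r \<in> lcarrier (full_graph L)"
    obtain s a t b u c where e: "p = (s, a)" "q = (t, b)" "r = (u, c)"
      by (metis prod.exhaust)
    have m: "s \<in> derivations L" "t \<in> derivations L" "u \<in> derivations L"
      "a \<in> lcarrier L" "b \<in> lcarrier L" "c \<in> lcarrier L"
      using pqr by (auto simp: e carr)
    have "(s \<circ> (t + u)) - ((t + u) \<circ> s) = ((s \<circ> t) - (t \<circ> s)) + ((s \<circ> u) - (u \<circ> s))"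
      using lbracket_add_right[OF D, of s t u] m by (simp add: Dbr Dcarr)
    with m show "lbracket (full_graph L) p (q + r) =
        lbracket (full_graph L) p q + lbracket (full_graph L) p r"
      by (simp add: e br bil add)
    have "((t + u) \<circ> s) - (s \<circ> (t + u)) = ((t \<circ> s) - (s \<circ> t)) + ((u \<circ> s) - (s \<circ> u))"
      using lbracket_add_left[OF D, of t u s] m by (simp add: Dbr Dcarr)
    with m show "lbracket (full_graph L) (q + r) p =
        lbracket (full_graph L) q p + lbracket (full_graph L) r p"
      by (simp add: e br bil add)
    have 1: "((s \<circ> ((t \<circ> u) - (u \<circ> t))) - (((t \<circ> u) - (u \<circ> t)) \<circ> s))
        + ((t \<circ> ((u \<circ> s) - (s \<circ> u))) - (((u \<circ> s) - (s \<circ> u)) \<circ> t))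
        + ((u \<circ> ((s \<circ> t) - (t \<circ> s))) - (((s \<circ> t) - (t \<circ> s)) \<circ> u)) = 0"
      using lie_algebraD(7)[OF D, of s t u] m by (simp add: Dbr Dcarr)
    have anti: "lbracket L (s b) c = - lbracket L c (s b)"
      "lbracket L (t c) a = - lbracket L a (t c)"
      "lbracket L (u a) b = - lbracket L b (u a)"
      using lbracket_anti[OF L dc[OF m(1), of b] m(6)] lbracket_anti[OF L dc[OF m(2), of c] m(4)]
        lbracket_anti[OF L dc[OF m(3), of a] m(5)] by blast+
    have J: "lbracket L a (lbracket L b c) =
        - lbracket L b (lbracket L c a) - lbracket L c (lbracket L a b)"
      using eq_neg_iff_add_eq_0[THEN iffD2, OF lie_algebraD(7)[OF L m(4-6), unfolded add.assoc]]
      by simp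
    have 2: "s (t c - u b + lbracket L b c) - (t (u a) - u (t a)) + lbracket L a (t c - u b + lbracket L b c)
        + (t (u a - s c + lbracket L c a) - (u (s b) - s (u b)) + lbracket L b (u a - s c + lbracket L c a))
        + (u (s b - t a + lbracket L a b) - (s (t c) - t (s c)) + lbracket L c (s b - t a + lbracket L a b))
        = 0"
      using m by (simp add: bil add diff der dc closed anti J)
    show "lbracket (full_graph L) p (lbracket (full_graph L) q r)
        + lbracket (full_graph L) q (lbracket (full_graph L) r p)
        + lbracket (full_graph L) r (lbracket (full_graph L) p q) = 0"
      using 1 2 by (simp add: e br zero_prod_def)
  next
    fix p q k assume pq: "p \<in> lcarrier (full_graph L)" "q \<in> lcarrier (full_graph L)"
    obtain s a t b where e: "p = (s, a)" "q = (t, b)"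
      by (metis prod.exhaust)
    have m: "s \<in> derivations L" "t \<in> derivations L" "a \<in> lcarrier L" "b \<in> lcarrier L"
      using pq by (auto simp: e carr)
    have "(s \<circ> (k *\<^sub>C t)) - ((k *\<^sub>C t) \<circ> s) = k *\<^sub>C ((s \<circ> t) - (t \<circ> s))"
      using lbracket_scale_right[OF D, of s t k] m by (simp add: Dbr Dcarr)
    with m show "lbracket (full_graph L) p (k *\<^sub>C q) = k *\<^sub>C lbracket (full_graph L) p q"
      by (simp add: e br bil scale scaleC_add_right cvec.scale_right_diff_distrib)
    have "((k *\<^sub>C t) \<circ> s) - (s \<circ> (k *\<^sub>C t)) = k *\<^sub>C ((t \<circ> s) - (s \<circ> t))"
      using lbracket_scale_left[OF D, of t s k] m by (simp add: Dbr Dcarr)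
    with m show "lbracket (full_graph L) (k *\<^sub>C q) p = k *\<^sub>C lbracket (full_graph L) q p"
      by (simp add: e br bil scale scaleC_add_right cvec.scale_right_diff_distrib)
    show "lbracket (full_graph L) p p = 0"
      using m lie_algebraD(6)[OF L] by (simp add: e br zero_prod_def)
  qed
qed

lemma full_graph_iter:
  assumes "lie_algebra L"
  shows "lie_algebra (full_graph_iter n L)"
    and "full_graph_iter 0 L \<cong>\<^sub>L L"
    and "full_graph_iter (Suc n) L \<cong>\<^sub>L full_graph (full_graph_iter n L)"
proof -
  show *: "lie_algebra (full_graph_iter n L)" for n
    by (induction n) (simp_all add: assms coordinate_copy(1) lie_algebra_full_graph)
  show "full_graph_iter 0 L \<cong>\<^sub>L L"
    and "full_graph_iter (Suc n) L \<cong>\<^sub>L full_graph (full_graph_iter n L)"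
    by (simp_all add: assms * coordinate_copy(2) lie_algebra_full_graph)
qed

end

theory Submission
  imports Defs
begin

text \<open>
  Call \<open>L\<close> almost complete if its center is zero, \<open>Der L\<close> is complete, and \<open>ad L\<close> has codimension one
  in \<open>Der L\<close> and contains all commutators of \<open>Der L\<close>. Everything that the theorem says about the
  center, completeness, commutators and dimensions follows from this property. So it is enough
  that the full graph of a Heisenberg algebra is almost complete, and that the full graph of an
  almost complete \<open>L\<close> is again almost complete with \<open>Der (full_graph L) \<cong>\<^sub>L full_graph (Der L)\<close>.

  Both facts come from one principle (locale \<open>complete_hull\<close>): if \<open>L\<close> is embedded in a complete Lie
  algebra \<open>K\<close> with trivial centralizer, contains the commutators of \<open>K\<close>, has codimension one, and all
  derivations of \<open>L\<close> are induced by elements of \<open>K\<close>, then \<open>K \<cong>\<^sub>L Der L\<close> and \<open>L\<close> is almost complete.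

  For the iteration step, \<open>(s, x) \<mapsto> (s, s + ad x)\<close> identifies the full graph of a centerless \<open>L\<close> with the
  pairs in \<open>Der L \<times> Der L\<close> whose difference lies in \<open>ad L\<close>. It contains two commuting copies of \<open>L\<close>,
  each the centralizer of the other. Hence a derivation preserves both, restricts to a pair of
  derivations of \<open>L\<close>, and is determined by this pair (\<open>full_graph_derivation\<close>). So the
  derivation algebra is \<open>Der L \<times> Der L\<close>, which is \<open>full_graph (Der L)\<close> when \<open>Der L\<close> is complete
  (\<open>full_graph_hull\<close>).

  For the start, let \<open>V\<close> be a complement of the center in a Heisenberg algebra, with the symplectic form
  \<open>\<omega>\<close> given by the bracket. The full graph is then the semidirect product of \<open>sp(V) \<oplus> \<complex>\<close> with
  a Heisenberg algebra on \<open>V \<oplus> V\<close>, where the two copies of \<open>V\<close> are isotropic and paired by \<open>\<omega>\<close>, and the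
  factor \<open>\<complex>\<close> scales both copies. The hull is obtained by allowing the copies to be scaled
  independently. That all derivations from the full graph to this hull are inner
  (\<open>cocycle_inner\<close>) follows from the grading by the Euler element and a Schur lemma for transvections. It
  implies the completeness of the hull as well.
\<close>

section \<open>Homomorphisms, isomorphisms and inner derivations\<close>

definition lie_hom ::
    "('a::complex_vector \<Rightarrow> 'b::complex_vector) \<Rightarrow> 'a lie_alg \<Rightarrow> 'b lie_alg \<Rightarrow> bool" where
  "lie_hom f L M \<longleftrightarrow> (\<forall>x\<in>lcarrier L. f x \<in> lcarrier M) \<and> linear_on (lcarrier L) f \<and>
     (\<forall>x\<in>lcarrier L. \<forall>y\<in>lcarrier L. f (lbracket L x y) = lbracket M (f x) (f y))"

lemma lie_homD:
  assumes "lie_hom f L M"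
  shows "x \<in> lcarrier L \<Longrightarrow> f x \<in> lcarrier M" "linear_on (lcarrier L) f"
    and "x \<in> lcarrier L \<Longrightarrow> y \<in> lcarrier L \<Longrightarrow> f (x + y) = f x + f y"
    and "x \<in> lcarrier L \<Longrightarrow> f (c *\<^sub>C x) = c *\<^sub>C f x"
    and "x \<in> lcarrier L \<Longrightarrow> y \<in> lcarrier L \<Longrightarrow> f (lbracket L x y) = lbracket M (f x) (f y)"
  using assms by (auto simp: lie_hom_def linear_on_def)

lemma lie_hom_0:
  assumes "lie_hom f L M" "lie_algebra L"
  shows "f 0 = 0"
  using linear_on_0[OF lie_algebraD(1)[OF assms(2)] lie_homD(2)[OF assms(1)]] .

lemma lie_hom_diff:
  assumes "lie_hom f L M" "lie_algebra L" "x \<in> lcarrier L" "y \<in> lcarrier L"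
  shows "f (x - y) = f x - f y"
  using linear_on_diff[OF lie_algebraD(1)[OF assms(2)] lie_homD(2)[OF assms(1)] assms(3,4)] .

lemma lie_hom_inj_onI:
  assumes "lie_hom f L M" "lie_algebra L" "\<And>x. x \<in> lcarrier L \<Longrightarrow> f x = 0 \<Longrightarrow> x = 0"
  shows "inj_on f (lcarrier L)"
proof (rule inj_onI)
  fix x y assume xy: "x \<in> lcarrier L" "y \<in> lcarrier L" "f x = f y"
  then have "x - y = 0"
    using assms(3)[of "x - y"] lie_hom_diff[OF assms(1,2), of x y]
      cvec.subspace_diff[OF lie_algebraD(1)[OF assms(2)], of x y] by simp
  then show "x = y"
    by simp
qed

text \<open>Conjugating derivations needs both directions of an isomorphism, so both are kept.\<close>

definition lie_inverses ::
    "('a::complex_vector \<Rightarrow> 'b::complex_vector) \<Rightarrow> ('b \<Rightarrow> 'a) \<Rightarrow> 'a lie_alg \<Rightarrow> 'b lie_alg \<Rightarrow> bool" where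
  "lie_inverses f g L M \<longleftrightarrow> lie_hom f L M \<and> lie_hom g M L \<and>
     (\<forall>x\<in>lcarrier L. g (f x) = x) \<and> (\<forall>y\<in>lcarrier M. f (g y) = y)"

lemma lie_inverses_sym: "lie_inverses f g L M \<Longrightarrow> lie_inverses g f M L"
  by (auto simp: lie_inverses_def)

lemma lie_inverses_imp_isomorphic:
  assumes "lie_inverses f g L M"
  shows "L \<cong>\<^sub>L M"
  unfolding lie_isomorphic_def
proof (intro exI conjI)
  show "bij_betw f (lcarrier L) (lcarrier M)"
    using assms by (intro bij_betw_byWitness[of _ g]) (auto simp: lie_inverses_def lie_homD)
qed (use assms in \<open>auto simp: lie_inverses_def lie_hom_def\<close>)

lemma bij_hom_inverses:
  assumes L: "lie_algebra L" and f: "lie_hom f L M"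
    and bij: "bij_betw f (lcarrier L) (lcarrier M)"
  shows "lie_inverses f (inv_into (lcarrier L) f) L M"
proof -
  let ?g = "inv_into (lcarrier L) f"
  note sub = lie_algebraD(1)[OF L]
  have g: "?g y \<in> lcarrier L" "f (?g y) = y" if "y \<in> lcarrier M" for y
    using bij_betw_inv_into_right[OF bij that] bij_betwE[OF bij_betw_inv_into[OF bij]] that
    by auto
  have gf: "?g (f x) = x" if "x \<in> lcarrier L" for x
    by (rule bij_betw_inv_into_left[OF bij that])
  \<comment> \<open>Elements of \<open>M\<close> are replaced by their preimages, where \<open>f\<close> is known to be a homomorphism.\<close>
  have img: "lcarrier M = f ` lcarrier L"
    using bij by (simp add: bij_betw_def)
  have "lie_hom ?g M L"
    unfolding lie_hom_def linear_on_def img ball_simps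
  proof (intro conjI ballI allI)
    fix x y c assume xy: "x \<in> lcarrier L" "y \<in> lcarrier L"
    show "?g (f x + f y) = ?g (f x) + ?g (f y)"
      using gf[OF cvec.subspace_add[OF sub xy]] xy by (simp add: gf lie_homD(3)[OF f])
    show "?g (lbracket M (f x) (f y)) = lbracket L (?g (f x)) (?g (f y))"
      using gf[OF lie_algebraD(3)[OF L xy]] xy by (simp add: gf lie_homD(5)[OF f])
  next
    fix x c assume x: "x \<in> lcarrier L"
    show "?g (c *\<^sub>C f x) = c *\<^sub>C ?g (f x)"
      using gf[OF cvec.subspace_scale[OF sub x, of c]] x by (simp add: gf lie_homD(4)[OF f])
  qed (simp add: gf)
  then show ?thesis
    using f g gf by (simp add: lie_inverses_def)
qed

lemma isomorphicE:
  assumes "L \<cong>\<^sub>L M" "lie_algebra L"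
  obtains f g where "lie_inverses f g L M"
proof -
  obtain f where f: "bij_betw f (lcarrier L) (lcarrier M)" "linear_on (lcarrier L) f"
    "\<forall>x\<in>lcarrier L. \<forall>y\<in>lcarrier L. f (lbracket L x y) = lbracket M (f x) (f y)"
    using assms(1) by (auto simp: lie_isomorphic_def)
  then have "lie_hom f L M"
    by (auto simp: lie_hom_def dest: bij_betwE)
  then show ?thesis
    using that bij_hom_inverses[OF assms(2)] f(1) by blast
qed

lemma isomorphic_sym: "L \<cong>\<^sub>L M \<Longrightarrow> lie_algebra L \<Longrightarrow> M \<cong>\<^sub>L L"
  by (metis isomorphicE lie_inverses_sym lie_inverses_imp_isomorphic)

lemma isomorphic_trans:
  assumes "L \<cong>\<^sub>L M" "M \<cong>\<^sub>L N"
  shows "L \<cong>\<^sub>L N"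
proof -
  obtain f where f: "bij_betw f (lcarrier L) (lcarrier M)" "linear_on (lcarrier L) f"
    "\<forall>x\<in>lcarrier L. \<forall>y\<in>lcarrier L. f (lbracket L x y) = lbracket M (f x) (f y)"
    using assms(1) by (auto simp: lie_isomorphic_def)
  obtain g where g: "bij_betw g (lcarrier M) (lcarrier N)" "linear_on (lcarrier M) g"
    "\<forall>x\<in>lcarrier M. \<forall>y\<in>lcarrier M. g (lbracket M x y) = lbracket N (g x) (g y)"
    using assms(2) by (auto simp: lie_isomorphic_def)
  have "f x \<in> lcarrier M" if "x \<in> lcarrier L" for x
    using f(1) that by (auto dest: bij_betwE)
  then show ?thesis
    unfolding lie_isomorphic_def using bij_betw_trans[OF f(1) g(1)] f g
    by (intro exI[of _ "g \<circ> f"]) (auto simp: linear_on_def)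
qed

lemma Der_simps [simp]:
  "lcarrier (Der L) = derivations L" "lbracket (Der L) s t = (s \<circ> t) - (t \<circ> s)"
  by (simp_all add: Der_def)

lemma full_graph_simps [simp]:
  "lcarrier (full_graph L) = derivations L \<times> lcarrier L"
  "lbracket (full_graph L) (s, a) (t, b) = ((s \<circ> t) - (t \<circ> s), s b - t a + lbracket L a b)"
  by (simp_all add: full_graph_def)

text \<open>
  Derivations are functions that vanish off the carrier, so transport along an isomorphism has to
  cut off \<open>f \<circ> D \<circ> g\<close> outside \<open>M\<close>.
\<close>

definition conjugate ::
    "('a \<Rightarrow> 'b) \<Rightarrow> ('b \<Rightarrow> 'a) \<Rightarrow> 'b::complex_vector lie_alg \<Rightarrow> ('a \<Rightarrow> 'a) \<Rightarrow> 'b \<Rightarrow> 'b" where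
  "conjugate f g M D = (\<lambda>y. if y \<in> lcarrier M then f (D (g y)) else 0)"

lemma conjugate_derivation:
  assumes L: "lie_algebra L" and M: "lie_algebra M" and inv: "lie_inverses f g L M"
    and D: "D \<in> derivations L"
  shows "conjugate f g M D \<in> derivations M"
proof -
  have f: "lie_hom f L M" and g: "lie_hom g M L" and fg: "\<And>y. y \<in> lcarrier M \<Longrightarrow> f (g y) = y"
    using inv by (auto simp: lie_inverses_def)
  note Dl = derivation_linear[OF L D]
  note closed = lie_homD(1)[OF f] lie_homD(1)[OF g] Dl(1)
    lie_algebraD(3)[OF L] lie_algebraD(3)[OF M]
    cvec.subspace_add[OF lie_algebraD(1)[OF M]] cvec.subspace_scale[OF lie_algebraD(1)[OF M]]
  show ?thesis
    unfolding derivations_def linear_on_def mem_Collect_eq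
    by (auto simp: conjugate_def closed lie_homD(3-5)[OF f] lie_homD(3-5)[OF g]
        derivationsD(4)[OF D] Dl fg)
qed

lemma conjugate_inverse:
  assumes inv: "lie_inverses f g L M" and D: "D \<in> derivations L"
  shows "conjugate g f L (conjugate f g M D) = D"
proof
  fix x
  show "conjugate g f L (conjugate f g M D) x = D x"
    using inv derivationsD(1,2)[OF D, of x] lie_homD(1)[of f L M x]
    by (auto simp: conjugate_def lie_inverses_def)
qed

lemma conjugate_hom:
  assumes L: "lie_algebra L" and M: "lie_algebra M" and inv: "lie_inverses f g L M"
  shows "lie_hom (conjugate f g M) (Der L) (Der M)"
proof -
  have f: "lie_hom f L M" and g: "lie_hom g M L" and gf: "\<And>x. x \<in> lcarrier L \<Longrightarrow> g (f x) = x"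
    using inv by (auto simp: lie_inverses_def)
  note closed = lie_homD(1)[OF f] lie_homD(1)[OF g] derivation_linear(1)[OF L]
  show ?thesis
    unfolding lie_hom_def linear_on_def Der_simps
    by (intro conjI ballI allI ext)
      (simp_all add: conjugate_derivation[OF L M inv], simp_all add: conjugate_def closed
        lie_homD(3,4)[OF f] lie_hom_diff[OF f L] gf lie_hom_0[OF g M] derivation_linear(5)[OF L])
qed

lemma Der_inverses:
  assumes "lie_algebra L" "lie_algebra M" "lie_inverses f g L M"
  shows "lie_inverses (conjugate f g M) (conjugate g f L) (Der L) (Der M)"
  using conjugate_hom[OF assms] conjugate_hom[OF assms(2,1) lie_inverses_sym[OF assms(3)]]
    conjugate_inverse[OF assms(3)] conjugate_inverse[OF lie_inverses_sym[OF assms(3)]]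
  by (simp add: lie_inverses_def)

lemma Der_cong:
  assumes "lie_algebra L" "lie_algebra M" "L \<cong>\<^sub>L M"
  shows "Der L \<cong>\<^sub>L Der M"
  by (meson assms isomorphicE Der_inverses lie_inverses_imp_isomorphic)

text \<open>
  This is what makes the iteration independent of the coordinate copies that are chosen at each stage.
\<close>

lemma full_graph_cong:
  assumes L: "lie_algebra L" and M: "lie_algebra M" and iso: "L \<cong>\<^sub>L M"
  shows "full_graph L \<cong>\<^sub>L full_graph M"
proof -
  have hom: "lie_hom (map_prod (conjugate f g N) f) (full_graph K) (full_graph N)"
    if K: "lie_algebra K" and N: "lie_algebra N" and inv: "lie_inverses f g K N"
    for f g and K :: "'c::complex_vector lie_alg" and N :: "'d::complex_vector lie_alg"
  proof -
    have f: "lie_hom f K N" and gf: "\<And>x. x \<in> lcarrier K \<Longrightarrow> g (f x) = x"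
      using inv by (auto simp: lie_inverses_def)
    note D = conjugate_hom[OF K N inv]
    note sub = lie_algebraD(1)[OF K]
    have app: "conjugate f g N s (f x) = f (s x)" if "x \<in> lcarrier K" for s x
      using that by (simp add: conjugate_def gf lie_homD(1)[OF f])
    show ?thesis
      unfolding lie_hom_def linear_on_def
      using lie_homD(1,3,4,5)[OF D] lie_homD(1)[OF f]
      by (auto simp: app lie_homD(3-5)[OF f] lie_hom_diff[OF f K] derivation_linear(1)[OF K]
          lie_algebraD(3)[OF K] cvec.subspace_diff[OF sub])
  qed
  obtain f g where inv: "lie_inverses f g L M"
    using isomorphicE[OF iso L] .
  note inv' = lie_inverses_sym[OF inv]
  have "lie_inverses (map_prod (conjugate f g M) f) (map_prod (conjugate g f L) g)
      (full_graph L) (full_graph M)"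
    unfolding lie_inverses_def
    using hom[OF L M inv] hom[OF M L inv'] conjugate_inverse[OF inv] conjugate_inverse[OF inv'] inv
    by (auto simp: lie_inverses_def)
  then show ?thesis
    by (rule lie_inverses_imp_isomorphic)
qed

lemma lie_complete_cong:
  assumes L: "lie_algebra L" and M: "lie_algebra M" and iso: "L \<cong>\<^sub>L M" and comp: "lie_complete L"
  shows "lie_complete M"
proof -
  obtain f g where inv: "lie_inverses f g L M"
    using isomorphicE[OF iso L] .
  note inv' = lie_inverses_sym[OF inv]
  have f: "lie_hom f L M" and g: "lie_hom g M L"
    and gf: "\<And>x. x \<in> lcarrier L \<Longrightarrow> g (f x) = x" and fg: "\<And>y. y \<in> lcarrier M \<Longrightarrow> f (g y) = y"
    using inv by (auto simp: lie_inverses_def)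
  have z: "0 \<in> lcarrier M"
    by (rule cvec.subspace_0[OF lie_algebraD(1)[OF M]])
  have "y = 0" if "y \<in> lie_center M" for y
  proof -
    have y: "y \<in> lcarrier M" "\<And>x. x \<in> lcarrier M \<Longrightarrow> lbracket M y x = 0"
      using that by (auto simp: lie_center_def)
    have "lbracket L (g y) x = 0" if "x \<in> lcarrier L" for x
      using that lie_homD(5)[OF g y(1), of "f x"] y lie_homD(1)[OF f that] gf lie_hom_0[OF g M]
      by simp
    then have "g y \<in> lie_center L"
      using y lie_homD(1)[OF g] by (auto simp: lie_center_def)
    then have "g y = 0"
      using comp by (auto simp: lie_complete_def)
    then show "y = 0"
      using fg[OF y(1)] lie_hom_0[OF f L] by simp
  qed
  moreover have "0 \<in> lie_center M"
    using z linear_on_0[OF lie_algebraD(1)[OF M] lie_algebraD(5)[OF M]]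
    by (auto simp: lie_center_def)
  moreover have "\<exists>x\<in>lcarrier M. D = lie_ad M x" if D: "D \<in> derivations M" for D
  proof -
    obtain x where x: "x \<in> lcarrier L" "conjugate g f L D = lie_ad L x"
      using comp conjugate_derivation[OF M L inv' D] by (auto simp: lie_complete_def)
    have "D = conjugate f g M (lie_ad L x)"
      using conjugate_inverse[OF inv' D] x by simp
    also have "\<dots> = lie_ad M (f x)"
      using x by (auto simp: conjugate_def lie_ad_def lie_homD(5)[OF f] lie_homD(1)[OF g] fg)
    finally show ?thesis
      using x lie_homD(1)[OF f] by blast
  qed
  ultimately show ?thesis
    by (auto simp: lie_complete_def)
qed

lemma lbracket_0:
  assumes "lie_algebra L" "x \<in> lcarrier L"
  shows "lbracket L 0 x = 0" "lbracket L x 0 = 0"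
  using linear_on_0[OF lie_algebraD(1)[OF assms(1)] lie_algebraD(5)[OF assms]]
    linear_on_0[OF lie_algebraD(1)[OF assms(1)] lie_algebraD(4)[OF assms]] by simp_all

lemma lie_jacobi_left:
  assumes L: "lie_algebra L" and xyz: "x \<in> lcarrier L" "y \<in> lcarrier L" "z \<in> lcarrier L"
  shows "lbracket L x (lbracket L y z)
    = lbracket L (lbracket L x y) z + lbracket L y (lbracket L x z)"
proof -
  have 1: "lbracket L z (lbracket L x y) = - lbracket L (lbracket L x y) z"
    by (rule lbracket_anti[OF L xyz(3) lie_algebraD(3)[OF L xyz(1,2)]])
  have "lbracket L z x = 0 - lbracket L x z"
    using lbracket_anti[OF L xyz(3,1)] by simp
  then have 2: "lbracket L y (lbracket L z x) = - lbracket L y (lbracket L x z)"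
    using lbracket_diff_right[OF L xyz(2) cvec.subspace_0[OF lie_algebraD(1)[OF L]]
        lie_algebraD(3)[OF L xyz(1,3)]] lbracket_0[OF L xyz(2)] by simp
  show ?thesis
    using lie_algebraD(7)[OF L xyz] unfolding 1 2 by (simp add: algebra_simps eq_neg_iff_add_eq_0)
qed

lemma lie_ad_apply [simp]: "y \<in> lcarrier L \<Longrightarrow> lie_ad L x y = lbracket L x y"
  by (simp add: lie_ad_def)

lemma lie_ad_derivation:
  assumes L: "lie_algebra L" and x: "x \<in> lcarrier L"
  shows "lie_ad L x \<in> derivations L"
  unfolding derivations_def linear_on_def mem_Collect_eq
  using lie_algebraD(1,3)[OF L] x
  by (auto simp: lie_ad_def lbracket_add_right[OF L x] lbracket_scale_right[OF L x]
      lie_jacobi_left[OF L x] cvec.subspace_add cvec.subspace_scale)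

lemma derivation_lie_ad:
  assumes L: "lie_algebra L" and s: "s \<in> derivations L" and x: "x \<in> lcarrier L"
  shows "(s \<circ> lie_ad L x) - (lie_ad L x \<circ> s) = lie_ad L (s x)"
  by (rule ext) (use x in \<open>auto simp: lie_ad_def derivation_linear[OF L s] derivationsD(2)[OF s]
      derivationsD(4)[OF s] lbracket_0[OF L]\<close>)

lemma lie_ad_hom:
  assumes L: "lie_algebra L"
  shows "lie_hom (lie_ad L) L (Der L)"
  unfolding lie_hom_def linear_on_def Der_simps
proof (intro conjI ballI allI)
  fix x y assume xy: "x \<in> lcarrier L" "y \<in> lcarrier L"
  show "lie_ad L (x + y) = lie_ad L x + lie_ad L y"
    by (rule ext) (use xy in \<open>simp add: lie_ad_def lbracket_add_left[OF L]\<close>)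
  show "lie_ad L (lbracket L x y) = (lie_ad L x \<circ> lie_ad L y) - (lie_ad L y \<circ> lie_ad L x)"
    using derivation_lie_ad[OF L lie_ad_derivation[OF L xy(1)] xy(2)] xy(2) by simp
next
  fix c x assume "x \<in> lcarrier L"
  then show "lie_ad L (c *\<^sub>C x) = c *\<^sub>C lie_ad L x"
    by (intro ext) (simp add: lie_ad_def lbracket_scale_left[OF L])
qed (rule lie_ad_derivation[OF L])

lemma lie_ad_eq_0_imp:
  assumes "lie_center L = {0}" "x \<in> lcarrier L" "lie_ad L x = 0"
  shows "x = 0"
proof -
  have "x \<in> lie_center L"
    using assms(2) by (simp add: lie_center_def flip: lie_ad_apply) (simp add: assms(3))
  then show ?thesis
    using assms(1) by simp
qed

lemma lie_ad_inj:
  assumes L: "lie_algebra L" and Z: "lie_center L = {0}"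
  shows "inj_on (lie_ad L) (lcarrier L)"
  using lie_hom_inj_onI[OF lie_ad_hom[OF L] L] lie_ad_eq_0_imp[OF Z] by blast

section \<open>Lie algebras with a complete hull of codimension one\<close>

text \<open>
  The property that propagates through the iteration. The derivation \<open>\<tau>\<close> shows that \<open>L\<close> is not
  complete, and it is named so that the codimension of \<open>ad L\<close> can be handled without dimensions.
\<close>

definition almost_complete :: "'a::complex_vector lie_alg \<Rightarrow> bool" where
  "almost_complete L \<longleftrightarrow> lie_algebra L \<and> lie_center L = {0} \<and> lie_complete (Der L) \<and>
     (\<forall>s\<in>derivations L. \<forall>t\<in>derivations L. (s \<circ> t) - (t \<circ> s) \<in> lie_ad L ` lcarrier L) \<and>
     (\<exists>\<tau>\<in>derivations L. \<tau> \<notin> lie_ad L ` lcarrier L \<and>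
        (\<forall>s\<in>derivations L. \<exists>c. s - c *\<^sub>C \<tau> \<in> lie_ad L ` lcarrier L))"

text \<open>
  A way to recognise \<open>Der L\<close> without computing it: a complete algebra \<open>K\<close> in which \<open>L\<close> sits as an
  ideal with trivial centralizer, and which induces all derivations of \<open>L\<close>, must be \<open>Der L\<close>.
\<close>

locale complete_hull =
  fixes L :: "'a::complex_vector lie_alg" and K :: "'k::complex_vector lie_alg" and \<phi> :: "'a \<Rightarrow> 'k"
  assumes L: "lie_algebra L" and K: "lie_algebra K" and complete: "lie_complete K"
    and hom: "lie_hom \<phi> L K" and inj: "inj_on \<phi> (lcarrier L)"
    and commutators: "k \<in> lcarrier K \<Longrightarrow> l \<in> lcarrier K \<Longrightarrow> lbracket K k l \<in> \<phi> ` lcarrier L"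
    and centralizer: "k \<in> lcarrier K \<Longrightarrow> (\<And>x. x \<in> lcarrier L \<Longrightarrow> lbracket K k (\<phi> x) = 0) \<Longrightarrow> k = 0"
    and derivation_inner: "D \<in> derivations L \<Longrightarrow>
      \<exists>k\<in>lcarrier K. \<forall>x\<in>lcarrier L. \<phi> (D x) = lbracket K k (\<phi> x)"
    and codim: "\<exists>\<tau>\<in>lcarrier K. \<tau> \<notin> \<phi> ` lcarrier L \<and>
      (\<forall>k\<in>lcarrier K. \<exists>c. k - c *\<^sub>C \<tau> \<in> \<phi> ` lcarrier L)"
begin

text \<open>
  The image of \<open>\<phi>\<close> contains all commutators, so it is stable under \<open>ad k\<close>, and \<open>ad k\<close> can be pulled
  back along \<open>\<phi>\<close>.
\<close>

definition restrict_ad :: "'k \<Rightarrow> 'a \<Rightarrow> 'a" where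
  "restrict_ad k = (\<lambda>x. if x \<in> lcarrier L then inv_into (lcarrier L) \<phi> (lbracket K k (\<phi> x)) else 0)"

lemma restrict_ad:
  assumes "k \<in> lcarrier K" "x \<in> lcarrier L"
  shows "restrict_ad k x \<in> lcarrier L" "\<phi> (restrict_ad k x) = lbracket K k (\<phi> x)"
  using commutators[OF assms(1) lie_homD(1)[OF hom assms(2)]] assms(2)
  by (auto simp: restrict_ad_def inv_into_into f_inv_into_f)

lemma map_eqI: "x \<in> lcarrier L \<Longrightarrow> y \<in> lcarrier L \<Longrightarrow> \<phi> x = \<phi> y \<Longrightarrow> x = y"
  using inj by (auto simp: inj_on_def)

lemma restrict_ad_derivation:
  assumes k: "k \<in> lcarrier K"
  shows "restrict_ad k \<in> derivations L"
  unfolding derivations_def linear_on_def mem_Collect_eq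
proof (intro conjI ballI allI impI)
  note sub = lie_algebraD(1)[OF L] and h = lie_homD[OF hom] and r = restrict_ad[OF k]
  note closed = cvec.subspace_add[OF sub] cvec.subspace_scale[OF sub] lie_algebraD(3)[OF L] r(1)
  fix x y assume xy: "x \<in> lcarrier L" "y \<in> lcarrier L"
  show "restrict_ad k (x + y) = restrict_ad k x + restrict_ad k y"
    by (rule map_eqI) (use xy in \<open>simp_all add: closed r h lbracket_add_right[OF K k]\<close>)
  show "restrict_ad k (lbracket L x y)
      = lbracket L (restrict_ad k x) y + lbracket L x (restrict_ad k y)"
    by (rule map_eqI) (use xy in \<open>simp_all add: closed r h lie_jacobi_left[OF K k]\<close>)
next
  note sub = lie_algebraD(1)[OF L] and h = lie_homD[OF hom] and r = restrict_ad[OF k]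
  fix c x assume x: "x \<in> lcarrier L"
  show "restrict_ad k (c *\<^sub>C x) = c *\<^sub>C restrict_ad k x"
    by (rule map_eqI) (use x in \<open>simp_all add: cvec.subspace_scale[OF sub] r h lbracket_scale_right[OF K k]\<close>)
qed (simp_all add: restrict_ad[OF k], simp add: restrict_ad_def)

lemma derivation_eqI:
  assumes "D \<in> derivations L" "E \<in> derivations L"
    and "\<And>x. x \<in> lcarrier L \<Longrightarrow> \<phi> (D x) = \<phi> (E x)"
  shows "D = E"
proof
  fix x
  show "D x = E x"
    using map_eqI[OF derivationsD(1)[OF assms(1)] derivationsD(1)[OF assms(2)] assms(3), of x]
      derivationsD(2)[OF assms(1)] derivationsD(2)[OF assms(2)] by (cases "x \<in> lcarrier L") auto
qed

lemma restrict_ad_hom: "lie_hom restrict_ad K (Der L)"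
  unfolding lie_hom_def linear_on_def Der_simps
proof (intro conjI ballI allI)
  note h = lie_homD[OF hom] and sub = lie_algebraD(1)[OF K]
    and D = subspace_derivations[OF L]
  fix k l assume k: "k \<in> lcarrier K" and l: "l \<in> lcarrier K"
  note [simp] = restrict_ad[OF k] restrict_ad[OF l] restrict_ad_derivation[OF k]
    restrict_ad_derivation[OF l]
  have kl: "k + l \<in> lcarrier K" "lbracket K k l \<in> lcarrier K"
    using k l lie_algebraD(3)[OF K] sub by (auto simp: cvec.subspace_add)
  show "restrict_ad (k + l) = restrict_ad k + restrict_ad l"
    by (rule derivation_eqI) (simp_all add: restrict_ad_derivation kl restrict_ad[OF kl(1)] h
        lbracket_add_left[OF K] k l cvec.subspace_add[OF D])
  show "restrict_ad (lbracket K k l) = (restrict_ad k \<circ> restrict_ad l) - (restrict_ad l \<circ> restrict_ad k)"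
    by (rule derivation_eqI) (simp_all add: restrict_ad_derivation kl restrict_ad[OF kl(2)] h
        lie_hom_diff[OF hom L] derivations_commutator[OF L] lie_jacobi_left[OF K k l])
next
  note h = lie_homD[OF hom] and sub = lie_algebraD(1)[OF K]
    and D = subspace_derivations[OF L]
  fix c k assume k: "k \<in> lcarrier K"
  have ck: "c *\<^sub>C k \<in> lcarrier K"
    using k by (rule cvec.subspace_scale[OF sub])
  show "restrict_ad (c *\<^sub>C k) = c *\<^sub>C restrict_ad k"
    by (rule derivation_eqI) (simp_all add: restrict_ad_derivation ck restrict_ad[OF ck] h
        restrict_ad[OF k] lbracket_scale_left[OF K] k cvec.subspace_scale[OF D])
qed (rule restrict_ad_derivation)

text \<open>
  Injectivity is the triviality of the centralizer; surjectivity is the assumption that \<open>K\<close> induces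
  every derivation.
\<close>

lemma restrict_ad_bij: "bij_betw restrict_ad (lcarrier K) (derivations L)"
  unfolding bij_betw_def
proof (intro conjI subset_antisym subsetI)
  show "inj_on restrict_ad (lcarrier K)"
  proof (rule lie_hom_inj_onI[OF restrict_ad_hom K])
    fix k assume k: "k \<in> lcarrier K" "restrict_ad k = 0"
    show "k = 0"
      by (rule centralizer[OF k(1)]) (use restrict_ad[OF k(1)] k(2) lie_hom_0[OF hom L] in simp)
  qed
  show "D \<in> derivations L" if "D \<in> restrict_ad ` lcarrier K" for D
    using that restrict_ad_derivation by auto
  show "D \<in> restrict_ad ` lcarrier K" if D: "D \<in> derivations L" for D
  proof -
    obtain k where k: "k \<in> lcarrier K" "\<forall>x\<in>lcarrier L. \<phi> (D x) = lbracket K k (\<phi> x)"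
      using derivation_inner[OF D] by blast
    have "D = restrict_ad k"
      by (rule derivation_eqI[OF D restrict_ad_derivation[OF k(1)]]) (use k restrict_ad in simp)
    then show ?thesis
      using k(1) by blast
  qed
qed

lemma restrict_ad_map: "x \<in> lcarrier L \<Longrightarrow> restrict_ad (\<phi> x) = lie_ad L x"
  by (rule derivation_eqI)
    (simp_all add: restrict_ad_derivation lie_ad_derivation[OF L] restrict_ad lie_homD[OF hom])

lemma Der_iso_hull: "Der L \<cong>\<^sub>L K"
  using bij_hom_inverses[OF K restrict_ad_hom] restrict_ad_bij
  by (metis Der_simps(1) lie_inverses_imp_isomorphic lie_inverses_sym)

text \<open>
  All conditions hold for \<open>\<phi> ` L\<close> inside \<open>K\<close>, and \<open>restrict_ad\<close> carries this pair to
  \<open>ad L\<close> inside \<open>Der L\<close>.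
\<close>

theorem almost_complete: "almost_complete L"
proof -
  have D: "lie_algebra (Der L)"
    by (rule lie_algebra_Der[OF L])
  have ad: "lie_ad L ` lcarrier L = restrict_ad ` \<phi> ` lcarrier L"
    by (auto simp: image_iff restrict_ad_map)
  have img: "\<phi> ` lcarrier L \<subseteq> lcarrier K"
    using lie_homD(1)[OF hom] by blast
  note rinj = bij_betw_imp_inj_on[OF restrict_ad_bij] and r = lie_homD[OF restrict_ad_hom]
  have surj: "\<exists>k\<in>lcarrier K. s = restrict_ad k" if "s \<in> derivations L" for s
    using bij_betw_imp_surj_on[OF restrict_ad_bij] that by blast
  have center: "x = 0" if "x \<in> lie_center L" for x
  proof -
    have x: "x \<in> lcarrier L" "\<And>y. y \<in> lcarrier L \<Longrightarrow> lbracket L x y = 0"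
      using that by (auto simp: lie_center_def)
    then have "\<phi> x = 0"
      using lie_homD(1,5)[OF hom] lie_hom_0[OF hom L] by (metis centralizer)
    then show "x = 0"
      using map_eqI[OF x(1) cvec.subspace_0[OF lie_algebraD(1)[OF L]]] lie_hom_0[OF hom L] by simp
  qed
  have "0 \<in> lie_center L"
    using cvec.subspace_0[OF lie_algebraD(1)[OF L]] lbracket_0[OF L] by (simp add: lie_center_def)
  with center have "lie_center L = {0}"
    by auto
  moreover have "lie_complete (Der L)"
    using lie_complete_cong[OF K D isomorphic_sym[OF Der_iso_hull D] complete] .
  moreover have "(s \<circ> t) - (t \<circ> s) \<in> lie_ad L ` lcarrier L"
    if s: "s \<in> derivations L" and t: "t \<in> derivations L" for s t
  proof -
    obtain k l where "k \<in> lcarrier K" "l \<in> lcarrier K" "s = restrict_ad k" "t = restrict_ad l"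
      using surj[OF s] surj[OF t] by blast
    then show ?thesis
      unfolding ad using commutators[of k l] r(5)[of k l] by (metis Der_simps(2) imageI)
  qed
  moreover have "\<exists>\<tau>\<in>derivations L. \<tau> \<notin> lie_ad L ` lcarrier L \<and>
      (\<forall>s\<in>derivations L. \<exists>c. s - c *\<^sub>C \<tau> \<in> lie_ad L ` lcarrier L)"
  proof -
    obtain \<tau> where \<tau>: "\<tau> \<in> lcarrier K" "\<tau> \<notin> \<phi> ` lcarrier L"
      "\<And>k. k \<in> lcarrier K \<Longrightarrow> \<exists>c. k - c *\<^sub>C \<tau> \<in> \<phi> ` lcarrier L"
      using codim by blast
    show ?thesis
    proof (intro bexI[of _ "restrict_ad \<tau>"] conjI ballI)
      show "restrict_ad \<tau> \<notin> lie_ad L ` lcarrier L"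
        unfolding ad using \<tau>(1,2) img by (simp add: inj_on_image_mem_iff[OF rinj])
      show "restrict_ad \<tau> \<in> derivations L"
        by (rule restrict_ad_derivation[OF \<tau>(1)])
      fix s assume "s \<in> derivations L"
      then obtain k where k: "k \<in> lcarrier K" "s = restrict_ad k"
        using surj by blast
      obtain c where c: "k - c *\<^sub>C \<tau> \<in> \<phi> ` lcarrier L"
        using \<tau>(3)[OF k(1)] by blast
      have "c *\<^sub>C \<tau> \<in> lcarrier K"
        using \<tau>(1) by (rule cvec.subspace_scale[OF lie_algebraD(1)[OF K]])
      then have "restrict_ad (k - c *\<^sub>C \<tau>) = s - c *\<^sub>C restrict_ad \<tau>"
        using k \<tau>(1) by (simp add: lie_hom_diff[OF restrict_ad_hom K] r(4))
      then show "\<exists>c. s - c *\<^sub>C restrict_ad \<tau> \<in> lie_ad L ` lcarrier L"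
        using c unfolding ad by (metis imageI)
    qed
  qed
  ultimately show ?thesis
    unfolding almost_complete_def using L by blast
qed

end

text \<open>
  Conversely \<open>Der L\<close> itself is a hull, because \<open>[s, ad x] = ad (s x)\<close> for every derivation \<open>s\<close>.
  Hence invariance under isomorphism can be read off by composing \<open>ad\<close> with the isomorphism.
\<close>

lemma almost_complete_imp_hull:
  assumes "almost_complete L"
  shows "complete_hull L (Der L) (lie_ad L)"
proof -
  have L: "lie_algebra L" and Z: "lie_center L = {0}"
    using assms by (auto simp: almost_complete_def)
  show ?thesis
  proof
    fix D assume D: "D \<in> lcarrier (Der L)"
      and c: "\<And>x. x \<in> lcarrier L \<Longrightarrow> lbracket (Der L) D (lie_ad L x) = 0"
    have "D x = 0" if x: "x \<in> lcarrier L" for x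
      using c[OF x] derivation_lie_ad[OF L _ x, of D] lie_ad_eq_0_imp[OF Z, of "D x"]
        derivationsD(1)[of D L x] D x by simp
    then show "D = 0"
      using derivationsD(2)[of D L] D by fastforce
  next
    fix D assume "D \<in> derivations L"
    then show "\<exists>k\<in>lcarrier (Der L). \<forall>x\<in>lcarrier L. lie_ad L (D x) = lbracket (Der L) k (lie_ad L x)"
      using derivation_lie_ad[OF L] by (intro bexI[of _ D]) auto
  qed (use assms lie_algebra_Der[OF L] lie_ad_hom[OF L] lie_ad_inj[OF L Z] in
      \<open>auto simp: almost_complete_def\<close>)
qed

lemma almost_complete_cong:
  assumes AL: "almost_complete L" and M: "lie_algebra M" and iso: "M \<cong>\<^sub>L L"
  shows "almost_complete M"
proof -
  interpret L: complete_hull L "Der L" "lie_ad L"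
    by (rule almost_complete_imp_hull[OF AL])
  obtain f g where inv: "lie_inverses f g M L"
    using isomorphicE[OF iso M] .
  have f: "lie_hom f M L" and g: "lie_hom g L M"
    and gf: "\<And>x. x \<in> lcarrier M \<Longrightarrow> g (f x) = x" and fg: "\<And>y. y \<in> lcarrier L \<Longrightarrow> f (g y) = y"
    using inv by (auto simp: lie_inverses_def)
  have img: "(lie_ad L \<circ> f) ` lcarrier M = lie_ad L ` lcarrier L"
    using lie_homD(1)[OF f] lie_homD(1)[OF g] fg by (force simp: image_iff)
  interpret M: complete_hull M "Der L" "lie_ad L \<circ> f"
  proof
    show "lie_hom (lie_ad L \<circ> f) M (Der L)"
      using f L.hom by (simp add: lie_hom_def linear_on_def)
    show "inj_on (lie_ad L \<circ> f) (lcarrier M)"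
      by (rule comp_inj_on) (use gf L.inj lie_homD(1)[OF f] in
          \<open>auto intro: inj_on_inverseI inj_on_subset\<close>)
    show "k = 0" if "k \<in> lcarrier (Der L)"
      "\<And>x. x \<in> lcarrier M \<Longrightarrow> lbracket (Der L) k ((lie_ad L \<circ> f) x) = 0" for k
      using L.centralizer[OF that(1)] that(2) lie_homD(1)[OF g] fg by (metis comp_apply)
  next
    fix D assume D: "D \<in> derivations M"
    then have "conjugate f g L D \<in> derivations L"
      by (rule conjugate_derivation[OF M L.L inv])
    then obtain k where k: "k \<in> lcarrier (Der L)"
      "\<And>x. x \<in> lcarrier L \<Longrightarrow> lie_ad L (conjugate f g L D x) = lbracket (Der L) k (lie_ad L x)"
      using L.derivation_inner by blast
    have "lie_ad L (f (D x)) = lbracket (Der L) k (lie_ad L (f x))" if "x \<in> lcarrier M" for x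
      using k(2)[OF lie_homD(1)[OF f that]] lie_homD(1)[OF f that] that gf
      by (simp add: conjugate_def)
    then show "\<exists>k\<in>lcarrier (Der L). \<forall>x\<in>lcarrier M.
        (lie_ad L \<circ> f) (D x) = lbracket (Der L) k ((lie_ad L \<circ> f) x)"
      using k(1) by auto
  qed (use M L.K L.complete L.commutators L.codim in \<open>simp_all only: img\<close>)
  show ?thesis
    by (rule M.almost_complete)
qed

lemma subspace_linear_image:
  assumes "cvec.subspace V" "linear_on V f"
  shows "cvec.subspace (f ` V)"
  unfolding cvec.subspace_def
proof (intro conjI ballI allI)
  show "0 \<in> f ` V"
    using linear_on_0[OF assms] cvec.subspace_0[OF assms(1)] by (metis imageI)
qed (auto simp: linear_on_add[OF assms(2), symmetric] linear_on_scale[OF assms(2), symmetric]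
    cvec.subspace_add[OF assms(1)] cvec.subspace_scale[OF assms(1)])

text \<open>
  Maps here are linear only on a subspace of the ambient type, so the dimension of an image is
  computed by transporting a basis.
\<close>

lemma independent_linear_image:
  assumes V: "cvec.subspace V" and f: "linear_on V f" "inj_on f V"
    and B: "B \<subseteq> V" "cvec.independent B"
  shows "cvec.independent (f ` B)"
proof
  assume "cvec.dependent (f ` B)"
  then obtain b where b: "b \<in> B" "f b \<in> cvec.span (f ` B - {f b})"
    by (auto simp: cvec.dependent_def)
  let ?S = "cvec.span (B - {b})"
  have S: "?S \<subseteq> V"
    using B(1) by (intro cvec.span_minimal[OF _ V]) auto
  have "f ` B - {f b} \<subseteq> f ` ?S"
    by (auto intro!: imageI cvec.span_base)
  moreover have "cvec.subspace (f ` ?S)"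
    using f(1) S by (intro subspace_linear_image) (auto simp: linear_on_def subset_iff)
  ultimately have "f b \<in> f ` ?S"
    using b(2) cvec.span_minimal by blast
  then have "b \<in> ?S"
    using b(1) B(1) S by (simp add: inj_on_image_mem_iff[OF f(2)] subset_iff)
  then show False
    using b(1) B(2) by (auto simp: cvec.dependent_def)
qed

lemma dim_linear_image:
  assumes V: "cvec.subspace V" and f: "linear_on V f" "inj_on f V"
  shows "cvec.dim (f ` V) = cvec.dim V"
proof -
  obtain B where B: "B \<subseteq> V" "cvec.independent B" "V \<subseteq> cvec.span B" "card B = cvec.dim V"
    by (rule cvec.basis_exists)
  show ?thesis
  proof (rule cvec.dim_unique)
    show "f ` V \<subseteq> cvec.span (f ` B)"
      using linear_on_span_image[OF V f(1) B(1)] B(3) by blast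
    show "cvec.independent (f ` B)"
      by (rule independent_linear_image[OF V f B(1,2)])
    show "card (f ` B) = cvec.dim V"
      using card_image[OF inj_on_subset[OF f(2) B(1)]] B(4) by simp
  qed (use B(1) in auto)
qed

lemma dim_codimension_one:
  assumes W: "cvec.subspace W" "finite_dimensional W" and \<tau>: "\<tau> \<notin> W" and U: "insert \<tau> W \<subseteq> U"
    and dec: "\<And>u. u \<in> U \<Longrightarrow> \<exists>c. u - c *\<^sub>C \<tau> \<in> W"
  shows "cvec.dim U = Suc (cvec.dim W)"
proof -
  obtain B where B: "finite B" "B \<subseteq> W" "cvec.independent B" "cvec.span B = W"
    by (rule finite_basisE[OF W])
  show ?thesis
  proof (rule cvec.dim_unique)
    show "cvec.independent (insert \<tau> B)"
      using B(3,4) \<tau> by (intro cvec.independent_insertI) auto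
    show "card (insert \<tau> B) = Suc (cvec.dim W)"
      using B \<tau> cvec.dim_eq_card_independent[OF B(3)] cvec.dim_span[of B]
      by (subst card_insert_disjoint) auto
    show "U \<subseteq> cvec.span (insert \<tau> B)"
      using dec by (auto simp: cvec.span_insert B(4))
    show "insert \<tau> B \<subseteq> U"
      using B(2) U by blast
  qed
qed

lemma almost_complete_dim:
  assumes "almost_complete L"
  shows "lie_dim (Der L) = Suc (lie_dim L)"
proof -
  interpret complete_hull L "Der L" "lie_ad L"
    by (rule almost_complete_imp_hull[OF assms])
  note sub = lie_algebraD(1,2)[OF L]
  obtain \<tau> where \<tau>: "\<tau> \<in> derivations L" "\<tau> \<notin> lie_ad L ` lcarrier L"
    "\<And>s. s \<in> derivations L \<Longrightarrow> \<exists>c. s - c *\<^sub>C \<tau> \<in> lie_ad L ` lcarrier L"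
    using codim by auto
  note lin = lie_homD(2)[OF hom]
  have "cvec.subspace (lie_ad L ` lcarrier L)"
    by (rule subspace_linear_image[OF sub(1) lin])
  then have "cvec.dim (derivations L) = Suc (cvec.dim (lie_ad L ` lcarrier L))"
    using finite_dimensional_image[OF sub lin] lie_ad_derivation[OF L] \<tau>
    by (intro dim_codimension_one[OF _ _ \<tau>(2)]) auto
  then show ?thesis
    using dim_linear_image[OF sub(1) lin inj] by (simp add: lie_dim_def)
qed

section \<open>The full graph of an almost complete Lie algebra\<close>

text \<open>
  The map \<open>(s, x) \<mapsto> (s, s + ad x)\<close> identifies the full graph with the pairs of derivations that
  differ by an inner one. The ideals of the elements \<open>(0, y)\<close> and \<open>(- ad y, y)\<close> become the two
  factors \<open>ad L\<close>. A derivation \<open>\<delta>\<close> acts on them by derivations \<open>d1\<close> and \<open>d2\<close> of \<open>L\<close>, and the brackets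
  of \<open>(s, x)\<close> with the two ideals then determine \<open>\<delta> (s, x)\<close>: it is the commutator with the pair
  \<open>(d2, d1)\<close>, written below in the original coordinates.
\<close>

lemma full_graph_derivation:
  assumes L: "lie_algebra L" and Z: "lie_center L = {0}"
    and \<delta>: "\<delta> \<in> derivations (full_graph L)"
  obtains d1 d2 where "d1 \<in> derivations L" "d2 \<in> derivations L"
    "\<And>s x. s \<in> derivations L \<Longrightarrow> x \<in> lcarrier L \<Longrightarrow>
      fst (\<delta> (s, x)) = (d2 \<circ> s) - (s \<circ> d2) \<and>
      lie_ad L (snd (\<delta> (s, x))) = ((d1 - d2) \<circ> s) - (s \<circ> (d1 - d2)) + lie_ad L (d1 x)"
proof -
  let ?F = "full_graph L"
  note F = lie_algebra_full_graph[OF L]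
  note sub = lie_algebraD(1)[OF L] and Dsub = subspace_derivations[OF L]
  note ad = lie_ad_derivation[OF L] and zL = cvec.subspace_0[OF sub] and zD = cvec.subspace_0[OF Dsub]
  note \<delta>lin = derivation_linear[OF F \<delta>] and br = derivationsD(4)[OF \<delta>]
  note lin = derivation_linear[OF L] and adh = lie_homD[OF lie_ad_hom[OF L]]
  have neg_ad: "- lie_ad L x \<in> derivations L" if "x \<in> lcarrier L" for x
    using cvec.subspace_neg[OF Dsub ad[OF that]] .
  have fs: "fst (\<delta> p) \<in> derivations L" "snd (\<delta> p) \<in> lcarrier L" for p
    using \<delta>lin(1)[of p] by (auto simp: mem_Times_iff)
  have faithful: "s = 0" if "s \<in> derivations L" "\<And>x. x \<in> lcarrier L \<Longrightarrow> s x = 0" for s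
    using that derivationsD(2)[of s L] by fastforce
  define d1 where "d1 = (\<lambda>y. if y \<in> lcarrier L then snd (\<delta> (0, y)) else 0)"
  define d2 where "d2 = (\<lambda>x. if x \<in> lcarrier L then snd (\<delta> (- lie_ad L x, x)) else 0)"
  have ad0: "lie_ad L 0 = 0"
    by (rule lie_hom_0[OF lie_ad_hom[OF L] L])
  have copy1: "lbracket ?F (s, x) (0, y) = (0, s y + lbracket L x y)"
    if "s \<in> derivations L" "x \<in> lcarrier L" "y \<in> lcarrier L" for s x y
    using that by (simp add: lin fun_eq_iff)
  have copy2: "lbracket ?F (s, x) (- lie_ad L y, y) = (- lie_ad L (s y), s y)"
    if s: "s \<in> derivations L" and x: "x \<in> lcarrier L" and y: "y \<in> lcarrier L" for s x y
  proof -
    have "(s \<circ> (- lie_ad L y)) - ((- lie_ad L y) \<circ> s) = - ((s \<circ> lie_ad L y) - (lie_ad L y \<circ> s))"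
      using lin(3)[OF s zL lin(1)[OF ad[OF y]]] by (simp add: fun_eq_iff lin(5)[OF s])
    then show ?thesis
      using lbracket_anti[OF L x y] derivation_lie_ad[OF L s y] x by simp
  qed
  have in1: "(0, y) \<in> lcarrier ?F" and in2: "(- lie_ad L y, y) \<in> lcarrier ?F" if "y \<in> lcarrier L" for y
    using that neg_ad zD by simp_all
  \<comment> \<open>The two copies of \<open>L\<close> commute and each is the centralizer of the other, so \<open>\<delta>\<close> preserves both.\<close>
  have cross: "fst (\<delta> (0, y)) x = 0 \<and>
      fst (\<delta> (- lie_ad L x, x)) y = - lbracket L (snd (\<delta> (- lie_ad L x, x))) y"
    if x: "x \<in> lcarrier L" and y: "y \<in> lcarrier L" for x y
  proof -
    obtain r u p q where e: "\<delta> (0, y) = (r, u)" "\<delta> (- lie_ad L x, x) = (p, q)"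
      by fastforce
    have m: "r \<in> derivations L" "u \<in> lcarrier L" "p \<in> derivations L" "q \<in> lcarrier L"
      using fs[of "(0, y)"] fs[of "(- lie_ad L x, x)"] by (simp_all add: e)
    have "0 = \<delta> (lbracket ?F (0, y) (- lie_ad L x, x))"
      using copy2[OF zD y x] \<delta>lin(5) by (simp add: ad0 zero_prod_def)
    also have "\<dots> = lbracket ?F (r, u) (- lie_ad L x, x) + lbracket ?F (0, y) (p, q)"
      using br[OF in1[OF y] in2[OF x]] by (simp only: e)
    also have "lbracket ?F (0, y) (p, q) = - lbracket ?F (p, q) (0, y)"
      by (rule lbracket_anti[OF F in1[OF y]]) (simp add: m)
    finally have sum: "0 = (- lie_ad L (r x), r x) - (0, p y + lbracket L q y)"
      by (simp only: copy1[OF m(3,4) y] copy2[OF m(1,2) x] diff_conv_add_uminus)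
    have "lie_ad L (r x) = 0" and *: "r x = p y + lbracket L q y"
      using arg_cong[OF sum, of fst] arg_cong[OF sum, of snd] by simp_all
    then have "r x = 0"
      using lie_ad_eq_0_imp[OF Z lin(1)[OF m(1)]] by blast
    with * show ?thesis
      by (simp add: e eq_neg_iff_add_eq_0)
  qed
  have d1: "\<delta> (0, y) = (0, d1 y)" if "y \<in> lcarrier L" for y
    using faithful[OF fs(1)] cross that by (simp add: d1_def prod_eq_iff)
  have d2: "\<delta> (- lie_ad L x, x) = (- lie_ad L (d2 x), d2 x)" if x: "x \<in> lcarrier L" for x
  proof -
    have "fst (\<delta> (- lie_ad L x, x)) + lie_ad L (d2 x) = 0"
      by (rule faithful[OF cvec.subspace_add[OF Dsub fs(1) ad]])
        (use x fs(2) cross in \<open>simp_all add: d2_def\<close>)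
    then show ?thesis
      using x by (simp add: d2_def prod_eq_iff eq_neg_iff_add_eq_0)
  qed
  have closed: "d1 y \<in> lcarrier L" "d2 y \<in> lcarrier L" for y
    using fs(2) zL by (simp_all add: d1_def d2_def)
  note subD = cvec.subspace_add[OF sub] cvec.subspace_scale[OF sub] lie_algebraD(3)[OF L]
  have d1D: "d1 \<in> derivations L"
    unfolding derivations_def linear_on_def mem_Collect_eq
  proof (intro conjI ballI allI impI)
    fix y z assume yz: "y \<in> lcarrier L" "z \<in> lcarrier L"
    show "d1 (y + z) = d1 y + d1 z"
      using \<delta>lin(2)[OF in1[OF yz(1)] in1[OF yz(2)]] yz by (simp add: d1 subD)
    show "d1 (lbracket L y z) = lbracket L (d1 y) z + lbracket L y (d1 z)"
      using br[OF in1[OF yz(1)] in1[OF yz(2)]] yz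
      by (simp add: d1 subD copy1[OF zD] closed del: full_graph_simps)
  next
    fix c y assume y: "y \<in> lcarrier L"
    show "d1 (c *\<^sub>C y) = c *\<^sub>C d1 y"
      using \<delta>lin(4)[OF in1[OF y], of c] y by (simp add: d1 subD)
  qed (simp_all add: closed, simp add: d1_def)
  have d2D: "d2 \<in> derivations L"
    unfolding derivations_def linear_on_def mem_Collect_eq
  proof (intro conjI ballI allI impI)
    fix y z assume yz: "y \<in> lcarrier L" "z \<in> lcarrier L"
    have "\<delta> (- lie_ad L (y + z), y + z) = \<delta> (- lie_ad L y, y) + \<delta> (- lie_ad L z, z)"
      using \<delta>lin(2)[OF in2[OF yz(1)] in2[OF yz(2)]] yz by (simp add: adh(3))
    then show "d2 (y + z) = d2 y + d2 z"
      using yz by (simp add: d2 subD)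
    have adb: "lbracket ?F (- lie_ad L y, y) (- lie_ad L z, z)
        = - (- lie_ad L (lbracket L y z), lbracket L y z)"
      if "y \<in> lcarrier L" "z \<in> lcarrier L" for y z
      using copy2[OF neg_ad that(1) that(2)] that adh(4)[of "lbracket L y z" "-1"]
      by (simp add: subD cvec.scale_minus_left del: full_graph_simps)
    have "\<delta> (- (- lie_ad L (lbracket L y z), lbracket L y z))
        = - \<delta> (- lie_ad L (lbracket L y z), lbracket L y z)"
      using \<delta>lin(4)[OF in2[OF subD(3)[OF yz]], of "-1"] by (simp add: cvec.scale_minus_left)
    then show "d2 (lbracket L y z) = lbracket L (d2 y) z + lbracket L y (d2 z)"
      using br[OF in2[OF yz(1)] in2[OF yz(2)]] yz
      by (simp add: d2 subD adb closed del: full_graph_simps)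
        (metis add_uminus_conv_diff diff_minus_eq_add minus_add_distrib minus_diff_eq minus_minus)
  next
    fix c y assume y: "y \<in> lcarrier L"
    have "\<delta> (- lie_ad L (c *\<^sub>C y), c *\<^sub>C y) = c *\<^sub>C \<delta> (- lie_ad L y, y)"
      using \<delta>lin(4)[OF in2[OF y], of c] y by (simp add: adh(4) cvec.scale_minus_right)
    then show "d2 (c *\<^sub>C y) = c *\<^sub>C d2 y"
      using y by (simp add: d2 subD)
  qed (simp_all add: closed, simp add: d2_def)
  show ?thesis
  proof (rule that[OF d1D d2D])
    fix s x assume s: "s \<in> derivations L" and x: "x \<in> lcarrier L"
    obtain s' x' where sx: "\<delta> (s, x) = (s', x')"
      by fastforce
    have s': "s' \<in> derivations L" "x' \<in> lcarrier L"
      using fs[of "(s, x)"] by (simp_all add: sx)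
    have sxF: "(s, x) \<in> lcarrier ?F"
      using s x by simp
    \<comment> \<open>\<open>A\<close> and \<open>B\<close> apply \<open>\<delta>\<close> to the brackets of \<open>(s, x)\<close> with \<open>(0, y)\<close> and with \<open>(- ad y, y)\<close>.\<close>
    have A: "s' y + lbracket L x' y = d1 (s y) - s (d1 y) + lbracket L (d1 x) y"
      if y: "y \<in> lcarrier L" for y
    proof -
      have "s y + lbracket L x y \<in> lcarrier L"
        using x y lin(1)[OF s] by (simp add: subD)
      then have "d1 (s y + lbracket L x y) = s' y + lbracket L x' y + (s (d1 y) + lbracket L x (d1 y))"
        using br[OF sxF in1[OF y]] y
        by (simp add: copy1 s x s' sx d1 closed del: full_graph_simps)
      then have "d1 (s y) + lbracket L (d1 x) y = s' y + lbracket L x' y + s (d1 y)"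
        using x y by (simp add: lin[OF d1D] lin(1)[OF s] subD derivationsD(4)[OF d1D])
      then show ?thesis
        by (simp add: algebra_simps)
    qed
    have B: "s' y = d2 (s y) - s (d2 y)" if y: "y \<in> lcarrier L" for y
      using br[OF sxF in2[OF y]] y
      by (simp add: copy2 s x s' sx d2 lin(1)[OF s] closed del: full_graph_simps)
    have "s' = (d2 \<circ> s) - (s \<circ> d2)"
    proof
      fix y
      show "s' y = ((d2 \<circ> s) - (s \<circ> d2)) y"
        using B[of y] derivationsD(2)[OF s] derivationsD(2)[OF s'(1)] derivationsD(2)[OF d2D]
          lin(5)[OF s] lin(5)[OF d2D] by (cases "y \<in> lcarrier L") auto
    qed
    moreover have "lie_ad L x' = ((d1 - d2) \<circ> s) - (s \<circ> (d1 - d2)) + lie_ad L (d1 x)"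
    proof
      fix y
      show "lie_ad L x' y = (((d1 - d2) \<circ> s) - (s \<circ> (d1 - d2)) + lie_ad L (d1 x)) y"
      proof (cases "y \<in> lcarrier L")
        case True
        have "lbracket L x' y
            = (d1 (s y) - s (d1 y) + lbracket L (d1 x) y) - (d2 (s y) - s (d2 y))"
          using A[OF True] unfolding B[OF True] by (simp add: algebra_simps)
        then show ?thesis
          using True by (simp add: lin(3)[OF s closed(1) closed(2)])
      next
        case False
        then show ?thesis
          using derivationsD(2)[OF s] derivationsD(2)[OF d2D] derivationsD(2)[OF d1D]
            lin(5)[OF s] lin(5)[OF d2D] lin(5)[OF d1D] by (simp add: lie_ad_def)
      qed
    qed
    ultimately show "fst (\<delta> (s, x)) = (d2 \<circ> s) - (s \<circ> d2) \<and>
      lie_ad L (snd (\<delta> (s, x))) = ((d1 - d2) \<circ> s) - (s \<circ> (d1 - d2)) + lie_ad L (d1 x)"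
      by (simp add: sx)
  qed
qed

text \<open>
  If \<open>d1 = ad b1\<close> and \<open>d2 = ad b2\<close>, the pair \<open>(d2, d1)\<close> itself belongs to the full graph, as the
  element \<open>(d2, b1 - b2)\<close>.
\<close>

lemma lie_complete_full_graph:
  assumes L: "lie_algebra L" and comp: "lie_complete L"
  shows "lie_complete (full_graph L)"
proof -
  let ?F = "full_graph L"
  have Z: "lie_center L = {0}" and inner: "\<And>D. D \<in> derivations L \<Longrightarrow> \<exists>x\<in>lcarrier L. D = lie_ad L x"
    using comp by (auto simp: lie_complete_def)
  note F = lie_algebra_full_graph[OF L]
  note sub = lie_algebraD(1)[OF L] and zL = cvec.subspace_0[OF lie_algebraD(1)[OF L]]
  note ad = lie_ad_derivation[OF L] and adh = lie_homD[OF lie_ad_hom[OF L]]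
  note lin = derivation_linear[OF L]
  have zD: "0 \<in> derivations L"
    by (rule cvec.subspace_0[OF subspace_derivations[OF L]])
  have center: "lie_center ?F = {0}"
  proof (intro subset_antisym subsetI)
    fix p assume p: "p \<in> lie_center ?F"
    obtain s x where e: "p = (s, x)"
      by fastforce
    have s: "s \<in> derivations L" and x: "x \<in> lcarrier L"
      and c: "\<And>t y. t \<in> derivations L \<Longrightarrow> y \<in> lcarrier L \<Longrightarrow> lbracket ?F (s, x) (t, y) = 0"
      using p by (auto simp: lie_center_def e simp del: full_graph_simps(2))
    have "lie_ad L (s y) = 0" if y: "y \<in> lcarrier L" for y
      using c[OF ad[OF y] zL] derivation_lie_ad[OF L s y] by (simp add: zero_prod_def)
    then have s0: "s y = 0" if "y \<in> lcarrier L" for y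
      using lie_ad_eq_0_imp[OF Z lin(1)[OF s]] that by blast
    have "lbracket L x y = 0" if y: "y \<in> lcarrier L" for y
      using c[OF zD y] s0[OF y] by (simp add: zero_prod_def)
    then have "x = 0"
      using Z x by (auto simp: lie_center_def)
    moreover have "s = 0"
      using s0 derivationsD(2)[OF s] by fastforce
    ultimately show "p \<in> {0}"
      by (simp add: e zero_prod_def)
  next
    fix p assume "p \<in> {0::('a \<Rightarrow> 'a) \<times> 'a}"
    then show "p \<in> lie_center ?F"
      using lbracket_0(1)[OF F] cvec.subspace_0[OF lie_algebraD(1)[OF F]]
      by (simp add: lie_center_def del: full_graph_simps)
  qed
  have "\<exists>p\<in>lcarrier ?F. \<delta> = lie_ad ?F p" if \<delta>: "\<delta> \<in> derivations ?F" for \<delta>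
  proof -
    obtain d1 d2 where d: "d1 \<in> derivations L" "d2 \<in> derivations L"
      and \<delta>eq: "\<And>s x. s \<in> derivations L \<Longrightarrow> x \<in> lcarrier L \<Longrightarrow>
        fst (\<delta> (s, x)) = (d2 \<circ> s) - (s \<circ> d2) \<and>
        lie_ad L (snd (\<delta> (s, x))) = ((d1 - d2) \<circ> s) - (s \<circ> (d1 - d2)) + lie_ad L (d1 x)"
      using full_graph_derivation[OF L Z \<delta>] by metis
    obtain b1 b2 where b: "b1 \<in> lcarrier L" "d1 = lie_ad L b1" "b2 \<in> lcarrier L" "d2 = lie_ad L b2"
      using inner d by metis
    have b12: "b1 - b2 \<in> lcarrier L"
      using b cvec.subspace_diff[OF sub] by simp
    have d12: "d1 - d2 = lie_ad L (b1 - b2)"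
      using lie_hom_diff[OF lie_ad_hom[OF L] L b(1,3)] b by simp
    have "\<delta> (s, x) = lbracket ?F (d2, b1 - b2) (s, x)"
      if s: "s \<in> derivations L" and x: "x \<in> lcarrier L" for s x
    proof -
      have "snd (\<delta> (s, x)) = d2 x - s (b1 - b2) + lbracket L (b1 - b2) x"
      proof (rule inj_onD[OF lie_ad_inj[OF L Z]])
        have "lie_ad L (d2 x - s (b1 - b2) + lbracket L (b1 - b2) x)
            = lie_ad L (d1 x) - lie_ad L (s (b1 - b2))"
          using b x lin(1)[OF s] lin(1)[OF d(1)] b12
          by (simp add: lie_hom_diff[OF lie_ad_hom[OF L] L, symmetric] lbracket_diff_left[OF L]
              lie_algebraD(3)[OF L])
        also have "\<dots> = lie_ad L (snd (\<delta> (s, x)))"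
          using \<delta>eq[OF s x] derivation_lie_ad[OF L s b12] d12 by (simp add: algebra_simps)
        finally show "lie_ad L (snd (\<delta> (s, x))) = lie_ad L (d2 x - s (b1 - b2) + lbracket L (b1 - b2) x)" ..
      qed (use derivation_linear(1)[OF F \<delta>, of "(s, x)"] b12 s d x in
          \<open>simp_all add: mem_Times_iff lin lie_algebraD(3)[OF L] cvec.subspace_diff[OF sub] cvec.subspace_add[OF sub]\<close>)
      then show ?thesis
        using \<delta>eq[OF s x] by (simp add: prod_eq_iff)
    qed
    then have "\<delta> = lie_ad ?F (d2, b1 - b2)"
      using derivationsD(2)[OF \<delta>] by (auto simp: lie_ad_def fun_eq_iff simp del: full_graph_simps(2))
    then show ?thesis
      using d b12 by auto
  qed
  then show ?thesis
    using center by (simp add: lie_complete_def)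
qed

text \<open>
  In terms of pairs the full graph of \<open>L\<close> lies in \<open>Der L \<times> Der L\<close>, which is isomorphic to the full
  graph of \<open>Der L\<close> because \<open>Der L\<close> is complete. A derivation with components \<open>d1\<close>, \<open>d2\<close> is induced by
  the pair \<open>(d2, d1)\<close>, that is, by \<open>(ad d2, d1 - d2)\<close>, and \<open>(0, \<tau>)\<close> spans the quotient if \<open>\<tau>\<close> spans
  \<open>Der L\<close> modulo \<open>ad L\<close>.
\<close>

lemma full_graph_hull:
  assumes AL: "almost_complete L"
  shows "complete_hull (full_graph L) (full_graph (Der L)) (map_prod (lie_ad (Der L)) (lie_ad L))"
proof -
  interpret H: complete_hull L "Der L" "lie_ad L"
    by (rule almost_complete_imp_hull[OF AL])
  note L = H.L and D = H.K
  have Z: "lie_center L = {0}" and ZD: "lie_center (Der L) = {0}"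
    and inner: "\<And>\<Delta>. \<Delta> \<in> derivations (Der L) \<Longrightarrow> \<exists>s\<in>derivations L. \<Delta> = lie_ad (Der L) s"
    using AL by (auto simp: almost_complete_def lie_complete_def)
  let ?\<phi> = "map_prod (lie_ad (Der L)) (lie_ad L)"
  let ?F = "full_graph L" and ?G = "full_graph (Der L)"
  note F = lie_algebra_full_graph[OF L] and G = lie_algebra_full_graph[OF D]
  note sub = lie_algebraD(1)[OF L] and zL = cvec.subspace_0[OF lie_algebraD(1)[OF L]]
  note Dsub = subspace_derivations[OF L]
  note ad = lie_ad_derivation[OF L] and adh = lie_homD[OF lie_ad_hom[OF L]]
  note adD = lie_ad_derivation[OF D] and adDh = lie_homD[OF lie_ad_hom[OF D]]
  note lin = derivation_linear[OF L]
  have zD: "0 \<in> derivations L"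
    by (rule cvec.subspace_0[OF subspace_derivations[OF L]])
  have hom: "lie_hom ?\<phi> ?F ?G"
    unfolding lie_hom_def linear_on_def
  proof (intro conjI ballI allI)
    fix p q assume "p \<in> lcarrier ?F" "q \<in> lcarrier ?F"
    then obtain s x t y where e: "p = (s, x)" "q = (t, y)" and m: "s \<in> derivations L"
      "t \<in> derivations L" "x \<in> lcarrier L" "y \<in> lcarrier L"
      by (cases p, cases q) auto
    show "?\<phi> (p + q) = ?\<phi> p + ?\<phi> q"
      using m by (simp add: e adh(3) adDh(3))
    have D_ad: "lie_ad (Der L) u (lie_ad L z) = lie_ad L (u z)"
      if "u \<in> derivations L" "z \<in> lcarrier L" for u z
      using that ad derivation_lie_ad[OF L that] by simp
    have closed: "s y \<in> lcarrier L" "t x \<in> lcarrier L" "lbracket L x y \<in> lcarrier L"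
      using m lin(1) lie_algebraD(3)[OF L] by auto
    have "lie_ad L (s y - t x + lbracket L x y)
        = lie_ad L (s y) - lie_ad L (t x) + lbracket (Der L) (lie_ad L x) (lie_ad L y)"
      using closed cvec.subspace_diff[OF sub closed(1,2)]
      by (simp only: adh(3) lie_hom_diff[OF lie_ad_hom[OF L] L] adh(5)[OF m(3,4)])
    moreover have "lie_ad (Der L) ((s \<circ> t) - (t \<circ> s))
        = (lie_ad (Der L) s \<circ> lie_ad (Der L) t) - (lie_ad (Der L) t \<circ> lie_ad (Der L) s)"
      using adDh(5)[of s t] m by simp
    ultimately show "?\<phi> (lbracket ?F p q) = lbracket ?G (?\<phi> p) (?\<phi> q)"
      using m by (simp add: e D_ad)
  next
    fix p c assume "p \<in> lcarrier ?F"
    then show "?\<phi> (c *\<^sub>C p) = c *\<^sub>C ?\<phi> p"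
      by (cases p) (simp add: adh(4) adDh(4))
  qed (use adD ad in auto)
  have img: "?\<phi> ` lcarrier ?F = derivations (Der L) \<times> (lie_ad L ` lcarrier L)"
    using inner adD by (fastforce simp: map_prod_surj_on image_iff)
  show ?thesis
  proof
    show "lie_algebra ?F" "lie_algebra ?G" "lie_hom ?\<phi> ?F ?G"
      by (rule F G hom)+
    show "lie_complete ?G"
      by (rule lie_complete_full_graph[OF D H.complete])
    show "inj_on ?\<phi> (lcarrier ?F)"
      using map_prod_inj_on[OF lie_ad_inj[OF D ZD] lie_ad_inj[OF L Z]] by simp
  next
    fix k l assume kl: "k \<in> lcarrier ?G" "l \<in> lcarrier ?G"
    obtain S s T t where e: "k = (S, s)" "l = (T, t)"
      by fastforce
    have m: "S \<in> derivations (Der L)" "T \<in> derivations (Der L)" "s \<in> derivations L" "t \<in> derivations L"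
      using kl by (simp_all add: e)
    have adL: "lie_ad L ` lcarrier L = cvec.span (lie_ad L ` lcarrier L)"
      using subspace_linear_image[OF sub adh(2)] cvec.span_eq_iff by metis
    have in_ad: "S t \<in> lie_ad L ` lcarrier L" if "S \<in> derivations (Der L)" "t \<in> derivations L" for S t
      using inner[OF that(1)] H.commutators that(2) by force
    have "S t - T s + lbracket (Der L) s t \<in> lie_ad L ` lcarrier L"
      using in_ad[of S t] in_ad[of T s] H.commutators[of s t] m
      by (subst adL) (simp add: cvec.span_add cvec.span_diff cvec.span_base)
    then show "lbracket ?G k l \<in> ?\<phi> ` lcarrier ?F"
      using lie_algebraD(3)[OF G kl] unfolding img by (simp add: e)
  next
    fix k assume k: "k \<in> lcarrier ?G"
      and c: "\<And>p. p \<in> lcarrier ?F \<Longrightarrow> lbracket ?G k (?\<phi> p) = 0"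
    obtain S t where e: "k = (S, t)" and St: "S \<in> derivations (Der L)" "t \<in> derivations L"
      using k by (cases k) auto
    obtain s where s: "s \<in> derivations L" "S = lie_ad (Der L) s"
      using inner[OF St(1)] by blast
    have "lie_ad (Der L) (S u) = 0" if u: "u \<in> derivations L" for u
      using c[of "(u, 0)"] u zL derivation_lie_ad[OF D St(1), of u] by (simp add: e zero_prod_def)
    then have S0: "S u = 0" if "u \<in> derivations L" for u
      using lie_ad_eq_0_imp[OF ZD] derivation_linear(1)[OF D St(1)] that by force
    have "t = 0"
    proof (rule H.centralizer)
      show "lbracket (Der L) t (lie_ad L x) = 0" if x: "x \<in> lcarrier L" for x
        using c[of "(0, x)"] x zD S0[OF ad[OF x]] lie_hom_0[OF lie_ad_hom[OF D] D]
        by (simp add: e zero_prod_def)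
    qed (use St in simp)
    moreover have "S = 0"
      using S0 derivationsD(2)[OF St(1)] by fastforce
    ultimately show "k = 0"
      by (simp add: e zero_prod_def)
  next
    fix \<delta> assume \<delta>: "\<delta> \<in> derivations ?F"
    obtain d1 d2 where d: "d1 \<in> derivations L" "d2 \<in> derivations L"
      and \<delta>eq: "\<And>s x. s \<in> derivations L \<Longrightarrow> x \<in> lcarrier L \<Longrightarrow>
        fst (\<delta> (s, x)) = (d2 \<circ> s) - (s \<circ> d2) \<and>
        lie_ad L (snd (\<delta> (s, x))) = ((d1 - d2) \<circ> s) - (s \<circ> (d1 - d2)) + lie_ad L (d1 x)"
      using full_graph_derivation[OF L Z \<delta>] by metis
    have d12: "d1 - d2 \<in> derivations L"
      using cvec.subspace_diff[OF Dsub d] .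
    have "?\<phi> (\<delta> p) = lbracket ?G (lie_ad (Der L) d2, d1 - d2) (?\<phi> p)" if p: "p \<in> lcarrier ?F" for p
    proof -
      obtain s x where e: "p = (s, x)" and s: "s \<in> derivations L" and x: "x \<in> lcarrier L"
        using p by (cases p) auto
      have 1: "lie_ad (Der L) (fst (\<delta> p)) = (lie_ad (Der L) d2 \<circ> lie_ad (Der L) s) - (lie_ad (Der L) s \<circ> lie_ad (Der L) d2)"
        using adDh(5)[of d2 s] \<delta>eq[OF s x] s d by (simp add: e)
      have e1: "((d1 - d2) \<circ> lie_ad L x) - (lie_ad L x \<circ> (d1 - d2)) = lie_ad L (d1 x) - lie_ad L (d2 x)"
        using derivation_lie_ad[OF L d12 x] lie_hom_diff[OF lie_ad_hom[OF L] L lin(1)[OF d(1)] lin(1)[OF d(2)], of x x]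
        by simp
      have e2: "lie_ad (Der L) d2 (lie_ad L x) = lie_ad L (d2 x)"
        using d ad[OF x] derivation_lie_ad[OF L d(2) x] by simp
      have e3: "lie_ad (Der L) s (d1 - d2) = (s \<circ> (d1 - d2)) - ((d1 - d2) \<circ> s)"
        using d12 by simp
      have group: "a - b + c = c' - (b - a) + (c - c')" for a b c c' :: "'a \<Rightarrow> 'a"
        by simp
      have 2: "lie_ad L (snd (\<delta> p)) = lie_ad (Der L) d2 (lie_ad L x) - lie_ad (Der L) s (d1 - d2)
          + lbracket (Der L) (d1 - d2) (lie_ad L x)"
        unfolding Der_simps e1 e2 e3 e \<delta>eq[OF s x, THEN conjunct2] by (rule group)
      have "?\<phi> (\<delta> p) = (lie_ad (Der L) (fst (\<delta> p)), lie_ad L (snd (\<delta> p)))"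
        by (simp add: map_prod_def case_prod_beta)
      then show ?thesis
        unfolding 1 2 by (simp add: e)
    qed
    then show "\<exists>k\<in>lcarrier ?G. \<forall>p\<in>lcarrier ?F. ?\<phi> (\<delta> p) = lbracket ?G k (?\<phi> p)"
      using adD d d12 by (intro bexI[of _ "(lie_ad (Der L) d2, d1 - d2)"]) auto
  next
    obtain \<tau> where \<tau>: "\<tau> \<in> derivations L" "\<tau> \<notin> lie_ad L ` lcarrier L"
      "\<And>s. s \<in> derivations L \<Longrightarrow> \<exists>c. s - c *\<^sub>C \<tau> \<in> lie_ad L ` lcarrier L"
      using H.codim by auto
    have "\<exists>c. k - c *\<^sub>C (0, \<tau>) \<in> ?\<phi> ` lcarrier ?F" if k: "k \<in> lcarrier ?G" for k
      using k \<tau>(3)[of "snd k"] unfolding img by (cases k) auto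
    then show "\<exists>\<tau>\<in>lcarrier ?G. \<tau> \<notin> ?\<phi> ` lcarrier ?F \<and>
        (\<forall>k\<in>lcarrier ?G. \<exists>c. k - c *\<^sub>C \<tau> \<in> ?\<phi> ` lcarrier ?F)"
      using \<tau>(1,2) cvec.subspace_0[OF subspace_derivations[OF D]] unfolding img
      by (intro bexI[of _ "(0, \<tau>)"]) auto
  qed
qed

section \<open>A complete Lie algebra attached to a symplectic space\<close>

lemma finite_dimensional_UNIV_complex: "finite_dimensional (UNIV :: complex set)"
proof -
  have "x \<in> cvec.span {1}" for x :: complex
    using cvec.span_scale[OF cvec.span_base[of 1 "{1 :: complex}"], of x]
    by (simp add: scaleC_complex_def del: cvec.span_scale)
  then show ?thesis
    unfolding finite_dimensional_def by (intro exI[of _ "{1}"]) auto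
qed

text \<open>
  Two independent vectors have the same eigenvalue because their sum is an eigenvector too.
\<close>

lemma scalar_if_all_eigenvectors:
  assumes V: "cvec.subspace V" and f: "linear_on V f"
    and eig: "\<And>u. u \<in> V \<Longrightarrow> \<exists>t. f u = t *\<^sub>C u"
  obtains t where "\<And>u. u \<in> V \<Longrightarrow> f u = t *\<^sub>C u"
proof (cases "\<exists>u\<in>V. u \<noteq> 0")
  case False
  then show ?thesis
    using linear_on_0[OF V f] by (intro that[of 0]) auto
next
  case True
  then obtain w t where w: "w \<in> V" "w \<noteq> 0" "f w = t *\<^sub>C w"
    using eig by blast
  have "f u = t *\<^sub>C u" if u: "u \<in> V" for u
  proof -
    obtain k where k: "f u = k *\<^sub>C u"
      using eig[OF u] by blast
    obtain m where m: "f (u + w) = m *\<^sub>C (u + w)"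
      using eig cvec.subspace_add[OF V u w(1)] by blast
    have *: "(k - m) *\<^sub>C u = (m - t) *\<^sub>C w"
      using m k w(3) linear_on_add[OF f u w(1)] by (simp add: algebra_simps)
    show ?thesis
    proof (cases "k = m")
      case True
      then have "m = t"
        using * w(2) by simp
      then show ?thesis
        using k True by simp
    next
      case False
      then have "u = ((m - t) / (k - m)) *\<^sub>C w"
        using arg_cong[OF *, of "scaleC (1 / (k - m))"] by simp
      then show ?thesis
        using linear_on_scale[OF f w(1)] w(3) by (metis cvec.scale_left_commute)
    qed
  qed
  then show ?thesis
    using that by blast
qed

locale symplectic_space =
  fixes V :: "'a::complex_vector set" and \<omega> :: "'a \<Rightarrow> 'a \<Rightarrow> complex"
  assumes V: "cvec.subspace V" and fin: "finite_dimensional V"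
    and form_right: "x \<in> V \<Longrightarrow> linear_on V (\<omega> x)"
    and form_left: "y \<in> V \<Longrightarrow> linear_on V (\<lambda>x. \<omega> x y)"
    and form_self: "x \<in> V \<Longrightarrow> \<omega> x x = 0"
    and nondegenerate: "x \<in> V \<Longrightarrow> (\<And>y. y \<in> V \<Longrightarrow> \<omega> x y = 0) \<Longrightarrow> x = 0"
    and nontrivial: "\<exists>x\<in>V. x \<noteq> 0"
begin

lemma closed [simp]:
  "0 \<in> V" "x \<in> V \<Longrightarrow> y \<in> V \<Longrightarrow> x + y \<in> V" "x \<in> V \<Longrightarrow> y \<in> V \<Longrightarrow> x - y \<in> V"
  "x \<in> V \<Longrightarrow> c *\<^sub>C x \<in> V" "x \<in> V \<Longrightarrow> - x \<in> V"
  using V by (auto intro: cvec.subspace_0 cvec.subspace_add cvec.subspace_diff cvec.subspace_scale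
      cvec.subspace_neg)

lemma form_simps [simp]:
  assumes "x \<in> V" "y \<in> V"
  shows "z \<in> V \<Longrightarrow> \<omega> (x + y) z = \<omega> x z + \<omega> y z" "z \<in> V \<Longrightarrow> \<omega> x (y + z) = \<omega> x y + \<omega> x z"
    "z \<in> V \<Longrightarrow> \<omega> (x - y) z = \<omega> x z - \<omega> y z" "z \<in> V \<Longrightarrow> \<omega> x (y - z) = \<omega> x y - \<omega> x z"
    "\<omega> (c *\<^sub>C x) y = c * \<omega> x y" "\<omega> x (c *\<^sub>C y) = c * \<omega> x y"
    "\<omega> (- x) y = - \<omega> x y" "\<omega> x (- y) = - \<omega> x y"
proof -
  note r = form_right[OF assms(1)] and l = form_left[OF assms(2)]
  show "z \<in> V \<Longrightarrow> \<omega> (x + y) z = \<omega> x z + \<omega> y z" "z \<in> V \<Longrightarrow> \<omega> (x - y) z = \<omega> x z - \<omega> y z"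
    using assms form_left[of z] linear_on_add[of V "\<lambda>x. \<omega> x z"] linear_on_diff[OF V, of "\<lambda>x. \<omega> x z"]
    by auto
  show "z \<in> V \<Longrightarrow> \<omega> x (y + z) = \<omega> x y + \<omega> x z" "z \<in> V \<Longrightarrow> \<omega> x (y - z) = \<omega> x y - \<omega> x z"
    using assms linear_on_add[OF r] linear_on_diff[OF V r] by auto
  show "\<omega> (c *\<^sub>C x) y = c * \<omega> x y" "\<omega> x (c *\<^sub>C y) = c * \<omega> x y"
    using assms linear_on_scale[OF l, of x c] linear_on_scale[OF r, of y c] by auto
  show "\<omega> (- x) y = - \<omega> x y" "\<omega> x (- y) = - \<omega> x y"
    using assms linear_on_scale[OF l, of x "-1"] linear_on_scale[OF r, of y "-1"]
    by (auto simp: cvec.scale_minus_left)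
qed

lemma form_0 [simp]: "x \<in> V \<Longrightarrow> \<omega> 0 x = 0" "x \<in> V \<Longrightarrow> \<omega> x 0 = 0"
  using linear_on_0[OF V form_left] linear_on_0[OF V form_right] by auto

lemma form_anti: "x \<in> V \<Longrightarrow> y \<in> V \<Longrightarrow> \<omega> x y = - \<omega> y x"
  using form_self[of "x + y"] form_self[of x] form_self[of y]
  by (simp add: eq_neg_iff_add_eq_0 add.commute)

lemma form_normalize:
  assumes "u \<in> V" "u \<noteq> 0"
  obtains v where "v \<in> V" "\<omega> u v = 1"
proof -
  obtain v where v: "v \<in> V" "\<omega> u v \<noteq> 0"
    using nondegenerate assms by blast
  show ?thesis
    using that[of "(1 / \<omega> u v) *\<^sub>C v"] v assms by simp
qed

definition sp :: "('a \<Rightarrow> 'a) set" where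
  "sp = {R. (\<forall>x\<in>V. R x \<in> V) \<and> (\<forall>x. x \<notin> V \<longrightarrow> R x = 0) \<and> linear_on V R \<and>
     (\<forall>x\<in>V. \<forall>y\<in>V. \<omega> (R x) y + \<omega> x (R y) = 0)}"

lemma spD:
  assumes "R \<in> sp"
  shows "R x \<in> V" "x \<notin> V \<Longrightarrow> R x = 0" "linear_on V R"
    and "x \<in> V \<Longrightarrow> y \<in> V \<Longrightarrow> R (x + y) = R x + R y" "x \<in> V \<Longrightarrow> y \<in> V \<Longrightarrow> R (x - y) = R x - R y"
    and "x \<in> V \<Longrightarrow> R (c *\<^sub>C x) = c *\<^sub>C R x" "R 0 = 0" "x \<in> V \<Longrightarrow> R (- x) = - R x"
    and "x \<in> V \<Longrightarrow> y \<in> V \<Longrightarrow> \<omega> (R x) y = - \<omega> x (R y)"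
proof -
  show lin: "linear_on V R" and "x \<notin> V \<Longrightarrow> R x = 0"
    and "x \<in> V \<Longrightarrow> y \<in> V \<Longrightarrow> \<omega> (R x) y = - \<omega> x (R y)"
    using assms by (auto simp: sp_def eq_neg_iff_add_eq_0)
  show "R x \<in> V"
    using assms by (cases "x \<in> V") (auto simp: sp_def)
  show "x \<in> V \<Longrightarrow> R (- x) = - R x"
    using linear_on_scale[OF lin, of x "-1"] by (simp add: cvec.scale_minus_left)
qed (use assms in \<open>auto simp: sp_def linear_on_add linear_on_scale linear_on_diff[OF V] linear_on_0[OF V]\<close>)

lemma form_sp_swap:
  assumes "R \<in> sp" "x \<in> V" "y \<in> V"
  shows "\<omega> y (R x) = \<omega> x (R y)"
  using form_anti[OF assms(3) spD(1)[OF assms(1)], of x] spD(9)[OF assms] by simp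

lemma sp_subspace: "cvec.subspace sp"
  unfolding cvec.subspace_def
proof (intro conjI ballI allI)
  fix R T c assume R: "R \<in> sp" and T: "T \<in> sp"
  show "R + T \<in> sp"
    using spD(1,2,4,6)[OF R] spD(1,2,4,6)[OF T] spD(9)[OF R] spD(9)[OF T]
    by (simp add: sp_def linear_on_def scaleC_add_right)
next
  fix R c assume R: "R \<in> sp"
  show "c *\<^sub>C R \<in> sp"
    using spD(1,2,4,6)[OF R] spD(9)[OF R]
    by (simp add: sp_def linear_on_def scaleC_add_right mult.commute)
qed (simp add: sp_def linear_on_def)

lemma sp_commutator:
  assumes "R \<in> sp" "T \<in> sp"
  shows "(R \<circ> T) - (T \<circ> R) \<in> sp"
  using spD(1,2,4,6,7)[OF assms(1)] spD(1,2,4,6,7)[OF assms(2)] spD(9)[OF assms(1)] spD(9)[OF assms(2)]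
  by (simp add: sp_def linear_on_def cvec.scale_right_diff_distrib)

lemma sp_finite_dimensional: "finite_dimensional sp"
proof -
  \<comment> \<open>The derivations of an abelian Lie algebra are all its linear endomorphisms.\<close>
  have "lie_algebra \<lparr>lcarrier = V, lbracket = \<lambda>x y. 0\<rparr>"
    using V fin by (simp add: lie_algebra_def linear_on_def)
  from finite_dimensional_derivations[OF this] show ?thesis
    by (rule finite_dimensional_subset) (auto simp: sp_def derivations_def linear_on_0[OF V])
qed

text \<open>
  An infinitesimal symplectic transvection, of rank one if \<open>u \<noteq> 0\<close>. These elements of \<open>sp\<close> suffice for a Schur lemma, and \<open>transvection u\<close> kills \<open>u\<close>,
  which makes that lemma elementary.
\<close>

definition transvection :: "'a \<Rightarrow> 'a \<Rightarrow> 'a" where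
  "transvection u = (\<lambda>v. if v \<in> V then \<omega> u v *\<^sub>C u else 0)"

lemma transvection_sp:
  assumes "u \<in> V"
  shows "transvection u \<in> sp"
proof -
  have "\<omega> u x * \<omega> u y + \<omega> u y * \<omega> x u = 0" if "x \<in> V" "y \<in> V" for x y
    using form_anti[OF that(1) assms] by simp
  then show ?thesis
    using assms by (simp add: sp_def transvection_def linear_on_def scaleC_add_left scaleC_scaleC)
qed

text \<open>
  The hypothesis allows the commutator to be a scalar \<open>g\<close>, since only this much is known about the
  difference of the two diagonal blocks of a cocycle in \<open>cocycle_inner\<close>. Evaluating the
  commutator with the transvection of \<open>u\<close> at \<open>u\<close> and at some \<open>v\<close> with \<open>\<omega> u v = 1\<close> gives
  \<open>\<omega> u (f u) = - g\<close> and \<open>\<omega> u (f u) = g\<close>, so \<open>g = 0\<close> and \<open>u\<close> is an eigenvector of \<open>f\<close>.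
\<close>

lemma scalar_if_commutes_with_transvections:
  assumes f: "linear_on V f" "\<And>x. x \<in> V \<Longrightarrow> f x \<in> V"
    and comm: "\<And>u. u \<in> V \<Longrightarrow> \<exists>g. \<forall>v\<in>V. f (transvection u v) - transvection u (f v) = g *\<^sub>C v"
  obtains t where "\<And>u. u \<in> V \<Longrightarrow> f u = t *\<^sub>C u"
proof (rule scalar_if_all_eigenvectors[OF V f(1)])
  fix u assume u: "u \<in> V"
  show "\<exists>t. f u = t *\<^sub>C u"
  proof (cases "u = 0")
    case True
    then show ?thesis
      using linear_on_0[OF V f(1)] by simp
  next
    case False
    obtain v where v: "v \<in> V" "\<omega> u v = 1"
      using form_normalize[OF u False] .
    obtain g where g: "\<And>w. w \<in> V \<Longrightarrow> f (\<omega> u w *\<^sub>C u) - \<omega> u (f w) *\<^sub>C u = g *\<^sub>C w"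
      using comm[OF u] f(2) by (auto simp: transvection_def)
    have "- \<omega> u (f u) *\<^sub>C u = g *\<^sub>C u"
      using g[OF u] linear_on_0[OF V f(1)] form_self[OF u] by (simp add: cvec.scale_minus_left)
    then have 1: "\<omega> u (f u) = - g"
      using False by (metis cvec.scale_right_imp_eq minus_minus)
    have 2: "f u - \<omega> u (f v) *\<^sub>C u = g *\<^sub>C v"
      using g[OF v(1)] v by (simp add: scaleC_one)
    have "\<omega> u (f u - \<omega> u (f v) *\<^sub>C u) = \<omega> u (g *\<^sub>C v)"
      by (simp only: 2)
    then have "\<omega> u (f u) = g"
      using u v f(2)[OF u] form_self[OF u] by simp
    with 1 have "g = 0"
      by simp
    with 2 show ?thesis
      by auto
  qed
qed (rule that)

text \<open>
  Semidirect product of \<open>sp(V) \<oplus> \<complex>\<^sup>2\<close> with the Heisenberg algebra on \<open>V \<oplus> V\<close> in which each copy of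
  \<open>V\<close> is isotropic and the two are paired by \<open>\<omega>\<close>. The element \<open>(R, \<alpha>, \<beta>)\<close> acts on the first copy by
  \<open>R + \<alpha>\<close>, on the second by \<open>R + \<beta>\<close> and on the center of the Heisenberg algebra by \<open>\<alpha> + \<beta>\<close>.
\<close>

definition sp_hull :: "(('a \<Rightarrow> 'a) \<times> complex \<times> complex \<times> 'a \<times> 'a \<times> complex) lie_alg" where
  "sp_hull = \<lparr>lcarrier = sp \<times> UNIV \<times> UNIV \<times> V \<times> V \<times> UNIV,
     lbracket = (\<lambda>(R, \<alpha>, \<beta>, x, y, z) (R', \<alpha>', \<beta>', x', y', z').
       ((R \<circ> R') - (R' \<circ> R), 0, 0,
        (R x' + \<alpha> *\<^sub>C x') - (R' x + \<alpha>' *\<^sub>C x), (R y' + \<beta> *\<^sub>C y') - (R' y + \<beta>' *\<^sub>C y),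
        (\<alpha> + \<beta>) * z' - (\<alpha>' + \<beta>') * z + \<omega> x y' + \<omega> y x'))\<rparr>"

lemma sp_hull_carrier: "lcarrier sp_hull = sp \<times> UNIV \<times> UNIV \<times> V \<times> V \<times> UNIV"
  by (simp add: sp_hull_def)

lemma sp_hull_bracket [simp]:
  "lbracket sp_hull (R, \<alpha>, \<beta>, x, y, z) (R', \<alpha>', \<beta>', x', y', z') =
    ((R \<circ> R') - (R' \<circ> R), 0, 0,
     (R x' + \<alpha> *\<^sub>C x') - (R' x + \<alpha>' *\<^sub>C x), (R y' + \<beta> *\<^sub>C y') - (R' y + \<beta>' *\<^sub>C y),
     (\<alpha> + \<beta>) * z' - (\<alpha>' + \<beta>') * z + \<omega> x y' + \<omega> y x')"
  by (simp add: sp_hull_def)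

lemma sp_hull_mem [simp]:
  "(R, \<alpha>, \<beta>, x, y, z) \<in> lcarrier sp_hull \<longleftrightarrow> R \<in> sp \<and> x \<in> V \<and> y \<in> V"
  by (simp add: sp_hull_carrier)

lemma lie_algebra_sp_hull: "lie_algebra sp_hull"
  unfolding lie_algebra_def linear_on_def
proof (intro conjI ballI allI)
  show "cvec.subspace (lcarrier sp_hull)"
    unfolding sp_hull_carrier by (intro subspace_Times sp_subspace V cvec.subspace_UNIV)
  show "finite_dimensional (lcarrier sp_hull)"
    unfolding sp_hull_carrier
    by (intro finite_dimensional_Times subspace_Times sp_subspace V cvec.subspace_UNIV
        sp_finite_dimensional fin finite_dimensional_UNIV_complex)
next
  fix p q assume pq: "p \<in> lcarrier sp_hull" "q \<in> lcarrier sp_hull"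
  obtain R \<alpha> \<beta> x y z where p: "p = (R, \<alpha>, \<beta>, x, y, z)"
    by (metis prod.exhaust)
  obtain R' \<alpha>' \<beta>' x' y' z' where q: "q = (R', \<alpha>', \<beta>', x', y', z')"
    by (metis prod.exhaust)
  have R: "R \<in> sp" and R': "R' \<in> sp" and m: "x \<in> V" "y \<in> V" "x' \<in> V" "y' \<in> V"
    using pq by (simp_all add: p q)
  note s = spD(1,4,5,6,7)[OF R] spD(1,4,5,6,7)[OF R']
  show "lbracket sp_hull p q \<in> lcarrier sp_hull"
    using m s sp_commutator[OF R R'] by (simp add: p q)
  show "lbracket sp_hull p p = 0"
    using m form_anti[of x y] by (simp add: p zero_prod_def)
  fix c
  show "lbracket sp_hull p (c *\<^sub>C q) = c *\<^sub>C lbracket sp_hull p q"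
    using m by (simp add: p q s fun_eq_iff algebra_simps)
  show "lbracket sp_hull (c *\<^sub>C q) p = c *\<^sub>C lbracket sp_hull q p"
    using m by (simp add: p q s fun_eq_iff algebra_simps)
next
  fix p1 p2 p3 assume ps: "p1 \<in> lcarrier sp_hull" "p2 \<in> lcarrier sp_hull" "p3 \<in> lcarrier sp_hull"
  obtain R1 \<alpha>1 \<beta>1 x1 y1 z1 where p1: "p1 = (R1, \<alpha>1, \<beta>1, x1, y1, z1)"
    by (metis prod.exhaust)
  obtain R2 \<alpha>2 \<beta>2 x2 y2 z2 where p2: "p2 = (R2, \<alpha>2, \<beta>2, x2, y2, z2)"
    by (metis prod.exhaust)
  obtain R3 \<alpha>3 \<beta>3 x3 y3 z3 where p3: "p3 = (R3, \<alpha>3, \<beta>3, x3, y3, z3)"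
    by (metis prod.exhaust)
  have R: "R1 \<in> sp" "R2 \<in> sp" "R3 \<in> sp"
    and m: "x1 \<in> V" "x2 \<in> V" "x3 \<in> V" "y1 \<in> V" "y2 \<in> V" "y3 \<in> V"
    using ps by (simp_all add: p1 p2 p3)
  note s = spD(1,4,5,6,7)[OF R(1)] spD(1,4,5,6,7)[OF R(2)] spD(1,4,5,6,7)[OF R(3)]
  show "lbracket sp_hull p1 (p2 + p3) = lbracket sp_hull p1 p2 + lbracket sp_hull p1 p3"
    using m by (simp add: p1 p2 p3 s fun_eq_iff algebra_simps)
  show "lbracket sp_hull (p2 + p3) p1 = lbracket sp_hull p2 p1 + lbracket sp_hull p3 p1"
    using m by (simp add: p1 p2 p3 s fun_eq_iff algebra_simps)
  have swap: "\<omega> y1 (R2 x3) = \<omega> x3 (R2 y1)" "\<omega> y1 (R3 x2) = \<omega> x2 (R3 y1)"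
    "\<omega> y2 (R1 x3) = \<omega> x3 (R1 y2)" "\<omega> y2 (R3 x1) = \<omega> x1 (R3 y2)"
    "\<omega> y3 (R2 x1) = \<omega> x1 (R2 y3)" "\<omega> y3 (R1 x2) = \<omega> x2 (R1 y3)"
    using R m form_sp_swap by blast+
  have anti: "\<omega> y1 x2 = - \<omega> x2 y1" "\<omega> y1 x3 = - \<omega> x3 y1" "\<omega> y2 x1 = - \<omega> x1 y2"
    "\<omega> y2 x3 = - \<omega> x3 y2" "\<omega> y3 x1 = - \<omega> x1 y3" "\<omega> y3 x2 = - \<omega> x2 y3"
    using m form_anti by blast+
  show "lbracket sp_hull p1 (lbracket sp_hull p2 p3) + lbracket sp_hull p2 (lbracket sp_hull p3 p1)
      + lbracket sp_hull p3 (lbracket sp_hull p1 p2) = 0"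
    using m by (simp add: p1 p2 p3 s swap anti fun_eq_iff zero_prod_def algebra_simps)
qed

text \<open>
  The subalgebra where both copies of \<open>V\<close> are scaled equally. It turns out to be the full graph of a
  Heisenberg algebra, with \<open>sp_hull\<close> as its derivation algebra.
\<close>

definition sp_ideal :: "(('a \<Rightarrow> 'a) \<times> complex \<times> complex \<times> 'a \<times> 'a \<times> complex) lie_alg" where
  "sp_ideal = \<lparr>lcarrier = {(R, \<alpha>, \<beta>, x, y, z). R \<in> sp \<and> \<alpha> = \<beta> \<and> x \<in> V \<and> y \<in> V},
     lbracket = lbracket sp_hull\<rparr>"

lemma sp_ideal_mem [simp]:
  "(R, \<alpha>, \<beta>, x, y, z) \<in> lcarrier sp_ideal \<longleftrightarrow> R \<in> sp \<and> \<alpha> = \<beta> \<and> x \<in> V \<and> y \<in> V"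
  by (simp add: sp_ideal_def)

lemma sp_ideal_bracket [simp]: "lbracket sp_ideal = lbracket sp_hull"
  by (simp add: sp_ideal_def)

lemma sp_ideal_subset: "p \<in> lcarrier sp_ideal \<Longrightarrow> p \<in> lcarrier sp_hull"
  by (cases p) auto

lemma sp_hull_commutators:
  assumes "p \<in> lcarrier sp_hull" "q \<in> lcarrier sp_hull"
  shows "lbracket sp_hull p q \<in> lcarrier sp_ideal"
  using assms by (cases p, cases q) (simp add: sp_commutator spD)

lemma sp_0 [simp]: "0 \<in> sp"
  by (rule cvec.subspace_0[OF sp_subspace])

lemma zero_comp [simp]: "(0 :: 'b \<Rightarrow> 'a) \<circ> R = 0"
  by (simp add: fun_eq_iff)

lemma sp_comp_zero [simp]: "R \<in> sp \<Longrightarrow> R \<circ> 0 = 0"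
  by (simp add: fun_eq_iff spD)

lemma lie_algebra_sp_ideal: "lie_algebra sp_ideal"
proof -
  note H = lie_algebraD[OF lie_algebra_sp_hull] and i = sp_ideal_subset
  have "cvec.subspace (lcarrier sp_ideal)"
    unfolding cvec.subspace_def
    by (auto simp: zero_prod_def cvec.subspace_add[OF sp_subspace] cvec.subspace_scale[OF sp_subspace])
  moreover have "finite_dimensional (lcarrier sp_ideal)"
    by (rule finite_dimensional_subset[OF H(2)]) (use i in blast)
  moreover have "linear_on (lcarrier sp_ideal) f" if "linear_on (lcarrier sp_hull) f"
    for f :: "_ \<Rightarrow> ('a \<Rightarrow> 'a) \<times> complex \<times> complex \<times> 'a \<times> 'a \<times> complex"
    using that i by (auto simp only: linear_on_def)
  ultimately show ?thesis
    unfolding lie_algebra_def sp_ideal_bracket using H(4-7) i sp_hull_commutators by simp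
qed

text \<open>
  The Euler element has weight 0 on \<open>sp(V) \<oplus> \<complex>\<^sup>2\<close>, weight 1 on both copies of \<open>V\<close> and weight 2 on the
  center of the Heisenberg algebra.
\<close>

abbreviation euler where "euler \<equiv> (0 :: 'a \<Rightarrow> 'a, 1 :: complex, 1 :: complex, 0 :: 'a, 0 :: 'a, 0 :: complex)"
abbreviation in_x where "in_x v \<equiv> (0 :: 'a \<Rightarrow> 'a, 0 :: complex, 0 :: complex, v :: 'a, 0 :: 'a, 0 :: complex)"
abbreviation in_y where "in_y v \<equiv> (0 :: 'a \<Rightarrow> 'a, 0 :: complex, 0 :: complex, 0 :: 'a, v :: 'a, 0 :: complex)"
abbreviation in_z where "in_z c \<equiv> (0 :: 'a \<Rightarrow> 'a, 0 :: complex, 0 :: complex, 0 :: 'a, 0 :: 'a, c :: complex)"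
abbreviation in_sp where "in_sp R \<equiv> (R :: 'a \<Rightarrow> 'a, 0 :: complex, 0 :: complex, 0 :: 'a, 0 :: 'a, 0 :: complex)"

lemma form_nonzero: obtains v w where "v \<in> V" "w \<in> V" "\<omega> v w = 1"
  using nontrivial form_normalize by blast

text \<open>
  A scalar \<open>R = - \<alpha>\<close> in \<open>sp\<close> satisfies \<open>2 \<alpha> \<omega> = 0\<close>, and \<open>\<omega>\<close> is not zero.
\<close>

lemma degree_zero_faithful:
  assumes R: "R \<in> sp" and x: "\<And>v. v \<in> V \<Longrightarrow> R v + \<alpha> *\<^sub>C v = 0"
    and y: "\<And>v. v \<in> V \<Longrightarrow> R v + \<beta> *\<^sub>C v = 0"
  shows "R = 0" "\<alpha> = 0" "\<beta> = 0"
proof -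
  obtain v w where vw: "v \<in> V" "w \<in> V" "\<omega> v w = 1"
    by (rule form_nonzero)
  have Rv: "R u = - (\<alpha> *\<^sub>C u)" "R u = - (\<beta> *\<^sub>C u)" if "u \<in> V" for u
    using x[OF that] y[OF that] by (simp_all add: eq_neg_iff_add_eq_0)
  have skew: "\<omega> (R v) w = - \<omega> v (R w)"
    by (rule spD(9)[OF R vw(1,2)])
  show \<alpha>: "\<alpha> = 0"
    using skew vw by (simp add: Rv(1))
  show "\<beta> = 0"
    using skew vw by (simp add: Rv(2))
  show "R = 0"
  proof
    fix u
    show "R u = 0 u"
      using Rv(1)[of u] spD(2)[OF R, of u] \<alpha> by (cases "u \<in> V") auto
  qed
qed

lemma sp_hull_centralizer:
  assumes k: "k \<in> lcarrier sp_hull"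
    and c: "\<And>p. p \<in> lcarrier sp_ideal \<Longrightarrow> lbracket sp_hull k p = 0"
  shows "k = 0"
proof -
  obtain R \<alpha> \<beta> x y z where e: "k = (R, \<alpha>, \<beta>, x, y, z)"
    by (metis prod.exhaust)
  have m: "R \<in> sp" "x \<in> V" "y \<in> V"
    using k by (simp_all add: e)
  have xyz: "x = 0" "y = 0" "z = 0"
    using c[of euler] m by (simp_all add: e zero_prod_def spD scaleC_one)
  have "R v + \<alpha> *\<^sub>C v = 0" "R v + \<beta> *\<^sub>C v = 0" if "v \<in> V" for v
    using c[of "in_x v"] c[of "in_y v"] m that by (simp_all add: e zero_prod_def)
  note degree_zero_faithful[OF m(1) this]
  then show ?thesis
    by (simp add: e xyz zero_prod_def)
qed

text \<open>
  Derivations of the ideal with values in the whole hull. Working with these settles two questions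
  together: derivations of \<open>sp_ideal\<close> and restrictions of derivations of \<open>sp_hull\<close> are both cocycles.
\<close>

definition cocycle where
  "cocycle \<delta> \<longleftrightarrow> linear_on (lcarrier sp_ideal) \<delta> \<and> (\<forall>p\<in>lcarrier sp_ideal. \<delta> p \<in> lcarrier sp_hull) \<and>
     (\<forall>p\<in>lcarrier sp_ideal. \<forall>q\<in>lcarrier sp_ideal.
        \<delta> (lbracket sp_hull p q) = lbracket sp_hull (\<delta> p) q + lbracket sp_hull p (\<delta> q))"

lemma cocycleD:
  assumes "cocycle \<delta>" "p \<in> lcarrier sp_ideal"
  shows "\<delta> p \<in> lcarrier sp_hull" "q \<in> lcarrier sp_ideal \<Longrightarrow> \<delta> (p + q) = \<delta> p + \<delta> q"
    "\<delta> (c *\<^sub>C p) = c *\<^sub>C \<delta> p"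
    "q \<in> lcarrier sp_ideal \<Longrightarrow>
      \<delta> (lbracket sp_hull p q) = lbracket sp_hull (\<delta> p) q + lbracket sp_hull p (\<delta> q)"
  using assms by (auto simp: cocycle_def linear_on_def)

lemma cocycle_0: "cocycle \<delta> \<Longrightarrow> \<delta> 0 = 0"
  using linear_on_0[OF lie_algebraD(1)[OF lie_algebra_sp_ideal], of \<delta>] by (simp add: cocycle_def)

lemma cocycle_minus_inner:
  assumes \<delta>: "cocycle \<delta>" and k: "k \<in> lcarrier sp_hull"
  shows "cocycle (\<lambda>p. \<delta> p - lbracket sp_hull k p)"
proof -
  note H = lie_algebra_sp_hull and i = sp_ideal_subset
  note sub = lie_algebraD(1)[OF H] and br = lie_algebraD(3)[OF H]
  note d = cocycleD[OF \<delta>]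
  show ?thesis
    unfolding cocycle_def linear_on_def
  proof (intro conjI ballI allI)
    fix p q assume pq: "p \<in> lcarrier sp_ideal" "q \<in> lcarrier sp_ideal"
    note m = i[OF pq(1)] i[OF pq(2)]
    show "\<delta> (p + q) - lbracket sp_hull k (p + q)
        = \<delta> p - lbracket sp_hull k p + (\<delta> q - lbracket sp_hull k q)"
      using pq m k by (simp add: d lbracket_add_right[OF H])
    show "\<delta> (lbracket sp_hull p q) - lbracket sp_hull k (lbracket sp_hull p q)
        = lbracket sp_hull (\<delta> p - lbracket sp_hull k p) q
          + lbracket sp_hull p (\<delta> q - lbracket sp_hull k q)"
      using pq m k by (simp add: d(1,4) lie_jacobi_left[OF H k] lbracket_diff_left[OF H]
          lbracket_diff_right[OF H] br)
  next
    fix p c assume p: "p \<in> lcarrier sp_ideal"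
    show "\<delta> (c *\<^sub>C p) - lbracket sp_hull k (c *\<^sub>C p) = c *\<^sub>C (\<delta> p - lbracket sp_hull k p)"
      using p i k by (simp add: d lbracket_scale_right[OF H] cvec.scale_right_diff_distrib)
    show "\<delta> p - lbracket sp_hull k p \<in> lcarrier sp_hull"
      using p i k by (simp add: d br cvec.subspace_diff[OF sub])
  qed
qed

text \<open>
  An inner cocycle removes the components of \<open>\<delta> euler\<close> of nonzero weight. The component that is left
  commutes with everything of weight 1: apply \<open>\<delta>\<close> to \<open>[euler, v] = v\<close> and compare the parts of weight 1.
  By faithfulness it is zero.
\<close>

lemma cocycle_inner_on_euler:
  assumes \<delta>: "cocycle \<delta>"
  obtains k where "k \<in> lcarrier sp_hull" "\<delta> euler = lbracket sp_hull k euler"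
proof -
  obtain R \<alpha> \<beta> x y z where e: "\<delta> euler = (R, \<alpha>, \<beta>, x, y, z)"
    by (metis prod.exhaust)
  have m: "R \<in> sp" "x \<in> V" "y \<in> V"
    using cocycleD(1)[OF \<delta>, of euler] by (simp_all add: e)
  let ?k = "(0, 0, 0, - x, - y, - z / 2) :: ('a \<Rightarrow> 'a) \<times> complex \<times> complex \<times> 'a \<times> 'a \<times> complex"
  have k: "?k \<in> lcarrier sp_hull"
    using m by simp
  define \<delta>' where "\<delta>' = (\<lambda>p. \<delta> p - lbracket sp_hull ?k p)"
  have \<delta>': "cocycle \<delta>'"
    unfolding \<delta>'_def by (rule cocycle_minus_inner[OF \<delta> k])
  have e': "\<delta>' euler = (R, \<alpha>, \<beta>, 0, 0, 0)"
    using m by (simp add: \<delta>'_def e scaleC_one fun_eq_iff zero_prod_def)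
  have "R v + \<alpha> *\<^sub>C v = 0" if v: "v \<in> V" for v
  proof -
    obtain T a b p q r where t: "\<delta>' (in_x v) = (T, a, b, p, q, r)"
      by (metis prod.exhaust)
    have "T \<in> sp"
      using cocycleD(1)[OF \<delta>', of "in_x v"] v by (simp add: t)
    then show ?thesis
      using cocycleD(4)[OF \<delta>', of euler "in_x v"] v m
      by (simp add: t e' scaleC_one spD)
  qed
  moreover have "R v + \<beta> *\<^sub>C v = 0" if v: "v \<in> V" for v
  proof -
    obtain T a b p q r where t: "\<delta>' (in_y v) = (T, a, b, p, q, r)"
      by (metis prod.exhaust)
    have "T \<in> sp"
      using cocycleD(1)[OF \<delta>', of "in_y v"] v by (simp add: t)
    then show ?thesis
      using cocycleD(4)[OF \<delta>', of euler "in_y v"] v m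
      by (simp add: t e' scaleC_one spD)
  qed
  ultimately have "R = 0" "\<alpha> = 0" "\<beta> = 0"
    using degree_zero_faithful[OF m(1)] by blast+
  then have "\<delta>' euler = 0"
    by (simp add: e' zero_prod_def)
  then show ?thesis
    using that[OF k] by (simp add: \<delta>'_def)
qed

text \<open>
  A cocycle that kills the Euler element commutes with its action and therefore preserves weights.
\<close>

lemma cocycle_graded:
  assumes \<delta>: "cocycle \<delta>" and e: "\<delta> euler = 0"
  shows "v \<in> V \<Longrightarrow> \<exists>x\<in>V. \<exists>y\<in>V. \<delta> (in_x v) = (0, 0, 0, x, y, 0)"
    and "v \<in> V \<Longrightarrow> \<exists>x\<in>V. \<exists>y\<in>V. \<delta> (in_y v) = (0, 0, 0, x, y, 0)"
    and "\<exists>z. \<delta> (in_z 1) = in_z z"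
    and "R \<in> sp \<Longrightarrow> \<exists>T\<in>sp. \<exists>\<alpha> \<beta>. \<delta> (in_sp R) = (T, \<alpha>, \<beta>, 0, 0, 0)"
proof -
  have comm: "\<delta> (lbracket sp_hull euler p) = lbracket sp_hull euler (\<delta> p)"
    if "p \<in> lcarrier sp_ideal" for p
    using cocycleD(4)[OF \<delta>, of euler p] that e cocycleD(1)[OF \<delta> that]
      lbracket_0(1)[OF lie_algebra_sp_hull sp_ideal_subset[OF that]] by simp
  have eu: "lbracket sp_hull euler (R, \<alpha>, \<beta>, x, y, z) = (0, 0, 0, x, y, 2 * z)"
    if "R \<in> sp" "x \<in> V" "y \<in> V" for R \<alpha> \<beta> x y z
    using that by (simp add: scaleC_one spD fun_eq_iff)
  have mem: "\<exists>R\<in>sp. \<exists>\<alpha> \<beta>. \<exists>x\<in>V. \<exists>y\<in>V. \<exists>z. \<delta> p = (R, \<alpha>, \<beta>, x, y, z)"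
    if "p \<in> lcarrier sp_ideal" for p
    using cocycleD(1)[OF \<delta> that] by (cases "\<delta> p") auto
  show "\<exists>x\<in>V. \<exists>y\<in>V. \<delta> (in_x v) = (0, 0, 0, x, y, 0)" if v: "v \<in> V"
  proof -
    obtain R \<alpha> \<beta> x y z where t: "R \<in> sp" "x \<in> V" "y \<in> V" "\<delta> (in_x v) = (R, \<alpha>, \<beta>, x, y, z)"
      using mem[of "in_x v"] v by auto
    then show ?thesis
      using comm[of "in_x v"] v by (simp add: eu[OF t(1-3)] eu del: sp_hull_bracket)
  qed
  show "\<exists>x\<in>V. \<exists>y\<in>V. \<delta> (in_y v) = (0, 0, 0, x, y, 0)" if v: "v \<in> V"
  proof -
    obtain R \<alpha> \<beta> x y z where t: "R \<in> sp" "x \<in> V" "y \<in> V" "\<delta> (in_y v) = (R, \<alpha>, \<beta>, x, y, z)"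
      using mem[of "in_y v"] v by auto
    then show ?thesis
      using comm[of "in_y v"] v by (simp add: eu[OF t(1-3)] eu del: sp_hull_bracket)
  qed
  show "\<exists>z. \<delta> (in_z 1) = in_z z"
  proof -
    obtain R \<alpha> \<beta> x y z where t: "R \<in> sp" "x \<in> V" "y \<in> V" "\<delta> (in_z 1) = (R, \<alpha>, \<beta>, x, y, z)"
      using mem[of "in_z 1"] by auto
    have "in_z 2 = 2 *\<^sub>C in_z 1"
      by (simp add: fun_eq_iff)
    then have "2 *\<^sub>C \<delta> (in_z 1) = lbracket sp_hull euler (\<delta> (in_z 1))"
      using comm[of "in_z 1"] cocycleD(3)[OF \<delta>, of "in_z 1" 2] by (simp add: eu del: sp_hull_bracket)
    then have *: "2 *\<^sub>C R = 0" "2 * \<alpha> = 0" "2 * \<beta> = 0" "2 *\<^sub>C x = x" "2 *\<^sub>C y = y"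
      by (simp_all add: t eu[OF t(1-3)] del: sp_hull_bracket)
    have "x = 0" "y = 0"
      using *(4,5) cvec.scale_left_distrib[of 1 1 x] cvec.scale_left_distrib[of 1 1 y]
      by (simp_all add: scaleC_one)
    then show ?thesis
      using * by (simp add: t)
  qed
  show "\<exists>T\<in>sp. \<exists>\<alpha> \<beta>. \<delta> (in_sp R) = (T, \<alpha>, \<beta>, 0, 0, 0)" if R: "R \<in> sp"
  proof -
    obtain T \<alpha> \<beta> x y z where t: "T \<in> sp" "x \<in> V" "y \<in> V" "\<delta> (in_sp R) = (T, \<alpha>, \<beta>, x, y, z)"
      using mem[of "in_sp R"] R by auto
    show ?thesis
      using comm[of "in_sp R"] R t cocycle_0[OF \<delta>] by (simp add: eu[OF t(1-3)] eu zero_prod_def del: sp_hull_bracket)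
  qed
qed

text \<open>
  The value on \<open>R \<in> sp\<close> has weight 0 and annihilates both copies of \<open>V\<close>, by the cocycle identity for
  \<open>[R, v] = R v\<close>.
\<close>

lemma cocycle_zero_if_zero_on_radical:
  assumes \<delta>: "cocycle \<delta>" and e: "\<delta> euler = 0" and z: "\<delta> (in_z 1) = 0"
    and x: "\<And>v. v \<in> V \<Longrightarrow> \<delta> (in_x v) = 0" and y: "\<And>v. v \<in> V \<Longrightarrow> \<delta> (in_y v) = 0"
    and p: "p \<in> lcarrier sp_ideal"
  shows "\<delta> p = 0"
proof -
  note d = cocycleD[OF \<delta>]
  have s: "\<delta> (in_sp R) = 0" if R: "R \<in> sp" for R
  proof -
    obtain T \<alpha> \<beta> where T: "T \<in> sp" "\<delta> (in_sp R) = (T, \<alpha>, \<beta>, 0, 0, 0)"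
      using cocycle_graded(4)[OF \<delta> e R] by blast
    have "T v + \<alpha> *\<^sub>C v = 0" if v: "v \<in> V" for v
    proof -
      have "lbracket sp_hull (in_sp R) (in_x v) = in_x (R v)"
        using v R by (simp add: spD fun_eq_iff)
      then have "0 = lbracket sp_hull (T, \<alpha>, \<beta>, 0, 0, 0) (in_x v) + lbracket sp_hull (in_sp R) 0"
        using d(4)[of "in_sp R" "in_x v"] v R T(2) x spD(1)[OF R] by simp
      then show ?thesis
        using v T(1) R lbracket_0(2)[OF lie_algebra_sp_hull, of "in_sp R"] by (simp add: zero_prod_def)
    qed
    moreover have "T v + \<beta> *\<^sub>C v = 0" if v: "v \<in> V" for v
    proof -
      have "lbracket sp_hull (in_sp R) (in_y v) = in_y (R v)"
        using v R by (simp add: spD fun_eq_iff)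
      then have "0 = lbracket sp_hull (T, \<alpha>, \<beta>, 0, 0, 0) (in_y v) + lbracket sp_hull (in_sp R) 0"
        using d(4)[of "in_sp R" "in_y v"] v R T(2) y spD(1)[OF R] by simp
      then show ?thesis
        using v T(1) R lbracket_0(2)[OF lie_algebra_sp_hull, of "in_sp R"] by (simp add: zero_prod_def)
    qed
    ultimately have "T = 0" "\<alpha> = 0" "\<beta> = 0"
      using degree_zero_faithful[OF T(1)] by blast+
    then show ?thesis
      using T(2) by (simp add: zero_prod_def)
  qed
  obtain R \<alpha> a b c where pe: "p = (R, \<alpha>, \<alpha>, a, b, c)" and m: "R \<in> sp" "a \<in> V" "b \<in> V"
    using p by (cases p) auto
  define N where "N = {q \<in> lcarrier sp_ideal. \<delta> q = 0}"
  have N: "cvec.subspace N"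
    using lie_algebraD(1)[OF lie_algebra_sp_ideal] d(2,3) cocycle_0[OF \<delta>]
    by (simp add: N_def cvec.subspace_def)
  have "in_sp R + (\<alpha> *\<^sub>C euler + (in_x a + (in_y b + c *\<^sub>C in_z 1))) \<in> N"
    by (intro cvec.subspace_add[OF N] cvec.subspace_scale[OF N])
      (use m s x y e z in \<open>simp_all add: N_def\<close>)
  then show ?thesis
    by (simp add: pe N_def)
qed

text \<open>
  After normalisation on the Euler element, a cocycle acts on \<open>V \<oplus> V\<close> by a block matrix with entries
  \<open>a, b, c, h\<close>. The off-diagonal blocks \<open>b\<close>, \<open>c\<close> commute with \<open>sp\<close>, hence are scalars, and they vanish
  because each copy of \<open>V\<close> is isotropic. The commutator of \<open>h - a\<close> with an element of \<open>sp\<close> is a scalar,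
  hence \<open>h - a = \<theta>\<close> is a scalar. The pairing of the copies then shows that \<open>a\<close> lies in
  \<open>sp\<close> up to the scalar \<open>(\<nu> - \<theta>) / 2\<close>, where \<open>\<nu>\<close> is the value on the center, so the cocycle
  agrees with an inner one on the Heisenberg algebra, and then everywhere.
\<close>

theorem cocycle_inner:
  assumes \<delta>0: "cocycle \<delta>0"
  obtains k where "k \<in> lcarrier sp_hull" "\<And>p. p \<in> lcarrier sp_ideal \<Longrightarrow> \<delta>0 p = lbracket sp_hull k p"
proof -
  obtain k0 where k0: "k0 \<in> lcarrier sp_hull" "\<delta>0 euler = lbracket sp_hull k0 euler"
    by (rule cocycle_inner_on_euler[OF \<delta>0])
  define \<delta> where "\<delta> = (\<lambda>p. \<delta>0 p - lbracket sp_hull k0 p)"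
  have \<delta>: "cocycle \<delta>"
    unfolding \<delta>_def by (rule cocycle_minus_inner[OF \<delta>0 k0(1)])
  have e: "\<delta> euler = 0"
    by (simp add: \<delta>_def k0(2))
  note d = cocycleD[OF \<delta>] and g = cocycle_graded[OF \<delta> e]
  obtain a b where ab: "\<And>v. v \<in> V \<Longrightarrow> a v \<in> V \<and> b v \<in> V \<and> \<delta> (in_x v) = (0, 0, 0, a v, b v, 0)"
    using g(1) by metis
  obtain c h where ch: "\<And>v. v \<in> V \<Longrightarrow> c v \<in> V \<and> h v \<in> V \<and> \<delta> (in_y v) = (0, 0, 0, c v, h v, 0)"
    using g(2) by metis
  obtain \<nu> where \<nu>: "\<delta> (in_z 1) = in_z \<nu>"
    using g(3) by blast
  obtain D \<gamma> \<eta> where D: "\<And>R. R \<in> sp \<Longrightarrow> D R \<in> sp \<and> \<delta> (in_sp R) = (D R, \<gamma> R, \<eta> R, 0, 0, 0)"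
    using g(4) by metis
  have lin: "linear_on V a" "linear_on V b" "linear_on V c" "linear_on V h"
  proof -
    have "in_x (v + w) = in_x v + in_x w" "in_y (v + w) = in_y v + in_y w"
      "in_x (k *\<^sub>C v) = k *\<^sub>C in_x v" "in_y (k *\<^sub>C v) = k *\<^sub>C in_y v" for v w k
      by (simp_all add: fun_eq_iff)
    then have "\<delta> (in_x (v + w)) = \<delta> (in_x v) + \<delta> (in_x w)" "\<delta> (in_y (v + w)) = \<delta> (in_y v) + \<delta> (in_y w)"
      "\<delta> (in_x (k *\<^sub>C v)) = k *\<^sub>C \<delta> (in_x v)" "\<delta> (in_y (k *\<^sub>C v)) = k *\<^sub>C \<delta> (in_y v)"
      if "v \<in> V" "w \<in> V" for v w k
      using that d(2,3) by (metis sp_0 sp_ideal_mem closed(1))+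
    then show "linear_on V a" "linear_on V b" "linear_on V c" "linear_on V h"
      by (auto simp: linear_on_def ab ch)
  qed
  have Rx: "a (R v) = D R v + \<gamma> R *\<^sub>C v + R (a v) \<and> b (R v) = R (b v)"
    if R: "R \<in> sp" and v: "v \<in> V" for R v
    using d(4)[of "in_sp R" "in_x v"] R v D[OF R] ab[OF v] ab[OF spD(1)[OF R, of v]]
    by (simp add: spD)
  have Ry: "h (R v) = D R v + \<eta> R *\<^sub>C v + R (h v) \<and> c (R v) = R (c v)"
    if R: "R \<in> sp" and v: "v \<in> V" for R v
    using d(4)[of "in_sp R" "in_y v"] R v D[OF R] ch[OF v] ch[OF spD(1)[OF R, of v]]
    by (simp add: spD)
  note tv = transvection_sp
  obtain b0 where b0: "\<And>v. v \<in> V \<Longrightarrow> b v = b0 *\<^sub>C v"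
  proof (rule scalar_if_commutes_with_transvections[OF lin(2)])
    show "\<exists>g. \<forall>v\<in>V. b (transvection u v) - transvection u (b v) = g *\<^sub>C v" if "u \<in> V" for u
      using Rx[OF tv[OF that]] by (intro exI[of _ 0]) simp
  qed (use ab in auto)
  obtain c0 where c0: "\<And>v. v \<in> V \<Longrightarrow> c v = c0 *\<^sub>C v"
  proof (rule scalar_if_commutes_with_transvections[OF lin(3)])
    show "\<exists>g. \<forall>v\<in>V. c (transvection u v) - transvection u (c v) = g *\<^sub>C v" if "u \<in> V" for u
      using Ry[OF tv[OF that]] by (intro exI[of _ 0]) simp
  qed (use ch in auto)
  define f where "f = (\<lambda>v. h v - a v)"
  have f: "linear_on V f"
    using lin(1,4) by (simp add: f_def linear_on_def cvec.scale_right_diff_distrib)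
  obtain \<theta> where \<theta>: "\<And>v. v \<in> V \<Longrightarrow> f v = \<theta> *\<^sub>C v"
  proof (rule scalar_if_commutes_with_transvections[OF f])
    fix u assume u: "u \<in> V"
    have "f (transvection u v) - transvection u (f v)
        = (\<eta> (transvection u) - \<gamma> (transvection u)) *\<^sub>C v" if v: "v \<in> V" for v
      using Rx[OF tv[OF u] v] Ry[OF tv[OF u] v] ab[OF v] ch[OF v]
      by (simp add: f_def spD(5)[OF tv[OF u]] cvec.scale_left_diff_distrib)
    then show "\<exists>g. \<forall>v\<in>V. f (transvection u v) - transvection u (f v) = g *\<^sub>C v"
      by blast
  qed (use ab ch in \<open>auto simp: f_def\<close>)
  have h: "h v = a v + \<theta> *\<^sub>C v" if "v \<in> V" for v
    using \<theta>[OF that] by (simp add: f_def algebra_simps)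
  obtain v w where vw: "v \<in> V" "w \<in> V" "\<omega> v w = 1"
    by (rule form_nonzero)
  have zero: "\<delta> 0 = 0"
    by (rule cocycle_0[OF \<delta>])
  have "b0 = 0"
    using d(4)[of "in_x v" "in_x w"] vw ab[OF vw(1)] ab[OF vw(2)] b0 zero
    by (simp add: zero_prod_def flip: zero_fun_def)
  have "c0 = 0"
    using d(4)[of "in_y v" "in_y w"] vw ch[OF vw(1)] ch[OF vw(2)] c0 zero
    by (simp add: zero_prod_def flip: zero_fun_def)
  have pairing: "\<omega> (a x) y + \<omega> x (a y) = (\<nu> - \<theta>) * \<omega> x y" if x: "x \<in> V" and y: "y \<in> V" for x y
  proof -
    have "lbracket sp_hull (in_x x) (in_y y) = \<omega> x y *\<^sub>C in_z 1"
      using x y by (simp add: fun_eq_iff)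
    then have "\<omega> x y *\<^sub>C in_z \<nu> = lbracket sp_hull (\<delta> (in_x x)) (in_y y) + lbracket sp_hull (in_x x) (\<delta> (in_y y))"
      using d(4)[of "in_x x" "in_y y"] d(3)[of "in_z 1" "\<omega> x y"] x y \<nu>
      by (simp del: sp_hull_bracket scaleC_Pair)
    then show ?thesis
      using x y ab[OF x] ch[OF y] ab[OF y] by (simp add: h algebra_simps)
  qed
  define R0 where "R0 = (\<lambda>v. if v \<in> V then a v - ((\<nu> - \<theta>) / 2) *\<^sub>C v else 0)"
  have R0: "R0 \<in> sp"
  proof -
    have "\<omega> (R0 x) y + \<omega> x (R0 y) = 0" if x: "x \<in> V" and y: "y \<in> V" for x y
    proof -
      have "\<omega> (R0 x) y + \<omega> x (R0 y) = \<omega> (a x) y + \<omega> x (a y) - (\<nu> - \<theta>) * \<omega> x y"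
        using x y ab[OF x] ab[OF y] by (simp add: R0_def field_simps)
      then show ?thesis
        using pairing[OF x y] by simp
    qed
    then show ?thesis
      using ab linear_on_add[OF lin(1)] linear_on_scale[OF lin(1)]
      by (simp add: sp_def R0_def linear_on_def algebra_simps)
  qed
  define k1 where "k1 = (R0, (\<nu> - \<theta>) / 2, (\<nu> + \<theta>) / 2, 0 :: 'a, 0 :: 'a, 0 :: complex)"
  have k1: "k1 \<in> lcarrier sp_hull"
    using R0 by (simp add: k1_def)
  define \<delta>' where "\<delta>' = (\<lambda>p. \<delta> p - lbracket sp_hull k1 p)"
  have \<delta>': "cocycle \<delta>'"
    unfolding \<delta>'_def by (rule cocycle_minus_inner[OF \<delta> k1])
  have vanish: "\<delta>' p = 0" if "p \<in> lcarrier sp_ideal" for p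
  proof (rule cocycle_zero_if_zero_on_radical[OF \<delta>' _ _ _ _ that])
    show "\<delta>' euler = 0"
      using e by (simp add: \<delta>'_def k1_def spD[OF R0] zero_prod_def fun_eq_iff)
    show "\<delta>' (in_z 1) = 0"
      using \<nu> by (simp add: \<delta>'_def k1_def spD[OF R0] zero_prod_def fun_eq_iff field_simps)
    show "\<delta>' (in_x v) = 0" if v: "v \<in> V" for v
      using v ab[OF v] b0[OF v] \<open>b0 = 0\<close>
      by (simp add: \<delta>'_def k1_def spD(7)[OF R0] zero_prod_def fun_eq_iff) (simp add: R0_def)
    have "((\<nu> + \<theta>) / 2) *\<^sub>C v = ((\<nu> - \<theta>) / 2) *\<^sub>C v + \<theta> *\<^sub>C v" for v :: 'a
      by (subst scaleC_add_left[symmetric]) (simp add: field_simps)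
    then show "\<delta>' (in_y v) = 0" if v: "v \<in> V" for v
      using v ch[OF v] c0[OF v] \<open>c0 = 0\<close> h[OF v]
      by (simp add: \<delta>'_def k1_def spD(7)[OF R0] zero_prod_def fun_eq_iff) (simp add: R0_def)
  qed
  have sum: "k0 + k1 \<in> lcarrier sp_hull"
    using k0(1) k1 by (rule cvec.subspace_add[OF lie_algebraD(1)[OF lie_algebra_sp_hull]])
  have "\<delta>0 p = lbracket sp_hull (k0 + k1) p" if p: "p \<in> lcarrier sp_ideal" for p
    using vanish[OF p] lbracket_add_left[OF lie_algebra_sp_hull k0(1) k1 sp_ideal_subset[OF p]]
    by (simp add: \<delta>'_def \<delta>_def algebra_simps)
  then show ?thesis
    using that[OF sum] by blast
qed

text \<open>
  A derivation of the hull agrees with some \<open>ad k\<close> on the ideal. The difference kills the ideal, so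
  it maps the hull into the centralizer of the ideal, which is zero.
\<close>

lemma lie_complete_sp_hull: "lie_complete sp_hull"
proof -
  note H = lie_algebra_sp_hull
  note sub = lie_algebraD(1)[OF H] and i = sp_ideal_subset
  have "p = 0" if "p \<in> lie_center sp_hull" for p
    by (rule sp_hull_centralizer) (use that i in \<open>unfold lie_center_def, blast+\<close>)
  moreover have "0 \<in> lie_center sp_hull"
    using lbracket_0(1)[OF H] cvec.subspace_0[OF sub] unfolding lie_center_def by blast
  ultimately have center: "lie_center sp_hull = {0}"
    by auto
  have "\<exists>k\<in>lcarrier sp_hull. \<delta> = lie_ad sp_hull k" if \<delta>: "\<delta> \<in> derivations sp_hull" for \<delta>
  proof -
    note d = derivation_linear[OF H \<delta>] derivationsD(4)[OF \<delta>]
    have "cocycle \<delta>"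
      using i d by (simp add: cocycle_def linear_on_def)
    then obtain k where k: "k \<in> lcarrier sp_hull"
      "\<And>p. p \<in> lcarrier sp_ideal \<Longrightarrow> \<delta> p = lbracket sp_hull k p"
      by (rule cocycle_inner) (rule that)
    have "\<delta> q = lbracket sp_hull k q" if q: "q \<in> lcarrier sp_hull" for q
    proof -
      have kq: "lbracket sp_hull k q \<in> lcarrier sp_hull"
        by (rule lie_algebraD(3)[OF H k(1) q])
      have "\<delta> q - lbracket sp_hull k q = 0"
      proof (rule sp_hull_centralizer)
        fix p assume p: "p \<in> lcarrier sp_ideal"
        have "lbracket sp_hull k (lbracket sp_hull q p)
            = lbracket sp_hull (\<delta> q) p + lbracket sp_hull q (lbracket sp_hull k p)"
          using k(2)[OF sp_hull_commutators[OF q i[OF p]]] k(2)[OF p] d(6)[OF q i[OF p]] by simp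
        then show "lbracket sp_hull (\<delta> q - lbracket sp_hull k q) p = 0"
          using lie_jacobi_left[OF H k(1) q i[OF p]] lbracket_diff_left[OF H d(1) kq i[OF p], of q]
          by simp
      qed (use d(1) kq cvec.subspace_diff[OF sub] in blast)
      then show ?thesis
        by simp
    qed
    then have "\<delta> = lie_ad sp_hull k"
      using derivationsD(2)[OF \<delta>] by (intro ext) (simp add: lie_ad_def)
    then show ?thesis
      using k(1) by blast
  qed
  then show ?thesis
    using center by (simp add: lie_complete_def)
qed

lemma sp_ideal_almost_complete: "almost_complete sp_ideal"
proof -
  note H = lie_algebra_sp_hull and I = lie_algebra_sp_ideal and i = sp_ideal_subset
  interpret complete_hull sp_ideal sp_hull "\<lambda>p. p"
  proof
    show "lie_hom (\<lambda>p. p) sp_ideal sp_hull"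
      using i by (simp add: lie_hom_def linear_on_def del: sp_hull_bracket)
    show "\<exists>k\<in>lcarrier sp_hull. \<forall>p\<in>lcarrier sp_ideal. \<delta> p = lbracket sp_hull k p"
      if \<delta>: "\<delta> \<in> derivations sp_ideal" for \<delta>
    proof -
      have "cocycle \<delta>"
        using derivation_linear[OF I \<delta>] derivationsD(4)[OF \<delta>] i
        by (simp add: cocycle_def linear_on_def)
      then show ?thesis
        by (rule cocycle_inner) blast
    qed
    \<comment> \<open>Scaling one copy of \<open>V\<close> only leaves the ideal.\<close>
    let ?\<tau> = "(0, 1, 0, 0, 0, 0) :: ('a \<Rightarrow> 'a) \<times> complex \<times> complex \<times> 'a \<times> 'a \<times> complex"
    have "\<exists>c. k - c *\<^sub>C ?\<tau> \<in> (\<lambda>p. p) ` lcarrier sp_ideal" if k: "k \<in> lcarrier sp_hull" for k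
    proof -
      obtain R \<alpha> \<beta> x y z where e: "k = (R, \<alpha>, \<beta>, x, y, z)"
        by (metis prod.exhaust)
      show ?thesis
        using k by (intro exI[of _ "\<alpha> - \<beta>"]) (simp add: e)
    qed
    then show "\<exists>\<tau>\<in>lcarrier sp_hull. \<tau> \<notin> (\<lambda>p. p) ` lcarrier sp_ideal \<and>
        (\<forall>k\<in>lcarrier sp_hull. \<exists>c. k - c *\<^sub>C \<tau> \<in> (\<lambda>p. p) ` lcarrier sp_ideal)"
      by (intro bexI[of _ ?\<tau>]) auto
    show "k = 0" if "k \<in> lcarrier sp_hull"
      "\<And>p. p \<in> lcarrier sp_ideal \<Longrightarrow> lbracket sp_hull k p = 0" for k
      using that by (rule sp_hull_centralizer)
  qed (simp_all only: I H lie_complete_sp_hull sp_hull_commutators inj_on_id2 image_ident)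
  show ?thesis
    by (rule almost_complete)
qed

text \<open>
  A nondegenerate form identifies \<open>V\<close> with its dual space, by comparison of dimensions.
\<close>

lemma form_represents:
  fixes \<beta> :: "'a \<Rightarrow> complex"
  assumes \<beta>: "linear_on V \<beta>"
  obtains x where "x \<in> V" "\<And>v. v \<in> V \<Longrightarrow> \<beta> v = \<omega> x v"
proof -
  define F where "F = (\<lambda>x v. if v \<in> V then \<omega> x v else 0)"
  have F: "linear_on V F"
    by (simp add: linear_on_def F_def fun_eq_iff)
  have inj: "inj_on F V"
  proof (rule inj_onI)
    fix x y assume xy: "x \<in> V" "y \<in> V" "F x = F y"
    have "x - y = 0"
    proof (rule nondegenerate)
      show "\<omega> (x - y) v = 0" if "v \<in> V" for v
        using fun_cong[OF xy(3), of v] xy(1,2) that by (simp add: F_def)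
    qed (use xy in simp)
    then show "x = y"
      by simp
  qed
  obtain B where B: "finite B" "B \<subseteq> V" "cvec.independent B" "cvec.span B = V"
    by (rule finite_basisE[OF V fin])
  define E where "E = (\<lambda>b v. if v \<in> V then cvec.representation B v b else 0)"
  \<comment> \<open>The coordinate functionals span the dual space, which bounds its dimension by that of \<open>V\<close>.\<close>
  have dual: "(\<lambda>v. if v \<in> V then g v else 0) \<in> cvec.span (E ` B)"
    if g: "linear_on V g" for g :: "'a \<Rightarrow> complex"
  proof -
    have gsum: "g (\<Sum>b\<in>A. k b *\<^sub>C b) = (\<Sum>b\<in>A. k b * g b)" if "A \<subseteq> V" for A k
      using that
    proof (induction A rule: infinite_finite_induct)
      case (insert b A)
      then have "(\<Sum>b\<in>A. k b *\<^sub>C b) \<in> V"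
        by (intro cvec.subspace_sum[OF V]) auto
      then show ?case
        using insert by (simp add: linear_on_add[OF g] linear_on_scale[OF g])
    qed (simp_all add: linear_on_0[OF V g])
    have "g v = (\<Sum>b\<in>B. cvec.representation B v b * g b)" if "v \<in> V" for v
      using gsum[OF B(2), of "cvec.representation B v"]
        cvec.sum_representation_eq[OF B(3) _ B(1) order_refl, of v] B(4) that by simp
    moreover have app: "(\<Sum>b\<in>A. g b *\<^sub>C E b) v = (\<Sum>b\<in>A. g b * E b v)" for A v
      by (induction A rule: infinite_finite_induct) auto
    ultimately have "(\<lambda>v. if v \<in> V then g v else 0) = (\<Sum>b\<in>B. g b *\<^sub>C E b)"
      by (simp add: fun_eq_iff app E_def mult.commute)
    then show ?thesis
      by (simp add: cvec.span_sum cvec.span_scale cvec.span_base)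
  qed
  let ?\<beta> = "\<lambda>v. if v \<in> V then \<beta> v else 0"
  have FB: "F ` B \<subseteq> cvec.span (E ` B)"
    using dual[OF form_right] B(2) by (auto simp: F_def)
  have ind: "cvec.independent (F ` B)"
    by (rule independent_linear_image[OF V F inj B(2,3)])
  have card: "card (F ` B) = card B"
    by (rule card_image[OF inj_on_subset[OF inj B(2)]])
  have "?\<beta> \<in> cvec.span (F ` B)"
  proof (rule ccontr)
    assume n: "?\<beta> \<notin> cvec.span (F ` B)"
    have "card (insert ?\<beta> (F ` B)) \<le> card (E ` B)"
      using cvec.independent_span_bound[OF _ cvec.independent_insertI[OF n ind], of "E ` B"]
        B(1) FB dual[OF \<beta>] by simp
    moreover have "?\<beta> \<notin> F ` B"
      using n cvec.span_base by blast
    ultimately show False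
      using card B(1) card_image_le[OF B(1), of E] by simp
  qed
  then have "?\<beta> \<in> F ` V"
    using cvec.span_minimal[OF image_mono[OF B(2)] subspace_linear_image[OF V F]] by blast
  then obtain x where "x \<in> V" "?\<beta> = F x"
    by blast
  then show ?thesis
    using that[of x] fun_cong[of ?\<beta> "F x"] by (metis F_def)
qed

end

section \<open>The full graph of a Heisenberg algebra\<close>

text \<open>
  Write \<open>G = V \<oplus> \<complex>c\<close> with \<open>[v, w] = \<omega> v w c\<close>. Every derivation of \<open>G\<close> is the
  sum of some \<open>ad x\<close> with \<open>x \<in> V\<close>, which accounts for one copy of \<open>V\<close>, and a map \<open>\<sigma> R \<alpha>\<close> with \<open>R \<in> sp\<close>. The other copy of \<open>V\<close> in the full graph cannot be taken to
  be \<open>(0, y)\<close>, since these elements do not commute with one another; the elements \<open>(- ad y / 2, y)\<close> do, because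
  \<open>G\<close> is nilpotent of class two. This explains the shift by \<open>y / 2\<close> in the isomorphism \<open>\<psi>\<close>
  from \<open>sp_ideal\<close> to the full graph.
\<close>

lemma almost_complete_full_graph_heisenberg:
  fixes G :: "'a::complex_vector lie_alg"
  assumes heis: "heisenberg G"
  shows "almost_complete (full_graph G)"
proof -
  have G: "lie_algebra G" and der: "lie_derived G = lie_center G"
    and dim: "cvec.dim (lie_center G) = 1"
    using heis by (auto simp: heisenberg_def)
  define C where "C = lcarrier G"
  note sub = lie_algebraD(1)[OF G, folded C_def]
  note G_closed = cvec.subspace_0[OF sub] cvec.subspace_add[OF sub] cvec.subspace_diff[OF sub]
    cvec.subspace_scale[OF sub] lie_algebraD(3)[OF G, folded C_def]
  note bil = lbracket_add_left[OF G, folded C_def] lbracket_add_right[OF G, folded C_def]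
    lbracket_diff_left[OF G, folded C_def] lbracket_diff_right[OF G, folded C_def]
    lbracket_scale_left[OF G, folded C_def] lbracket_scale_right[OF G, folded C_def]
  note ad = lie_ad_derivation[OF G, folded C_def]
  have center_sub: "cvec.subspace (lie_center G)"
    unfolding der[symmetric] lie_derived_def by (rule cvec.subspace_span)
  obtain c where c0: "c \<noteq> 0" and center: "lie_center G = range (\<lambda>k. k *\<^sub>C c)"
  proof -
    obtain B where B: "B \<subseteq> lie_center G" "cvec.independent B" "lie_center G \<subseteq> cvec.span B"
      "card B = cvec.dim (lie_center G)"
      by (rule cvec.basis_exists)
    obtain c where c: "B = {c}"
      using B(4) dim by (metis card_1_singletonE)
    have "lie_center G = cvec.span {c}"
      using B(1,3) c cvec.span_minimal[OF _ center_sub] by blast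
    moreover have "c \<noteq> 0"
      using B(2) c cvec.dependent_zero by blast
    ultimately show ?thesis
      using that[of c] by (simp add: cvec.span_singleton)
  qed
  have cC: "c \<in> C" and c_central: "\<And>x. x \<in> C \<Longrightarrow> lbracket G c x = 0"
  proof -
    have "c = 1 *\<^sub>C c"
      by (simp add: scaleC_one)
    then have "c \<in> lie_center G"
      unfolding center by blast
    then show "c \<in> C" "\<And>x. x \<in> C \<Longrightarrow> lbracket G c x = 0"
      by (auto simp: lie_center_def C_def)
  qed
  have c_central': "lbracket G x c = 0" if "x \<in> C" for x
    using lbracket_anti[OF G, of x c] that cC c_central by (simp add: C_def)
  \<comment> \<open>The coordinate along \<open>c\<close>; its kernel serves as a complement of the center.\<close>
  obtain \<zeta> :: "'a \<Rightarrow> complex" where \<zeta>add: "\<And>x y. x \<in> C \<Longrightarrow> y \<in> C \<Longrightarrow> \<zeta> (x + y) = \<zeta> x + \<zeta> y"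
    and \<zeta>scale: "\<And>k x. x \<in> C \<Longrightarrow> \<zeta> (k *\<^sub>C x) = k * \<zeta> x" and \<zeta>c: "\<zeta> c = 1"
  proof -
    have "cvec.independent {c}"
      using c0 by simp
    then obtain B where B: "{c} \<subseteq> B" "B \<subseteq> C" "cvec.independent B" "C \<subseteq> cvec.span B"
      using cvec.maximal_independent_subset_extend[of "{c}" C] cC by auto
    have "cvec.representation B c c = 1"
      using cvec.representation_basis[OF B(3), of c] B(1) by simp
    then show ?thesis
      using B by (intro that[of "\<lambda>x. cvec.representation B x c"])
        (auto simp: cvec.representation_add cvec.representation_scale subset_iff)
  qed
  have \<zeta>diff: "\<zeta> (x - y) = \<zeta> x - \<zeta> y" if "x \<in> C" "y \<in> C" for x y
    using \<zeta>add[of "x - y" y] that G_closed by simp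
  have \<zeta>0: "\<zeta> 0 = 0"
    using \<zeta>scale[OF cC, of 0] by simp
  define V where "V = {x \<in> C. \<zeta> x = 0}"
  define \<omega> where "\<omega> = (\<lambda>x y. \<zeta> (lbracket G x y))"
  have VC: "x \<in> C" if "x \<in> V" for x
    using that by (simp add: V_def)
  have br: "lbracket G x y = \<omega> x y *\<^sub>C c" if "x \<in> C" "y \<in> C" for x y
  proof -
    have "lbracket G x y \<in> lie_center G"
      unfolding der[symmetric] lie_derived_def using that by (auto simp: C_def intro: cvec.span_base)
    then obtain k where "lbracket G x y = k *\<^sub>C c"
      unfolding center by blast
    then show ?thesis
      using \<zeta>scale[OF cC] \<zeta>c by (simp add: \<omega>_def)
  qed
  have split: "x - \<zeta> x *\<^sub>C c \<in> V" if "x \<in> C" for x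
    using that cC by (simp add: V_def G_closed \<zeta>diff \<zeta>scale \<zeta>c)
  interpret symplectic_space V \<omega>
  proof
    show "cvec.subspace V"
      by (simp add: cvec.subspace_def V_def G_closed \<zeta>add \<zeta>scale \<zeta>0)
    show "finite_dimensional V"
      by (rule finite_dimensional_subset[OF lie_algebraD(2)[OF G]]) (auto simp: V_def C_def)
    show "linear_on V (\<omega> x)" if "x \<in> V" for x
      using that by (simp add: linear_on_def \<omega>_def V_def bil G_closed \<zeta>add \<zeta>scale)
    show "linear_on V (\<lambda>x. \<omega> x y)" if "y \<in> V" for y
      using that by (simp add: linear_on_def \<omega>_def V_def bil G_closed \<zeta>add \<zeta>scale)
    show "\<omega> x x = 0" if "x \<in> V" for x
      using lie_algebraD(6)[OF G] that by (simp add: \<omega>_def V_def C_def \<zeta>0[unfolded C_def])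
    show nondeg: "x = 0" if x: "x \<in> V" "\<And>y. y \<in> V \<Longrightarrow> \<omega> x y = 0" for x
    proof -
      have "lbracket G x y = 0" if y: "y \<in> C" for y
      proof -
        have "lbracket G x y = lbracket G x (y - \<zeta> y *\<^sub>C c)"
          using x(1) y cC by (simp add: bil G_closed c_central' VC)
        then show ?thesis
          using br[OF VC[OF x(1)] VC[OF split[OF y]]] x(2)[OF split[OF y]] by simp
      qed
      then have "x \<in> lie_center G"
        using x(1) by (simp add: lie_center_def V_def C_def)
      then obtain k where "x = k *\<^sub>C c"
        unfolding center by blast
      then show "x = 0"
        using x(1) \<zeta>scale[OF cC, of k] \<zeta>c by (simp add: V_def)
    qed
    show "\<exists>x\<in>V. x \<noteq> 0"
    proof (rule ccontr)
      assume "\<not> (\<exists>x\<in>V. x \<noteq> 0)"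
      then have *: "x = \<zeta> x *\<^sub>C c" if "x \<in> C" for x
        using split[OF that] by (metis eq_iff_diff_eq_0)
      have "lbracket G x y = 0" if x: "x \<in> C" and y: "y \<in> C" for x y
      proof -
        have "lbracket G x y = lbracket G (\<zeta> x *\<^sub>C c) y"
          using *[OF x] by simp
        then show ?thesis
          using y cC by (simp add: bil c_central)
      qed
      then have "{lbracket G x y |x y. x \<in> lcarrier G \<and> y \<in> lcarrier G} \<subseteq> {0}"
        by (auto simp: C_def)
      then have "lie_derived G \<subseteq> {0}"
        unfolding lie_derived_def using cvec.span_minimal[OF _ cvec.subspace_single_0] by blast
      then show False
        using dim unfolding der[symmetric]
        by (metis cvec.dim_le_card card.empty cvec.span_empty finite.emptyI le_zero_eq zero_neq_one)
    qed
  qed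
  \<comment> \<open>The derivation acting on \<open>V\<close> by \<open>R + \<alpha>\<close> and on the center by \<open>2 \<alpha>\<close>.\<close>
  define \<sigma> where "\<sigma> = (\<lambda>R \<alpha> a. if a \<in> C then
    R (a - \<zeta> a *\<^sub>C c) + \<alpha> *\<^sub>C (a - \<zeta> a *\<^sub>C c) + (2 * \<alpha> * \<zeta> a) *\<^sub>C c else 0)"
  have form_split: "\<omega> a b = \<omega> (a - \<zeta> a *\<^sub>C c) (b - \<zeta> b *\<^sub>C c)" if "a \<in> C" "b \<in> C" for a b
    using that cC by (simp add: \<omega>_def bil G_closed c_central c_central')
  have \<zeta>V: "\<zeta> v = 0" if "v \<in> V" for v
    using that by (simp add: V_def)
  have \<sigma>C: "\<sigma> R \<alpha> a \<in> C" if "R \<in> sp" for R \<alpha> a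
    using that cC split VC[OF spD(1)[OF that]] by (simp add: \<sigma>_def G_closed)
  have \<sigma>der: "\<sigma> R \<alpha> \<in> derivations G" if R: "R \<in> sp" for R \<alpha>
    unfolding derivations_def linear_on_def mem_Collect_eq C_def[symmetric]
  proof (intro conjI ballI allI impI)
    fix a b assume a: "a \<in> C" and b: "b \<in> C"
    let ?\<pi> = "\<lambda>a. a - \<zeta> a *\<^sub>C c"
    note s = spD(1,4,5,6)[OF R] split[OF a] split[OF b]
    define \<pi> where "\<pi> = ?\<pi>"
    have "\<sigma> R \<alpha> d = R (\<pi> d) + \<alpha> *\<^sub>C \<pi> d + (2 * \<alpha> * \<zeta> d) *\<^sub>C c" if "d \<in> C" for d
      using that by (simp only: \<sigma>_def \<pi>_def if_True)
    moreover have "\<pi> (a + b) = \<pi> a + \<pi> b" "\<pi> a \<in> V" "\<pi> b \<in> V"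
      using a b split by (simp_all add: \<pi>_def \<zeta>add algebra_simps)
    ultimately show "\<sigma> R \<alpha> (a + b) = \<sigma> R \<alpha> a + \<sigma> R \<alpha> b"
      using a b by (simp add: G_closed \<zeta>add spD(4)[OF R] algebra_simps)
    have proj: "?\<pi> (\<sigma> R \<alpha> d) = R (?\<pi> d) + \<alpha> *\<^sub>C ?\<pi> d" if d: "d \<in> C" for d
    proof -
      have "R (?\<pi> d) + \<alpha> *\<^sub>C ?\<pi> d \<in> V"
        using split[OF d] spD(1)[OF R] by simp
      moreover have "\<sigma> R \<alpha> d = (R (?\<pi> d) + \<alpha> *\<^sub>C ?\<pi> d) + (2 * \<alpha> * \<zeta> d) *\<^sub>C c"
        using d by (simp only: \<sigma>_def if_True)
      ultimately show ?thesis
        using cC VC by (simp add: \<zeta>add \<zeta>scale \<zeta>c \<zeta>V G_closed)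
    qed
    have similitude: "\<omega> (R v + \<alpha> *\<^sub>C v) w + \<omega> v (R w + \<alpha> *\<^sub>C w) = 2 * \<alpha> * \<omega> v w"
      if "v \<in> V" "w \<in> V" for v w
      using that by (simp add: spD(1)[OF R] spD(9)[OF R])
    have "lbracket G (\<sigma> R \<alpha> a) b + lbracket G a (\<sigma> R \<alpha> b)
        = (\<omega> (\<sigma> R \<alpha> a) b + \<omega> a (\<sigma> R \<alpha> b)) *\<^sub>C c"
      using a b by (simp add: br \<sigma>C[OF R] scaleC_add_left)
    also have "\<omega> (\<sigma> R \<alpha> a) b + \<omega> a (\<sigma> R \<alpha> b) = 2 * \<alpha> * \<omega> (?\<pi> a) (?\<pi> b)"
      unfolding form_split[OF \<sigma>C[OF R] b] form_split[OF a \<sigma>C[OF R]] proj[OF a] proj[OF b]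
      by (rule similitude[OF split[OF a] split[OF b]])
    finally show "\<sigma> R \<alpha> (lbracket G a b) = lbracket G (\<sigma> R \<alpha> a) b + lbracket G a (\<sigma> R \<alpha> b)"
      using br[OF a b] form_split[OF a b] cC spD(7)[OF R]
      by (simp add: \<sigma>_def \<zeta>scale \<zeta>c G_closed)
  next
    fix k a assume a: "a \<in> C"
    let ?\<pi> = "\<lambda>a. a - \<zeta> a *\<^sub>C c"
    have "?\<pi> (k *\<^sub>C a) = k *\<^sub>C ?\<pi> a"
      using a by (simp add: \<zeta>scale cvec.scale_right_diff_distrib)
    then show "\<sigma> R \<alpha> (k *\<^sub>C a) = k *\<^sub>C \<sigma> R \<alpha> a"
      unfolding \<sigma>_def using a split[OF a] spD(6)[OF R]
      by (simp add: G_closed \<zeta>scale scaleC_add_right mult.assoc mult.left_commute mult.commute)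
  qed (use \<sigma>C[OF R] in simp, simp add: \<sigma>_def)
  have \<sigma>V: "\<sigma> R \<alpha> v = R v + \<alpha> *\<^sub>C v" if "v \<in> V" for R \<alpha> v
    using that by (simp add: \<sigma>_def V_def)
  have \<sigma>c: "\<sigma> R \<alpha> (k *\<^sub>C c) = (2 * \<alpha> * k) *\<^sub>C c" if "R \<in> sp" for R \<alpha> k
    using cC that by (simp add: \<sigma>_def G_closed \<zeta>scale \<zeta>c spD)
  \<comment> \<open>A derivation is determined by its values on \<open>V\<close> and \<open>c\<close>.\<close>
  have der_eqI: "s = t" if s: "s \<in> derivations G" and t: "t \<in> derivations G"
    and on_V: "\<And>v. v \<in> V \<Longrightarrow> s v = t v" and on_c: "s c = t c" for s t
  proof
    fix a
    have "s ((a - \<zeta> a *\<^sub>C c) + \<zeta> a *\<^sub>C c) = t ((a - \<zeta> a *\<^sub>C c) + \<zeta> a *\<^sub>C c)" if a: "a \<in> C"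
      unfolding derivation_linear(2)[OF G s VC[OF split[OF a], unfolded C_def] G_closed(4)[OF cC, unfolded C_def]]
        derivation_linear(2)[OF G t VC[OF split[OF a], unfolded C_def] G_closed(4)[OF cC, unfolded C_def]]
      using on_V[OF split[OF a]] on_c derivation_linear(4)[OF G s cC[unfolded C_def]]
        derivation_linear(4)[OF G t cC[unfolded C_def]] by simp
    then show "s a = t a"
      using derivationsD(2)[OF s] derivationsD(2)[OF t] by (cases "a \<in> C") (auto simp: C_def)
  qed
  define S where "S = (\<lambda>R \<alpha> u. \<sigma> R \<alpha> + lie_ad G u)"
  have Sder: "S R \<alpha> u \<in> derivations G" if "R \<in> sp" "u \<in> V" for R \<alpha> u
    using cvec.subspace_add[OF subspace_derivations[OF G] \<sigma>der[OF that(1)] ad[OF VC[OF that(2)]]]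
    by (simp add: S_def)
  have S_apply: "S R \<alpha> u (v + k *\<^sub>C c) = (R v + \<alpha> *\<^sub>C v) + (\<omega> u v + 2 * \<alpha> * k) *\<^sub>C c"
    if R: "R \<in> sp" and u: "u \<in> V" and v: "v \<in> V" for R \<alpha> u v k
  proof -
    have kc: "k *\<^sub>C c \<in> C"
      using cC by (rule G_closed(4))
    have "S R \<alpha> u (v + k *\<^sub>C c) = S R \<alpha> u v + S R \<alpha> u (k *\<^sub>C c)"
      by (rule derivation_linear(2)[OF G Sder[OF R u] VC[OF v, unfolded C_def] kc[unfolded C_def]])
    moreover have "lie_ad G u (k *\<^sub>C c) = 0" "lie_ad G u v = \<omega> u v *\<^sub>C c"
      using VC[OF u] VC[OF v] cC kc br[OF VC[OF u] VC[OF v]]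
      by (simp_all add: lie_ad_def C_def[symmetric] bil c_central')
    ultimately show ?thesis
      using \<sigma>V[OF v] \<sigma>c[OF R] by (simp add: S_def scaleC_add_left)
  qed
  have S_V: "S R \<alpha> u v = (R v + \<alpha> *\<^sub>C v) + \<omega> u v *\<^sub>C c" and S_c: "S R \<alpha> u c = (2 * \<alpha>) *\<^sub>C c"
    if "R \<in> sp" "u \<in> V" "v \<in> V" for R \<alpha> u v
    using S_apply[OF that, of \<alpha> 0] S_apply[OF that(1,2) closed(1), of \<alpha> 1] that
    by (simp_all add: spD scaleC_one)
  define \<psi> where "\<psi> = (\<lambda>(R, \<alpha>, \<beta> :: complex, x, y, z).
    (S R \<alpha> (x - (1 / 2) *\<^sub>C y), y + z *\<^sub>C c))"
  have hom: "lie_hom \<psi> sp_ideal (full_graph G)"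
    unfolding lie_hom_def linear_on_def
  proof (intro conjI ballI allI)
    fix p q assume p: "p \<in> lcarrier sp_ideal" and q: "q \<in> lcarrier sp_ideal"
    obtain R \<alpha> x y z where pe: "p = (R, \<alpha>, \<alpha>, x, y, z)" and R: "R \<in> sp" "x \<in> V" "y \<in> V"
      using p by (cases p) auto
    obtain T \<beta> x' y' z' where qe: "q = (T, \<beta>, \<beta>, x', y', z')" and T: "T \<in> sp" "x' \<in> V" "y' \<in> V"
      using q by (cases q) auto
    define u where "u = x - (1 / 2) *\<^sub>C y"
    define w where "w = x' - (1 / 2) *\<^sub>C y'"
    have u: "u \<in> V" and w: "w \<in> V"
      using R T by (simp_all add: u_def w_def)
    note s = spD(1,4,5,6,7)[OF R(1)] spD(1,4,5,6,7)[OF T(1)]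
    note SD = Sder[OF R(1) u] Sder[OF T(1) w]
    have RT: "R + T \<in> sp"
      using R(1) T(1) by (rule cvec.subspace_add[OF sp_subspace])
    have "S (R + T) (\<alpha> + \<beta>) (u + w) = S R \<alpha> u + S T \<beta> w"
    proof (rule der_eqI)
      show "S (R + T) (\<alpha> + \<beta>) (u + w) \<in> derivations G"
        using Sder[OF RT] u w by simp
      show "S R \<alpha> u + S T \<beta> w \<in> derivations G"
        using SD by (rule cvec.subspace_add[OF subspace_derivations[OF G]])
      show "S (R + T) (\<alpha> + \<beta>) (u + w) v = (S R \<alpha> u + S T \<beta> w) v" if v: "v \<in> V" for v
        using S_V[OF R(1) u v] S_V[OF T(1) w v] S_V[OF RT closed(2)[OF u w] v] u w v
        by (simp add: scaleC_add_left)
      show "S (R + T) (\<alpha> + \<beta>) (u + w) c = (S R \<alpha> u + S T \<beta> w) c"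
        using S_c[OF R(1) u closed(1)] S_c[OF T(1) w closed(1)] S_c[OF RT closed(2)[OF u w] closed(1)]
        by (simp add: scaleC_add_left distrib_left)
    qed
    moreover have "u + w = (x + x') - (1 / 2) *\<^sub>C (y + y')"
      by (simp add: u_def w_def scaleC_add_right)
    ultimately have add: "S (R + T) (\<alpha> + \<beta>) ((x + x') - (1 / 2) *\<^sub>C (y + y')) = S R \<alpha> u + S T \<beta> w"
      by metis
    have \<psi>pq: "\<psi> p = (S R \<alpha> u, y + z *\<^sub>C c)" "\<psi> q = (S T \<beta> w, y' + z' *\<^sub>C c)"
      by (simp_all add: \<psi>_def pe qe u_def w_def)
    have "\<psi> (p + q) = (S (R + T) (\<alpha> + \<beta>) ((x + x') - (1 / 2) *\<^sub>C (y + y')),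
        (y + y') + (z + z') *\<^sub>C c)"
      by (simp add: \<psi>_def pe qe)
    then show "\<psi> (p + q) = \<psi> p + \<psi> q"
      unfolding add \<psi>pq by (simp add: scaleC_add_left)
    define Q where "Q = (R \<circ> T) - (T \<circ> R)"
    define r where "r = (R w + \<alpha> *\<^sub>C w) - (T u + \<beta> *\<^sub>C u)"
    have Q: "Q \<in> sp" and r: "r \<in> V"
      using sp_commutator[OF R(1) T(1)] u w s by (simp_all add: Q_def r_def)
    have "S Q 0 r = (S R \<alpha> u \<circ> S T \<beta> w) - (S T \<beta> w \<circ> S R \<alpha> u)"
    proof (rule der_eqI[OF Sder[OF Q r] derivations_commutator[OF G SD]])
      show "S Q 0 r v = ((S R \<alpha> u \<circ> S T \<beta> w) - (S T \<beta> w \<circ> S R \<alpha> u)) v" if v: "v \<in> V" for v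
      proof -
        have e1: "S R \<alpha> u (S T \<beta> w v) = (R (T v + \<beta> *\<^sub>C v) + \<alpha> *\<^sub>C (T v + \<beta> *\<^sub>C v))
            + (\<omega> u (T v + \<beta> *\<^sub>C v) + 2 * \<alpha> * \<omega> w v) *\<^sub>C c"
          unfolding S_V[OF T(1) w v] by (rule S_apply[OF R(1) u]) (use s v in simp)
        have e2: "S T \<beta> w (S R \<alpha> u v) = (T (R v + \<alpha> *\<^sub>C v) + \<beta> *\<^sub>C (R v + \<alpha> *\<^sub>C v))
            + (\<omega> w (R v + \<alpha> *\<^sub>C v) + 2 * \<beta> * \<omega> u v) *\<^sub>C c"
          unfolding S_V[OF R(1) u v] by (rule S_apply[OF T(1) w]) (use s v in simp)
        have "\<omega> r v = \<omega> u (T v) - \<omega> w (R v) + \<alpha> * \<omega> w v - \<beta> * \<omega> u v"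
          using u w v s by (simp add: r_def spD(9)[OF R(1)] spD(9)[OF T(1)])
        then have e3: "S Q 0 r v = R (T v) - T (R v)
            + (\<omega> u (T v) - \<omega> w (R v) + \<alpha> * \<omega> w v - \<beta> * \<omega> u v) *\<^sub>C c"
          using S_V[OF Q r v, of 0] by (simp add: Q_def)
        have double: "(a * (2 * b)) *\<^sub>C c = (a * b) *\<^sub>C c + (a * b) *\<^sub>C c" for a b
          by (simp flip: scaleC_add_left)
        show ?thesis
          unfolding fun_diff_apply comp_apply e1 e2 e3 using u w v s
          by (simp add: algebra_simps double)
      qed
      have "S R \<alpha> u (k *\<^sub>C c) = (2 * \<alpha> * k) *\<^sub>C c" "S T \<beta> w (k *\<^sub>C c) = (2 * \<beta> * k) *\<^sub>C c" for k
        using S_apply[OF R(1) u closed(1), of \<alpha> k] S_apply[OF T(1) w closed(1), of \<beta> k] u w s by simp_all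
      then show "S Q 0 r c = ((S R \<alpha> u \<circ> S T \<beta> w) - (S T \<beta> w \<circ> S R \<alpha> u)) c"
        using S_c[OF Q r closed(1)] S_c[OF R(1) u closed(1)] S_c[OF T(1) w closed(1)] by simp
    qed
    moreover have r_eq: "r = ((R x' + \<alpha> *\<^sub>C x') - (T x + \<beta> *\<^sub>C x))
        - (1 / 2) *\<^sub>C ((R y' + \<alpha> *\<^sub>C y') - (T y + \<beta> *\<^sub>C y))"
    proof -
      have Rw: "R w = R x' - (1 / 2) *\<^sub>C R y'" and Tu: "T u = T x - (1 / 2) *\<^sub>C T y"
        using R T s by (simp_all add: u_def w_def)
      show ?thesis
        unfolding r_def Rw Tu unfolding u_def w_def by (simp add: algebra_simps)
    qed
    moreover have "S R \<alpha> u (y' + z' *\<^sub>C c) - S T \<beta> w (y + z *\<^sub>C c) + lbracket G (y + z *\<^sub>C c) (y' + z' *\<^sub>C c)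
        = ((R y' + \<alpha> *\<^sub>C y') - (T y + \<beta> *\<^sub>C y))
          + ((\<alpha> + \<alpha>) * z' - (\<beta> + \<beta>) * z + \<omega> x y' + \<omega> y x') *\<^sub>C c"
    proof -
      have "lbracket G (y + z *\<^sub>C c) (y' + z' *\<^sub>C c) = \<omega> y y' *\<^sub>C c"
        using VC[OF R(3)] VC[OF T(3)] cC br[OF VC[OF R(3)] VC[OF T(3)]]
        by (simp add: bil G_closed c_central c_central')
      moreover have "\<omega> u y' = \<omega> x y' - \<omega> y y' / 2" "\<omega> w y = - \<omega> y x' + \<omega> y y' / 2"
        using R T form_anti[OF T(2) R(3)] form_anti[OF T(3) R(3)] by (simp_all add: u_def w_def)
      then have "\<omega> u y' + \<omega> y y' = \<omega> w y + (\<omega> x y' + \<omega> y x')"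
        by simp
      ultimately show ?thesis
        unfolding S_apply[OF R(1) u T(3)] S_apply[OF T(1) w R(3)]
        by (simp add: algebra_simps flip: scaleC_add_left)
    qed
    moreover have "\<psi> (lbracket sp_ideal p q) = (S Q 0 r, ((R y' + \<alpha> *\<^sub>C y') - (T y + \<beta> *\<^sub>C y))
          + ((\<alpha> + \<alpha>) * z' - (\<beta> + \<beta>) * z + \<omega> x y' + \<omega> y x') *\<^sub>C c)"
      unfolding r_eq by (simp add: \<psi>_def pe qe Q_def)
    ultimately show "\<psi> (lbracket sp_ideal p q) = lbracket (full_graph G) (\<psi> p) (\<psi> q)"
      unfolding \<psi>pq full_graph_simps by simp
  next
    fix k p assume p: "p \<in> lcarrier sp_ideal"
    obtain R \<alpha> x y z where pe: "p = (R, \<alpha>, \<alpha>, x, y, z)" and R: "R \<in> sp" "x \<in> V" "y \<in> V"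
      using p by (cases p) auto
    define u where "u = x - (1 / 2) *\<^sub>C y"
    have u: "u \<in> V"
      using R by (simp add: u_def)
    have kR: "k *\<^sub>C R \<in> sp"
      using R(1) by (rule cvec.subspace_scale[OF sp_subspace])
    have "S (k *\<^sub>C R) (k * \<alpha>) (k *\<^sub>C u) = k *\<^sub>C S R \<alpha> u"
    proof (rule der_eqI)
      show "S (k *\<^sub>C R) (k * \<alpha>) (k *\<^sub>C u) \<in> derivations G"
        using Sder[OF kR] u by simp
      show "k *\<^sub>C S R \<alpha> u \<in> derivations G"
        using Sder[OF R(1) u] by (rule cvec.subspace_scale[OF subspace_derivations[OF G]])
      show "S (k *\<^sub>C R) (k * \<alpha>) (k *\<^sub>C u) v = (k *\<^sub>C S R \<alpha> u) v" if v: "v \<in> V" for v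
        using S_V[OF R(1) u v] S_V[OF kR closed(4)[OF u] v] u v
        by (simp add: scaleC_add_right)
      show "S (k *\<^sub>C R) (k * \<alpha>) (k *\<^sub>C u) c = (k *\<^sub>C S R \<alpha> u) c"
        using S_c[OF R(1) u closed(1)] S_c[OF kR closed(4)[OF u] closed(1)]
        by (simp add: mult.left_commute)
    qed
    moreover have "k *\<^sub>C u = k *\<^sub>C x - (1 / 2) *\<^sub>C k *\<^sub>C y"
      by (simp add: u_def cvec.scale_right_diff_distrib mult.commute)
    ultimately have scale: "S (k *\<^sub>C R) (k * \<alpha>) (k *\<^sub>C x - (1 / 2) *\<^sub>C k *\<^sub>C y) = k *\<^sub>C S R \<alpha> u"
      by metis
    have "\<psi> (k *\<^sub>C p) = (S (k *\<^sub>C R) (k * \<alpha>) (k *\<^sub>C x - (1 / 2) *\<^sub>C k *\<^sub>C y),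
        k *\<^sub>C y + (k * z) *\<^sub>C c)"
      by (simp add: \<psi>_def pe)
    then show "\<psi> (k *\<^sub>C p) = k *\<^sub>C \<psi> p"
      unfolding scale by (simp add: \<psi>_def pe u_def scaleC_add_right)
  next
    fix p assume p: "p \<in> lcarrier sp_ideal"
    then show "\<psi> p \<in> lcarrier (full_graph G)"
      using cC by (cases p) (simp add: \<psi>_def Sder C_def[symmetric] G_closed VC)
  qed
  have inj: "inj_on \<psi> (lcarrier sp_ideal)"
  proof (rule lie_hom_inj_onI[OF hom lie_algebra_sp_ideal])
    fix p assume p: "p \<in> lcarrier sp_ideal" and \<psi>p: "\<psi> p = 0"
    obtain R \<alpha> x y z where pe: "p = (R, \<alpha>, \<alpha>, x, y, z)" and R: "R \<in> sp" "x \<in> V" "y \<in> V"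
      using p by (cases p) auto
    have yz: "y + z *\<^sub>C c = 0" and S0: "S R \<alpha> (x - (1 / 2) *\<^sub>C y) = 0"
      using \<psi>p by (simp_all add: \<psi>_def pe zero_prod_def)
    have "\<zeta> (y + z *\<^sub>C c) = z"
      using VC[OF R(3)] cC by (simp add: \<zeta>add \<zeta>scale \<zeta>c G_closed \<zeta>V[OF R(3)])
    then have z: "z = 0" and y: "y = 0"
      using yz \<zeta>0 by auto
    have Sx: "S R \<alpha> x = 0"
      using S0 y by simp
    have \<alpha>: "\<alpha> = 0"
      using S_c[OF R(1,2) closed(1), of \<alpha>] Sx c0 by simp
    have Rv: "R v = 0" and xv: "\<omega> x v = 0" if v: "v \<in> V" for v
    proof -
      have *: "R v + \<omega> x v *\<^sub>C c = 0"
        using S_V[OF R(1,2) v, of 0] Sx \<alpha> by simp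
      have "\<zeta> (R v + \<omega> x v *\<^sub>C c) = \<omega> x v"
        using VC[OF spD(1)[OF R(1)]] cC by (simp add: \<zeta>add \<zeta>scale \<zeta>c G_closed \<zeta>V[OF spD(1)[OF R(1)]])
      then show "\<omega> x v = 0"
        using * \<zeta>0 by simp
      then show "R v = 0"
        using * by simp
    qed
    have "x = 0"
      using nondegenerate[OF R(2)] xv by blast
    moreover have "R = 0"
      using Rv spD(2)[OF R(1)] by fastforce
    ultimately show "p = 0"
      by (simp add: pe y z \<alpha> zero_prod_def)
  qed
  have surj: "q \<in> \<psi> ` lcarrier sp_ideal" if q: "q \<in> lcarrier (full_graph G)" for q
  proof -
    obtain s m where qe: "q = (s, m)" and s: "s \<in> derivations G" and m: "m \<in> C"
      using q by (cases q) (auto simp: C_def)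
    note sl = derivation_linear[OF G s, folded C_def]
    have "s c \<in> lie_center G"
    proof -
      have "lbracket G (s c) a = 0" if a: "a \<in> C" for a
        using derivationsD(4)[OF s, folded C_def, OF cC a] c_central[OF a] c_central[OF sl(1)] sl(5)
        by simp
      then show ?thesis
        using sl(1) by (simp add: lie_center_def C_def)
    qed
    then obtain k where sc: "s c = k *\<^sub>C c"
      unfolding center by blast
    have "linear_on V (\<lambda>v. \<zeta> (s v))"
      using VC sl by (simp add: linear_on_def \<zeta>add \<zeta>scale)
    then obtain x where x: "x \<in> V" "\<And>v. v \<in> V \<Longrightarrow> \<zeta> (s v) = \<omega> x v"
      by (rule form_represents) (rule that)
    define \<alpha> where "\<alpha> = k / 2"
    define R where "R = (\<lambda>v. if v \<in> V then (s v - \<zeta> (s v) *\<^sub>C c) - \<alpha> *\<^sub>C v else 0)"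
    have R: "R \<in> sp"
    proof -
      have pair: "\<omega> (R v) w + \<omega> v (R w) = 0" if v: "v \<in> V" and w: "w \<in> V" for v w
      proof -
        have "(k * \<omega> v w) *\<^sub>C c = s (lbracket G v w)"
          using br[OF VC[OF v] VC[OF w]] sl(4)[OF cC] sc by (simp add: mult.commute)
        also have "\<dots> = (\<omega> (s v) w + \<omega> v (s w)) *\<^sub>C c"
          using derivationsD(4)[OF s, folded C_def, OF VC[OF v] VC[OF w]] br VC[OF v] VC[OF w] sl(1)
          by (simp add: scaleC_add_left)
        finally have "k * \<omega> v w = \<omega> (s v) w + \<omega> v (s w)"
          using c0 by simp
        moreover have "\<omega> (s v) w = \<omega> (s v - \<zeta> (s v) *\<^sub>C c) w" "\<omega> v (s w) = \<omega> v (s w - \<zeta> (s w) *\<^sub>C c)"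
          using form_split[OF sl(1) VC[OF w]] form_split[OF VC[OF v] sl(1)] \<zeta>V[OF v] \<zeta>V[OF w] by simp_all
        moreover define P where "P = (\<lambda>v. s v - \<zeta> (s v) *\<^sub>C c)"
        ultimately have "k * \<omega> v w = \<omega> (P v) w + \<omega> v (P w)" "P v \<in> V" "P w \<in> V"
          using split[OF sl(1)] by simp_all
        moreover have "R v = P v - \<alpha> *\<^sub>C v" "R w = P w - \<alpha> *\<^sub>C w"
          using v w by (simp_all add: R_def P_def)
        ultimately show ?thesis
          using v w by (simp add: \<alpha>_def)
      qed
      have "R v \<in> V" if "v \<in> V" for v
        using split[OF sl(1)] that by (simp add: R_def)
      moreover have "linear_on V R"
        using VC sl by (simp add: linear_on_def R_def \<zeta>add \<zeta>scale algebra_simps)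
      ultimately show ?thesis
        using pair by (simp add: sp_def) (simp add: R_def)
    qed
    let ?y = "m - \<zeta> m *\<^sub>C c"
    have "s = S R \<alpha> x"
    proof (rule der_eqI[OF s Sder[OF R x(1)]])
      show "s v = S R \<alpha> x v" if "v \<in> V" for v
        using S_V[OF R x(1) that] x(2)[OF that] that by (simp add: R_def)
      show "s c = S R \<alpha> x c"
        using S_c[OF R x(1) closed(1)] sc by (simp add: \<alpha>_def)
    qed
    then have "q = \<psi> (R, \<alpha>, \<alpha>, x + (1 / 2) *\<^sub>C ?y, ?y, \<zeta> m)"
      by (simp add: \<psi>_def qe)
    then show ?thesis
      using R x(1) split[OF m] by (intro image_eqI[of _ _ "(R, \<alpha>, \<alpha>, x + (1 / 2) *\<^sub>C ?y, ?y, \<zeta> m)"]) simp_all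
  qed
  have "bij_betw \<psi> (lcarrier sp_ideal) (lcarrier (full_graph G))"
    using inj surj lie_homD(1)[OF hom] by (auto simp: bij_betw_def simp del: full_graph_simps)
  then have "full_graph G \<cong>\<^sub>L sp_ideal"
    using bij_hom_inverses[OF lie_algebra_sp_ideal hom] lie_inverses_sym lie_inverses_imp_isomorphic
    by blast
  then show ?thesis
    by (rule almost_complete_cong[OF sp_ideal_almost_complete lie_algebra_full_graph[OF G]])
qed

section \<open>Iterated full graphs\<close>

theorem theorem3:
  fixes \<gg> :: "'a::complex_vector lie_alg" and n :: nat
  assumes "heisenberg \<gg>" and "n \<ge> 1"
  shows
    "lie_center (full_graph_iter n \<gg>) = {0}
     \<and> (Der (full_graph_iter n \<gg>) \<cong>\<^sub>L full_graph_iter (n - 1) (Der (full_graph \<gg>))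
        \<and> lie_complete (Der (full_graph_iter n \<gg>))
        \<and> \<not> lie_complete (full_graph_iter n \<gg>))
     \<and> lie_derived (Der (full_graph_iter n \<gg>))
          \<subseteq> lie_ad (full_graph_iter n \<gg>) ` lcarrier (full_graph_iter n \<gg>)
     \<and> int (lie_dim (Der (full_graph_iter n \<gg>))) - int (lie_dim (full_graph_iter n \<gg>)) = 1"
proof -
  have g: "lie_algebra \<gg>"
    using assms(1) by (simp add: heisenberg_def)
  note iter = full_graph_iter[OF g]
  have Dg: "lie_algebra (Der (full_graph \<gg>))"
    by (intro lie_algebra_Der lie_algebra_full_graph g)
  note diter = full_graph_iter[OF Dg]
  have main: "almost_complete (full_graph_iter (Suc m) \<gg>) \<and>
      Der (full_graph_iter (Suc m) \<gg>) \<cong>\<^sub>L full_graph_iter m (Der (full_graph \<gg>))" for m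
  proof (induction m)
    case 0
    have iso: "full_graph_iter (Suc 0) \<gg> \<cong>\<^sub>L full_graph \<gg>"
      using isomorphic_trans[OF iter(3) full_graph_cong[OF iter(1) g iter(2)]] .
    have "almost_complete (full_graph_iter (Suc 0) \<gg>)"
      by (rule almost_complete_cong[OF almost_complete_full_graph_heisenberg[OF assms(1)] iter(1) iso])
    moreover have "Der (full_graph_iter (Suc 0) \<gg>) \<cong>\<^sub>L full_graph_iter 0 (Der (full_graph \<gg>))"
      using isomorphic_trans[OF Der_cong[OF iter(1) lie_algebra_full_graph[OF g] iso]
          isomorphic_sym[OF diter(2) diter(1)]] .
    ultimately show ?case ..
  next
    case (Suc m)
    let ?L = "full_graph_iter (Suc m) \<gg>" and ?L' = "full_graph_iter (Suc (Suc m)) \<gg>"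
    have AC: "almost_complete ?L" and D: "Der ?L \<cong>\<^sub>L full_graph_iter m (Der (full_graph \<gg>))"
      using Suc.IH by auto
    note hull = full_graph_hull[OF AC]
    have AL: "almost_complete (full_graph ?L)"
      by (rule complete_hull.almost_complete[OF hull])
    have "Der ?L' \<cong>\<^sub>L full_graph (Der ?L)"
      using isomorphic_trans[OF Der_cong[OF iter(1) lie_algebra_full_graph[OF iter(1)] iter(3)]
          complete_hull.Der_iso_hull[OF hull]] .
    then have "Der ?L' \<cong>\<^sub>L full_graph (full_graph_iter m (Der (full_graph \<gg>)))"
      using full_graph_cong[OF lie_algebra_Der[OF iter(1)] diter(1) D] by (rule isomorphic_trans)
    then have "Der ?L' \<cong>\<^sub>L full_graph_iter (Suc m) (Der (full_graph \<gg>))"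
      using isomorphic_sym[OF diter(3) diter(1)] by (rule isomorphic_trans)
    moreover have "almost_complete ?L'"
      by (rule almost_complete_cong[OF AL iter(1) iter(3)])
    ultimately show ?case
      by blast
  qed
  obtain m where n: "n = Suc m"
    using assms(2) by (cases n) auto
  let ?L = "full_graph_iter n \<gg>"
  have AC: "almost_complete ?L" and iso: "Der ?L \<cong>\<^sub>L full_graph_iter (n - 1) (Der (full_graph \<gg>))"
    using main[of m] by (simp_all add: n)
  have L: "lie_algebra ?L" and Z: "lie_center ?L = {0}" and comp: "lie_complete (Der ?L)"
    and comm: "\<And>s t. s \<in> derivations ?L \<Longrightarrow> t \<in> derivations ?L \<Longrightarrow>
      (s \<circ> t) - (t \<circ> s) \<in> lie_ad ?L ` lcarrier ?L"
    and outer: "\<exists>\<tau>\<in>derivations ?L. \<tau> \<notin> lie_ad ?L ` lcarrier ?L"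
    using AC by (auto simp: almost_complete_def)
  have "\<not> lie_complete ?L"
    using outer by (auto simp: lie_complete_def)
  moreover have "lie_derived (Der ?L) \<subseteq> lie_ad ?L ` lcarrier ?L"
    unfolding lie_derived_def
    using comm by (intro cvec.span_minimal subspace_linear_image[OF lie_algebraD(1)[OF L]
          lie_homD(2)[OF lie_ad_hom[OF L]]]) auto
  ultimately show ?thesis
    using Z iso comp almost_complete_dim[OF AC] by simp
qed

end
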